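(* Let $n\ge1$, $1<p<\infty$, $1<r<\infty$ and $0<s<\infty$. Suppose that there is a constant $C_p<\infty$ such that for all $\sigma\in L^\infty(\mathbb R^n)$ with $\sup_{k\in\mathbb Z}\|\sigma(2^k\cdot)\widehat\Psi\|_{L^r_s(\mathbb R^n)}<\infty$ we have $$\|T_\sigma\|_{L^p(\mathbb R^n)\to L^p(\mathbb R^n)}\le C_p\,\sup_{k\in\mathbb Z}\|\sigma(2^k\cdot)\widehat\Psi\|_{L^r_s(\mathbb R^n)}<\infty .$$ Then necessarily $rs\ge n$ and $\big|\frac1p-\frac12\big|\le\frac sn$.
   Context: The Fourier transform is $\widehat f(\xi)=\int_{\mathbb R^n}f(x)e^{-2\pi i x\cdot\xi}\,dx$. For a bounded function $\sigma$ on $\mathbb R^n$ and a Schwartz function $f$, $$T_\sigma(f)(x)=\int_{\mathbb R^n}\widehat f(\xi)\sigma(\xi)e^{2\pi i x\cdot\xi}\,d\xi .$$ For $s>0$, $(I-\Delta)^{s/2}$ denotes the operator given on the Fourier transform by multiplication by $(1+4\pi^2|\xi|^2)^{s/2}$, and $L^r_s$ is the Sobolev space of functions $h$ on $\mathbb R^n$ with norm $\|h\|_{L^r_s}=\|(I-\Delta)^{s/2}h\|_{L^r}<\infty$. $\Psi$ is a fixed Schwartz function on $\mathbb R^n$ whose Fourier transform is supported in the annulus $\{\xi:1/2<|\xi|<2\}$ and satisfies $\sum_{j\in\mathbb Z}\widehat\Psi(2^{-j}\xi)=1$ for all $\xi\ne0$. *)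

theory Defs
  imports "HOL-Analysis.Analysis"
begin

definition partial_deriv :: "'n \<Rightarrow> (real^'n \<Rightarrow> complex) \<Rightarrow> real^'n \<Rightarrow> complex" where
  "partial_deriv i f x = frechet_derivative f (at x) (axis i 1)"

fun iter_partial :: "'n list \<Rightarrow> (real^'n \<Rightarrow> complex) \<Rightarrow> real^'n \<Rightarrow> complex" where
  "iter_partial [] f = f"
| "iter_partial (i # is) f = partial_deriv i (iter_partial is f)"

definition schwartz :: "(real^'n \<Rightarrow> complex) \<Rightarrow> bool" where
  "schwartz f \<longleftrightarrow>
     (\<forall>is. (\<forall>x. iter_partial is f differentiable (at x)) \<and>
           (\<forall>N::nat. \<exists>B. \<forall>x. norm x ^ N * norm (iter_partial is f x) \<le> B))"

definition fourier :: "(real^'n \<Rightarrow> complex) \<Rightarrow> real^'n \<Rightarrow> complex" where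
  "fourier f \<xi> = (LINT x|lebesgue. f x * cis (- 2 * pi * (x \<bullet> \<xi>)))"

definition inv_fourier :: "(real^'n \<Rightarrow> complex) \<Rightarrow> real^'n \<Rightarrow> complex" where
  "inv_fourier f x = (LINT \<xi>|lebesgue. f \<xi> * cis (2 * pi * (x \<bullet> \<xi>)))"

text \<open>Only meant for measurable \<open>f\<close> and \<open>0 < p < \<infinity>\<close>; the value is \<open>\<infinity>\<close> if
  \<open>f\<close> is not \<open>p\<close>-integrable.\<close>

definition Lp_norm :: "real \<Rightarrow> (real^'n \<Rightarrow> complex) \<Rightarrow> ennreal" where
  "Lp_norm p f =
     (let I = (\<integral>\<^sup>+x. ennreal (norm (f x) powr p) \<partial>lebesgue)
      in if I = \<infinity> then \<infinity> else ennreal (enn2real I powr (1 / p)))"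

definition Linfty :: "(real^'n \<Rightarrow> complex) \<Rightarrow> bool" where
  "Linfty \<sigma> \<longleftrightarrow>
     \<sigma> \<in> borel_measurable lebesgue \<and> (\<exists>B::real. AE x in lebesgue. norm (\<sigma> x) \<le> B)"

definition multiplier_op ::
    "(real^'n \<Rightarrow> complex) \<Rightarrow> (real^'n \<Rightarrow> complex) \<Rightarrow> real^'n \<Rightarrow> complex" where
  "multiplier_op \<sigma> f = inv_fourier (\<lambda>\<xi>. fourier f \<xi> * \<sigma> \<xi>)"

text \<open>Norm from \<open>L\<^sup>p\<close> to \<open>L\<^sup>p\<close> of an operator given on the (dense) Schwartz class;
  the quotient is well defined since \<open>0 < Lp_norm p f < \<infinity>\<close> for Schwartz \<open>f \<noteq> 0\<close>.\<close>

definition Lp_op_norm ::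
    "real \<Rightarrow> ((real^'n \<Rightarrow> complex) \<Rightarrow> real^'n \<Rightarrow> complex) \<Rightarrow> ennreal" where
  "Lp_op_norm p T = (SUP f\<in>{f. schwartz f \<and> f \<noteq> (\<lambda>x. 0)}. Lp_norm p (T f) / Lp_norm p f)"

text \<open>For general \<open>h\<close> the function \<open>(I - \<Delta>)\<^bsup>s/2\<^esup> h\<close> is a tempered distribution.
  Distributions are represented by their action on Schwartz functions; the values on other
  arguments are irrelevant and never used. The operations below are the usual dual ones.\<close>

type_synonym 'n distr = "(real^'n \<Rightarrow> complex) \<Rightarrow> complex"

definition tempered_fun :: "(real^'n \<Rightarrow> complex) \<Rightarrow> bool" where
  "tempered_fun h \<longleftrightarrow>
     h \<in> borel_measurable lebesgue \<and>
     (\<forall>\<phi>. schwartz \<phi> \<longrightarrow> integrable lebesgue (\<lambda>x. h x * \<phi> x))"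

definition distr_of_fun :: "(real^'n \<Rightarrow> complex) \<Rightarrow> 'n distr" where
  "distr_of_fun h \<phi> = (LINT x|lebesgue. h x * \<phi> x)"

definition fourier_distr :: "'n::finite distr \<Rightarrow> 'n distr" where
  "fourier_distr u \<phi> = u (fourier \<phi>)"

definition inv_fourier_distr :: "'n::finite distr \<Rightarrow> 'n distr" where
  "inv_fourier_distr u \<phi> = u (inv_fourier \<phi>)"

definition mult_distr :: "(real^'n \<Rightarrow> complex) \<Rightarrow> 'n distr \<Rightarrow> 'n distr" where
  "mult_distr m u \<phi> = u (\<lambda>\<xi>. m \<xi> * \<phi> \<xi>)"

definition bessel_op :: "real \<Rightarrow> 'n::finite distr \<Rightarrow> 'n distr" where
  "bessel_op s u =
     inv_fourier_distr
       (mult_distr (\<lambda>\<xi>. complex_of_real ((1 + 4 * pi\<^sup>2 * (norm \<xi>)\<^sup>2) powr (s / 2)))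
         (fourier_distr u))"

text \<open>The \<open>L\<^sup>r\<close> norm of \<open>(I - \<Delta>)\<^bsup>s/2\<^esup> h\<close> if this distribution is (given by) an
  \<open>L\<^sup>r\<close> function \<open>g\<close>, and \<open>\<infinity>\<close> otherwise. Such a \<open>g\<close> is unique up to null sets, so that
  the infimum merely selects the common value of the norm; over the empty set it is \<open>\<infinity>\<close>.\<close>

definition sobolev_norm :: "real \<Rightarrow> real \<Rightarrow> (real^'n \<Rightarrow> complex) \<Rightarrow> ennreal" where
  "sobolev_norm r s h =
     (if tempered_fun h
      then INF g\<in>{g. tempered_fun g \<and>
                     (\<forall>\<phi>. schwartz \<phi> \<longrightarrow>
                        distr_of_fun g \<phi> = bessel_op s (distr_of_fun h) \<phi>)}.
             Lp_norm r g
      else \<infinity>)"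

text \<open>The annulus condition only asks that the Fourier transform vanish off the open annulus, so
  it also covers the case of closed support inside it.\<close>

definition littlewood_paley :: "(real^'n \<Rightarrow> complex) \<Rightarrow> bool" where
  "littlewood_paley \<Psi> \<longleftrightarrow>
     schwartz \<Psi> \<and>
     (\<forall>\<xi>. fourier \<Psi> \<xi> \<noteq> 0 \<longrightarrow> 1/2 < norm \<xi> \<and> norm \<xi> < 2) \<and>
     (\<forall>\<xi>. \<xi> \<noteq> 0 \<longrightarrow> ((\<lambda>j::int. fourier \<Psi> (2 powi (- j) *\<^sub>R \<xi>)) has_sum 1) UNIV)"

definition hormander_const ::
    "(real^'n \<Rightarrow> complex) \<Rightarrow> real \<Rightarrow> real \<Rightarrow> (real^'n \<Rightarrow> complex) \<Rightarrow> ennreal" where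
  "hormander_const \<Psi> r s \<sigma> =
     (SUP k::int. sobolev_norm r s (\<lambda>\<xi>. \<sigma> (2 powi k *\<^sub>R \<xi>) * fourier \<Psi> \<xi>))"

end

theory Submission
  imports Defs "HOL-Probability.Probability"
begin

text \<open>Both conditions come from testing the inequality on Gaussians, for which the Fourier transform
  and all \<open>L\<^sup>p\<close> norms are explicit.

  For \<open>r s \<ge> n\<close> take \<open>\<sigma>(\<xi>) = exp (- \<pi> L\<^sup>2 |\<xi> - a|\<^sup>2)\<close> with \<open>|a| = 1\<close> and \<open>f\<close> with the same Fourier
  transform. The operator norm stays bounded below as \<open>L\<close> grows, while the Sobolev norms of the
  localised pieces are \<open>O(L powr (s - n / r))\<close>.

  For the second condition take the chirp \<open>\<sigma>(\<xi>) = exp (- \<pi> z |\<xi>|\<^sup>2)\<close> with \<open>z = 1 + i \<lambda>\<close>, whose localised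
  pieces have Sobolev norm \<open>O(|z| powr s)\<close>. If \<open>p < 2\<close> it spreads a fixed Gaussian, if \<open>p > 2\<close> it focuses
  the Gaussian with Fourier transform \<open>exp (- \<pi> (1 - i \<lambda>) |\<xi>|\<^sup>2)\<close>; either way the \<open>L\<^sup>p\<close> norm grows by
  a factor of order \<open>|z| powr (n |1/p - 1/2|)\<close>.

  The fractional Sobolev norms are controlled by the moment inequality for \<open>A = I - \<Delta>\<close>: writing
  \<open>s / 2 = l + \<alpha>\<close>, the function \<open>A\<^sup>\<alpha> u\<close> with \<open>u = A\<^sup>l h\<close> is a multiple of the integral of
  \<open>t powr (- \<alpha> - 1) (u - exp (- t A) u)\<close> over \<open>t > 0\<close>, and the heat semigroup is a contraction
  on \<open>L\<^sup>r\<close>, so that only bounds for \<open>A\<^sup>l h\<close> and \<open>A\<^sup>l\<^sup>+\<^sup>1 h\<close> are needed.\<close>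

section \<open>Schwartz functions\<close>

text \<open>The exponents come from scaling. A bump of width 1/L has frequency L and L^r norm of
  order L^(-n/r). The transform of \<open>gauss z\<close> with Re z = 1 has height |z|^(-n/2) and
  width of order |z|, hence L^p norm of order |z|^(n/p - n/2); the sign of this exponent is why the
  Gaussian is spread for p < 2 and focused for p > 2.

  The obstacle is uniformity: each Sobolev bound must hold for all dyadic scales k and for the
  parameter tending to infinity, with s an arbitrary positive real. So all derivative bounds are
  recorded by one number K, the frequency of the localised piece. Every power of A costs K^2, with
  constants chosen before the Gaussian parameters, and the moment inequality converts two
  consecutive integer powers into K powr s.

  Only upper bounds for Sobolev norms are needed, and as these norms are infima over representing
  functions, one explicit representative is enough. On the operator side only moduli of Gaussians
  enter, so no branch of a complex power is ever fixed.\<close>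

lemma partial_derivI:
  "(f has_derivative D) (at x) \<Longrightarrow> partial_deriv i f x = D (axis i 1)"
  by (simp add: partial_deriv_def frechet_derivative_at[symmetric])

text \<open>The head of the index list is differentiated last, so a derivative taken before all
  others is appended at the end.\<close>

lemma iter_partial_snoc: "iter_partial is (partial_deriv i f) = iter_partial (is @ [i]) f"
  by (induction "is") auto

lemma schwartz_partial_deriv: "schwartz f \<Longrightarrow> schwartz (partial_deriv i f)"
  unfolding schwartz_def iter_partial_snoc by blast

lemma schwartz_differentiable: "schwartz f \<Longrightarrow> f differentiable (at x)"
  unfolding schwartz_def by (drule spec[where x = "[]"]) simp

lemma schwartz_decay0: "schwartz f \<Longrightarrow> \<exists>B. \<forall>x. norm x ^ N * norm (f x) \<le> B"
  unfolding schwartz_def by (drule spec[where x = "[]"]) simp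

text \<open>Iterated partials are never computed. The closure proofs below choose a class S stable
  under a single \<open>partial_deriv\<close>, and induction on the index list carries
  differentiability and decay to all orders.\<close>

lemma schwartz_coinduct:
  assumes "S f"
    and diff: "\<And>f x. S f \<Longrightarrow> f differentiable (at x)"
    and decay: "\<And>f N. S f \<Longrightarrow> \<exists>B. \<forall>x. norm x ^ N * norm (f x) \<le> B"
    and closed: "\<And>f i. S f \<Longrightarrow> S (partial_deriv i f)"
  shows "schwartz f"
proof -
  have "S (iter_partial is f)" for "is"
    by (induction "is") (auto simp: assms)
  then show ?thesis
    unfolding schwartz_def using diff decay by blast
qed

text \<open>The bounds for exponents 0 and N combine because (1 + t)^N is at most 2^N (1 + t^N). The
  inhomogeneous weight is the one that can be used near the origin as well.\<close>

lemma schwartz_decay: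
  assumes "schwartz f"
  obtains B where "B \<ge> 0" "\<And>x. (1 + norm x) ^ N * norm (f x) \<le> B"
proof -
  obtain B0 where B0: "\<And>x. norm (f x) \<le> B0"
    using schwartz_decay0[OF assms, of 0] by auto
  obtain B1 where B1: "\<And>x. norm x ^ N * norm (f x) \<le> B1"
    using schwartz_decay0[OF assms, of N] by auto
  have "(1 + norm x) ^ N * norm (f x) \<le> 2 ^ N * (B0 + B1)" for x
  proof -
    have "(1 + norm x) ^ N \<le> (2 * max 1 (norm x)) ^ N"
      by (intro power_mono) auto
    also have "\<dots> = 2 ^ N * max 1 (norm x) ^ N"
      by (simp add: power_mult_distrib)
    also have "max 1 (norm x) ^ N \<le> 1 + norm x ^ N"
      by (cases "norm x \<le> 1") (auto simp: max_def)
    finally have "(1 + norm x) ^ N * norm (f x) \<le> 2 ^ N * (1 + norm x ^ N) * norm (f x)"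
      by (simp add: mult_right_mono)
    also have "\<dots> = 2 ^ N * (norm (f x) + norm x ^ N * norm (f x))"
      by (simp add: algebra_simps)
    also have "\<dots> \<le> 2 ^ N * (B0 + B1)"
      using B0[of x] B1[of x] by (intro mult_left_mono add_mono) auto
    finally show ?thesis .
  qed
  moreover from this[of 0] have "0 \<le> 2 ^ N * (B0 + B1)"
    by (simp add: order_trans[OF norm_ge_zero])
  ultimately show ?thesis using that by blast
qed

lemma has_derivative_partial:
  fixes f :: "real^'n \<Rightarrow> complex"
  assumes "f differentiable (at x)"
  shows "(f has_derivative (\<lambda>h. \<Sum>i\<in>UNIV. of_real (h $ i) * partial_deriv i f x)) (at x)"
proof -
  obtain D where D: "(f has_derivative D) (at x)"
    using assms unfolding differentiable_def by blast
  then interpret bounded_linear D by (rule has_derivative_bounded_linear)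
  have "D h = (\<Sum>i\<in>UNIV. of_real (h $ i) * partial_deriv i f x)" for h
  proof -
    have "D h = D (\<Sum>i\<in>UNIV. (h $ i) *\<^sub>R axis i 1)"
      by (simp only: basis_expansion flip: scalar_mult_eq_scaleR)
    also have "\<dots> = (\<Sum>i\<in>UNIV. of_real (h $ i) * partial_deriv i f x)"
      by (simp add: sum scaleR partial_derivI[OF D] scaleR_conv_of_real[where 'a = complex]
          del: scaleR_conv_of_real)
    finally show ?thesis .
  qed
  then have "D = (\<lambda>h. \<Sum>i\<in>UNIV. of_real (h $ i) * partial_deriv i f x)" ..
  then show ?thesis using D by simp
qed

lemma partial_deriv_add:
  assumes "f differentiable (at x)" "g differentiable (at x)"
  shows "partial_deriv i (\<lambda>x. f x + g x) x = partial_deriv i f x + partial_deriv i g x"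
proof -
  obtain D E where D: "(f has_derivative D) (at x)" "(g has_derivative E) (at x)"
    using assms unfolding differentiable_def by blast
  from partial_derivI[OF has_derivative_add[OF this]] show ?thesis
    by (simp add: partial_derivI[OF D(1)] partial_derivI[OF D(2)])
qed

lemma partial_deriv_mult:
  assumes "f differentiable (at x)" "g differentiable (at x)"
  shows "partial_deriv i (\<lambda>x. f x * g x) x = f x * partial_deriv i g x + partial_deriv i f x * g x"
proof -
  obtain D E where D: "(f has_derivative D) (at x)" "(g has_derivative E) (at x)"
    using assms unfolding differentiable_def by blast
  from partial_derivI[OF has_derivative_mult[OF this]] show ?thesis
    by (simp add: partial_derivI[OF D(1)] partial_derivI[OF D(2)])
qed

lemma partial_deriv_const: "partial_deriv i (\<lambda>x. c) x = 0"
  using partial_derivI[OF has_derivative_const] by fastforce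

lemma partial_deriv_coord:
  "partial_deriv i (\<lambda>x. of_real (x $ j)) x = (if i = j then 1 else 0)"
proof -
  have "((\<lambda>x. complex_of_real (x $ j)) has_derivative (\<lambda>h. of_real (h $ j))) (at x)"
    by (intro bounded_linear_imp_has_derivative bounded_linear_compose[OF bounded_linear_of_real bounded_linear_vec_nth])
  from partial_derivI[OF this] show ?thesis by (simp add: axis_def)
qed

lemma differentiable_coord: "(\<lambda>x. complex_of_real (x $ j)) differentiable (at x)"
proof -
  have "((\<lambda>x. complex_of_real (x $ j)) has_derivative (\<lambda>h. of_real (h $ j))) (at x)"
    by (intro bounded_linear_imp_has_derivative bounded_linear_compose[OF bounded_linear_of_real bounded_linear_vec_nth])
  then show ?thesis unfolding differentiable_def by blast
qed

lemma schwartz_add: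
  assumes "schwartz f" "schwartz g"
  shows "schwartz (\<lambda>x. f x + g x)"
proof (rule schwartz_coinduct[where S = "\<lambda>k. \<exists>f g. schwartz f \<and> schwartz g \<and> k = (\<lambda>x. f x + g x)"])
  show "\<exists>f' g'. schwartz f' \<and> schwartz g' \<and> (\<lambda>x. f x + g x) = (\<lambda>x. f' x + g' x)"
    using assms by blast
next
  fix k :: "real^'a \<Rightarrow> complex" and x
  assume "\<exists>f g. schwartz f \<and> schwartz g \<and> k = (\<lambda>x. f x + g x)"
  then show "k differentiable at x" using schwartz_differentiable by (auto intro!: differentiable_add)
next
  fix k :: "real^'a \<Rightarrow> complex" and N
  assume "\<exists>f g. schwartz f \<and> schwartz g \<and> k = (\<lambda>x. f x + g x)"
  then obtain f g where k: "schwartz f" "schwartz g" "k = (\<lambda>x. f x + g x)" by blast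
  obtain B where B: "\<And>x. norm x ^ N * norm (f x) \<le> B" using schwartz_decay0[OF k(1)] by blast
  obtain C where C: "\<And>x. norm x ^ N * norm (g x) \<le> C" using schwartz_decay0[OF k(2)] by blast
  have "norm x ^ N * norm (k x) \<le> B + C" for x
  proof -
    have "norm x ^ N * norm (k x) \<le> norm x ^ N * (norm (f x) + norm (g x))"
      unfolding k(3) by (intro mult_left_mono norm_triangle_ineq) auto
    then show ?thesis using B[of x] C[of x] by (simp add: distrib_left)
  qed
  then show "\<exists>B. \<forall>x. norm x ^ N * norm (k x) \<le> B" by blast
next
  fix k :: "real^'a \<Rightarrow> complex" and i
  assume "\<exists>f g. schwartz f \<and> schwartz g \<and> k = (\<lambda>x. f x + g x)"
  then obtain f g where k: "schwartz f" "schwartz g" "k = (\<lambda>x. f x + g x)" by blast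
  have "partial_deriv i k = (\<lambda>x. partial_deriv i f x + partial_deriv i g x)"
    unfolding k(3) using k schwartz_differentiable by (auto intro!: partial_deriv_add)
  then show "\<exists>f g. schwartz f \<and> schwartz g \<and> partial_deriv i k = (\<lambda>x. f x + g x)"
    using k schwartz_partial_deriv by blast
qed

lemma schwartz_cmult:
  assumes "schwartz f"
  shows "schwartz (\<lambda>x. c * f x)"
proof (rule schwartz_coinduct[where S = "\<lambda>k. \<exists>f. schwartz f \<and> k = (\<lambda>x. c * f x)"])
  show "\<exists>f'. schwartz f' \<and> (\<lambda>x. c * f x) = (\<lambda>x. c * f' x)"
    using assms by blast
next
  fix k :: "real^'a \<Rightarrow> complex" and x
  assume "\<exists>f. schwartz f \<and> k = (\<lambda>x. c * f x)"
  then show "k differentiable at x" using schwartz_differentiable by (auto intro!: differentiable_mult)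
next
  fix k :: "real^'a \<Rightarrow> complex" and N
  assume "\<exists>f. schwartz f \<and> k = (\<lambda>x. c * f x)"
  then obtain f where k: "schwartz f" "k = (\<lambda>x. c * f x)" by blast
  obtain B where B: "\<And>x. norm x ^ N * norm (f x) \<le> B" using schwartz_decay0[OF k(1)] by blast
  have "norm x ^ N * norm (k x) \<le> norm c * B" for x
    using mult_left_mono[OF B[of x], of "norm c"] by (simp add: k(2) norm_mult mult_ac)
  then show "\<exists>B. \<forall>x. norm x ^ N * norm (k x) \<le> B" by blast
next
  fix k :: "real^'a \<Rightarrow> complex" and i
  assume "\<exists>f. schwartz f \<and> k = (\<lambda>x. c * f x)"
  then obtain f where k: "schwartz f" "k = (\<lambda>x. c * f x)" by blast
  have "partial_deriv i k = (\<lambda>x. c * partial_deriv i f x)"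
    unfolding k(2) by (intro ext, subst partial_deriv_mult)
      (simp_all add: partial_deriv_const schwartz_differentiable[OF k(1)])
  then show "\<exists>f. schwartz f \<and> partial_deriv i k = (\<lambda>x. c * f x)"
    using k schwartz_partial_deriv by blast
qed

text \<open>The product rule produces an additional term f when the differentiation index is j, so
  the invariant class has to be x_j f + g with f and g both Schwartz.\<close>

lemma schwartz_coord_mult:
  fixes f :: "real^'n \<Rightarrow> complex"
  assumes "schwartz f"
  shows "schwartz (\<lambda>x. of_real (x $ j) * f x)"
proof (rule schwartz_coinduct[where S = "\<lambda>k. \<exists>f g. schwartz f \<and> schwartz g \<and> k = (\<lambda>x. of_real (x $ j) * f x + g x)"])
  have "schwartz (\<lambda>x. 0 * f x)" using assms by (rule schwartz_cmult)
  then have "schwartz (\<lambda>x::real^'n. 0)" by simp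
  then show "\<exists>f' g. schwartz f' \<and> schwartz g \<and> (\<lambda>x. of_real (x $ j) * f x) = (\<lambda>x. of_real (x $ j) * f' x + g x)"
    using assms by (intro exI[of _ f] exI[of _ "\<lambda>x. 0"]) auto
next
  fix k :: "real^'n \<Rightarrow> complex" and x
  assume "\<exists>f g. schwartz f \<and> schwartz g \<and> k = (\<lambda>x. of_real (x $ j) * f x + g x)"
  then show "k differentiable at x" using schwartz_differentiable differentiable_coord
    by (auto intro!: differentiable_add differentiable_mult)
next
  fix k :: "real^'n \<Rightarrow> complex" and N
  assume "\<exists>f g. schwartz f \<and> schwartz g \<and> k = (\<lambda>x. of_real (x $ j) * f x + g x)"
  then obtain f g where k: "schwartz f" "schwartz g" "k = (\<lambda>x. of_real (x $ j) * f x + g x)" by blast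
  obtain B where B: "\<And>x. norm x ^ Suc N * norm (f x) \<le> B" using schwartz_decay0[OF k(1)] by blast
  obtain C where C: "\<And>x. norm x ^ N * norm (g x) \<le> C" using schwartz_decay0[OF k(2)] by blast
  have "norm x ^ N * norm (k x) \<le> B + C" for x
  proof -
    have "norm (k x) \<le> \<bar>x $ j\<bar> * norm (f x) + norm (g x)"
      unfolding k(3) by (rule order_trans[OF norm_triangle_ineq]) (simp add: norm_mult)
    also have "\<dots> \<le> norm x * norm (f x) + norm (g x)"
      by (intro add_mono mult_right_mono component_le_norm_cart) auto
    finally have "norm x ^ N * norm (k x) \<le> norm x ^ N * (norm x * norm (f x) + norm (g x))"
      by (intro mult_left_mono) auto
    also have "\<dots> = norm x ^ Suc N * norm (f x) + norm x ^ N * norm (g x)"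
      by (simp add: algebra_simps)
    also have "\<dots> \<le> B + C" using B[of x] C[of x] by simp
    finally show ?thesis .
  qed
  then show "\<exists>B. \<forall>x. norm x ^ N * norm (k x) \<le> B" by blast
next
  fix k :: "real^'n \<Rightarrow> complex" and i
  assume "\<exists>f g. schwartz f \<and> schwartz g \<and> k = (\<lambda>x. of_real (x $ j) * f x + g x)"
  then obtain f g where k: "schwartz f" "schwartz g" "k = (\<lambda>x. of_real (x $ j) * f x + g x)" by blast
  have "partial_deriv i k = (\<lambda>x. of_real (x $ j) * partial_deriv i f x + ((if i = j then 1 else 0) * f x + partial_deriv i g x))"
    unfolding k(3)
    by (intro ext, subst partial_deriv_add)
      (simp_all add: partial_deriv_mult partial_deriv_coord differentiable_mult differentiable_coord
        schwartz_differentiable k(1,2))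
  moreover have "schwartz (\<lambda>x. (if i = j then 1 else 0) * f x + partial_deriv i g x)"
    using k schwartz_partial_deriv by (intro schwartz_add schwartz_cmult) auto
  ultimately show "\<exists>f g. schwartz f \<and> schwartz g \<and> partial_deriv i k = (\<lambda>x. of_real (x $ j) * f x + g x)"
    using k schwartz_partial_deriv by blast
qed

lemma schwartz_reflect:
  assumes "schwartz f"
  shows "schwartz (\<lambda>x. f (- x))"
proof (rule schwartz_coinduct[where S = "\<lambda>k. \<exists>f. schwartz f \<and> k = (\<lambda>x. f (- x))"])
  show "\<exists>f'. schwartz f' \<and> (\<lambda>x. f (- x)) = (\<lambda>x. f' (- x))"
    using assms by blast
next
  fix k :: "real^'a \<Rightarrow> complex" and x
  assume "\<exists>f. schwartz f \<and> k = (\<lambda>x. f (- x))"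
  then obtain f where k: "schwartz f" "k = (\<lambda>x. f (- x))" by blast
  show "k differentiable at x"
    unfolding k(2) using differentiable_compose[of f uminus x UNIV] schwartz_differentiable[OF k(1)]
    by auto
next
  fix k :: "real^'a \<Rightarrow> complex" and N
  assume "\<exists>f. schwartz f \<and> k = (\<lambda>x. f (- x))"
  then obtain f where k: "schwartz f" "k = (\<lambda>x. f (- x))" by blast
  obtain B where "\<And>x. norm x ^ N * norm (f x) \<le> B" using schwartz_decay0[OF k(1)] by blast
  from this[of "- x" for x] show "\<exists>B. \<forall>x. norm x ^ N * norm (k x) \<le> B" by (auto simp: k)
next
  fix k :: "real^'a \<Rightarrow> complex" and i
  assume "\<exists>f. schwartz f \<and> k = (\<lambda>x. f (- x))"
  then obtain f where k: "schwartz f" "k = (\<lambda>x. f (- x))" by blast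
  have "partial_deriv i k = (\<lambda>x. (\<lambda>y. - 1 * partial_deriv i f y) (- x))"
  proof
    fix x
    have "(f has_derivative (\<lambda>h. \<Sum>i\<in>UNIV. of_real (h $ i) * partial_deriv i f (- x))) (at (- x))"
      by (rule has_derivative_partial) (rule schwartz_differentiable[OF k(1)])
    then have "(k has_derivative (\<lambda>h. \<Sum>i\<in>UNIV. of_real ((- h) $ i) * partial_deriv i f (- x))) (at x)"
      unfolding k(2) by (rule has_derivative_compose[OF has_derivative_minus[OF has_derivative_ident]])
    from partial_derivI[OF this, of i]
    show "partial_deriv i k x = (\<lambda>y. - 1 * partial_deriv i f y) (- x)"
      by (simp add: axis_def if_distrib[of of_real] if_distrib[of "\<lambda>z. z * _"] sum.delta' sum_negf cong: if_cong)
  qed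
  then show "\<exists>f. schwartz f \<and> partial_deriv i k = (\<lambda>x. f (- x))"
    by (intro exI[of _ "\<lambda>y. - 1 * partial_deriv i f y"] conjI schwartz_cmult
      schwartz_partial_deriv k(1)) simp
qed

lemma schwartz_continuous: "schwartz f \<Longrightarrow> continuous_on UNIV f"
  by (intro continuous_at_imp_continuous_on ballI differentiable_imp_continuous_within
    schwartz_differentiable)

lemma schwartz_borel: "schwartz f \<Longrightarrow> f \<in> borel_measurable borel"
  by (rule borel_measurable_continuous_onI[OF schwartz_continuous])

section \<open>Integrability from polynomial decay\<close>

lemma nn_integral_inverse_1_plus_square_finite:
  "(\<integral>\<^sup>+x. ennreal (1 / (1 + x\<^sup>2)) \<partial>lborel) < \<infinity>"
proof -
  have "set_integrable lborel (einterval (- \<infinity>) \<infinity>) (\<lambda>x. inverse (1 + x^2) :: real)"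
    using integrable_inverse_1_plus_square by (simp add: interval_lebesgue_integrable_def)
  then have "integrable lborel (\<lambda>x. 1 / (1 + x^2) :: real)"
    by (simp add: set_integrable_def inverse_eq_divide)
  then have "(\<integral>\<^sup>+x. ennreal (norm (1 / (1 + x\<^sup>2) :: real)) \<partial>lborel) < \<infinity>"
    by (simp only: integrable_iff_bounded)
  then show ?thesis by simp
qed

text \<open>Each coordinate is bounded by the norm, so the product of all 1 + x_b^2 is at most (1 +
  |x|)^(2n). The decay hypothesis therefore dominates f by a product of one-dimensional integrable
  functions, whose integral factorises.\<close>

lemma integrable_decay:
  fixes f :: "'a::euclidean_space \<Rightarrow> 'b::{banach, second_countable_topology}"
  assumes [measurable]: "f \<in> borel_measurable borel"
    and B: "\<And>x. (1 + norm x) ^ (2 * DIM('a)) * norm (f x) \<le> B"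
  shows "integrable lborel f"
proof (rule integrableI_bounded)
  have B0: "B \<ge> 0" using B[of 0] norm_ge_zero[of "f 0"] by (simp del: norm_ge_zero)
  have "norm (f x) \<le> B * (\<Prod>b\<in>Basis. 1 / (1 + (x \<bullet> b)\<^sup>2))" for x
  proof -
    have "(\<Prod>b\<in>(Basis::'a set). 1 + (x \<bullet> b)\<^sup>2) \<le> (\<Prod>b\<in>(Basis::'a set). (1 + norm x)\<^sup>2)"
    proof (rule prod_mono)
      fix b :: 'a assume b: "b \<in> Basis"
      have "(x \<bullet> b)\<^sup>2 \<le> (norm x)\<^sup>2"
        using Basis_le_norm[OF b, of x] by (simp add: abs_le_square_iff[symmetric])
      also have "1 + \<dots> \<le> (1 + norm x)\<^sup>2" by (simp add: power2_eq_square algebra_simps)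
      finally show "0 \<le> 1 + (x \<bullet> b)\<^sup>2 \<and> 1 + (x \<bullet> b)\<^sup>2 \<le> (1 + norm x)\<^sup>2" by auto
    qed
    also have "\<dots> = (1 + norm x) ^ (2 * DIM('a))"
      by (simp add: power_mult)
    finally have "(\<Prod>b\<in>(Basis::'a set). 1 + (x \<bullet> b)\<^sup>2) * norm (f x) \<le> B"
      using B[of x] by (meson mult_right_mono norm_ge_zero order_trans)
    moreover have "(\<Prod>b\<in>(Basis::'a set). 1 + (x \<bullet> b)\<^sup>2) > 0"
      by (intro prod_pos) (auto simp: add_pos_nonneg)
    ultimately show ?thesis
      by (simp add: prod_dividef field_simps)
  qed
  then have "(\<integral>\<^sup>+x. ennreal (norm (f x)) \<partial>lborel) \<le>
     (\<integral>\<^sup>+x. ennreal B * (\<Prod>b\<in>Basis. ennreal (1 / (1 + (x \<bullet> b)\<^sup>2))) \<partial>(lborel::'a measure))"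
    by (intro nn_integral_mono) (simp add: prod_ennreal ennreal_mult'[symmetric] B0 prod_nonneg ennreal_leI)
  also have "\<dots> = ennreal B * (\<integral>\<^sup>+x. (\<Prod>b\<in>Basis. ennreal (1 / (1 + (x \<bullet> b)\<^sup>2))) \<partial>(lborel::'a measure))"
    by (rule nn_integral_cmult) measurable
  also have "(\<integral>\<^sup>+x. (\<Prod>b\<in>Basis. ennreal (1 / (1 + (x \<bullet> b)\<^sup>2))) \<partial>(lborel::'a measure)) =
      (\<Prod>b\<in>(Basis::'a set). (\<integral>\<^sup>+x. ennreal (1 / (1 + x\<^sup>2)) \<partial>lborel))"
    by (rule nn_integral_lborel_prod) auto
  also have "ennreal B * \<dots> < \<infinity>"
    using nn_integral_inverse_1_plus_square_finite
    by (simp add: ennreal_mult_less_top power_less_top_ennreal)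
  finally show "(\<integral>\<^sup>+x. ennreal (norm (f x)) \<partial>lborel) < \<infinity>" .
qed simp

lemma schwartz_integrable_power:
  fixes f :: "real^'n \<Rightarrow> complex"
  assumes "schwartz f"
  shows "integrable lborel (\<lambda>x. (1 + norm x) ^ N *\<^sub>R f x)"
proof -
  obtain B where B: "\<And>x. (1 + norm x) ^ (2 * DIM(real^'n) + N) * norm (f x) \<le> B"
    using schwartz_decay[OF assms, where N = "2 * DIM(real^'n) + N"] by blast
  show ?thesis
  proof (rule integrable_decay)
    show "(1 + norm x) ^ (2 * DIM(real^'n)) * norm ((1 + norm x) ^ N *\<^sub>R f x) \<le> B" for x
      using B[of x] by (simp only: norm_scaleR abs_of_nonneg power_add mult.assoc
        zero_le_power norm_ge_zero add_nonneg_nonneg zero_le_one)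
    show "(\<lambda>x. (1 + norm x) ^ N *\<^sub>R f x) \<in> borel_measurable borel"
      by (intro borel_measurable_continuous_onI continuous_intros schwartz_continuous[OF assms])
  qed
qed

lemma schwartz_integrable: "schwartz f \<Longrightarrow> integrable lborel f"
  using schwartz_integrable_power[of f 0] by simp

lemma schwartz_bounded:
  assumes "schwartz f" obtains B where "B \<ge> 0" "\<And>x. norm (f x) \<le> B"
  using schwartz_decay[OF assms, of 0] by auto

section \<open>Fourier transform of Schwartz functions\<close>

lemma integral_lebesgue_lborel:
  fixes f :: "'a::euclidean_space \<Rightarrow> 'b::{banach, second_countable_topology}"
  assumes "f \<in> borel_measurable borel"
  shows "integral\<^sup>L lebesgue f = integral\<^sup>L lborel f"
  using assms by (simp add: integral_completion)

lemma nn_integral_lebesgue_lborel: "integral\<^sup>N lebesgue f = integral\<^sup>N lborel f"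
  by (rule nn_integral_completion)

lemma integral_lborel_translate:
  fixes f :: "'a::euclidean_space \<Rightarrow> 'b::{banach, second_countable_topology}"
  assumes [measurable]: "f \<in> borel_measurable borel"
  shows "(LINT x|lborel. f (x + a)) = (LINT x|lborel. f x)"
proof -
  have "(LINT x|lborel. f x) = (LINT x|distr lborel borel ((+) a). f x)"
    by (simp add: lborel_distr_plus)
  also have "\<dots> = (LINT x|lborel. f (a + x))"
    by (rule integral_distr) auto
  finally show ?thesis by (simp add: add.commute)
qed

lemma nn_integral_lborel_translate:
  fixes f :: "'a::euclidean_space \<Rightarrow> ennreal"
  assumes [measurable]: "f \<in> borel_measurable borel"
  shows "(\<integral>\<^sup>+x. f (x + a) \<partial>lborel) = (\<integral>\<^sup>+x. f x \<partial>lborel)"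
proof -
  have "(\<integral>\<^sup>+x. f x \<partial>lborel) = (\<integral>\<^sup>+x. f x \<partial>distr lborel borel ((+) a))"
    by (simp add: lborel_distr_plus)
  also have "\<dots> = (\<integral>\<^sup>+x. f (a + x) \<partial>lborel)"
    by (rule nn_integral_distr) auto
  finally show ?thesis by (simp add: add.commute)
qed

lemma integrable_lborel_translate:
  fixes f :: "'a::euclidean_space \<Rightarrow> 'b::{banach, second_countable_topology}"
  assumes "integrable lborel f"
  shows "integrable lborel (\<lambda>x. f (x + a))"
proof -
  have "integrable (distr lborel borel ((+) a)) f"
    using assms by (simp add: lborel_distr_plus)
  then have "integrable lborel (\<lambda>x. f (a + x))"
    by (rule integrable_distr[rotated]) simp
  then show ?thesis by (simp add: add.commute)
qed

lemma borel_measurable_cis [measurable]: "cis \<in> borel_measurable borel"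
  by (intro borel_measurable_continuous_onI continuous_intros)

lemma integrable_mult_cis:
  fixes f :: "'a::euclidean_space \<Rightarrow> complex"
  assumes "integrable lborel f" and [measurable]: "g \<in> borel_measurable borel"
  shows "integrable lborel (\<lambda>x. f x * cis (g x))"
proof (rule Bochner_Integration.integrable_bound[OF assms(1)])
  have [measurable]: "f \<in> borel_measurable borel"
    using borel_measurable_integrable[OF assms(1)] by simp
  show "(\<lambda>x. f x * cis (g x)) \<in> borel_measurable lborel" by measurable
qed (simp add: norm_mult)

lemma fourier_eq:
  assumes [measurable]: "f \<in> borel_measurable borel"
  shows "fourier f \<xi> = (LINT x|lborel. f x * cis (- 2 * pi * (x \<bullet> \<xi>)))"
  unfolding fourier_def by (rule integral_lebesgue_lborel) measurable

lemma inv_fourier_eq_fourier: "inv_fourier f x = fourier f (- x)"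
  by (simp add: inv_fourier_def fourier_def inner_commute)

lemma norm_fourier_le:
  assumes "f \<in> borel_measurable borel"
  shows "norm (fourier f \<xi>) \<le> (LINT x|lborel. norm (f x))"
  unfolding fourier_eq[OF assms] by (rule order_trans[OF integral_norm_bound]) (simp add: norm_mult)

lemma norm_cis_diff_le: "norm (cis t - 1 - \<i> * of_real t) \<le> t\<^sup>2 / 2"
  using iexp_approx1[of t 1] by (simp add: cis_conv_exp algebra_simps power2_eq_square)

text \<open>Instead of differentiating under the integral, the remainder is estimated directly: cis
  t differs from its linear part by at most t^2 / 2, so the error at increment h is at most C |h|^2
  with C controlled by a second moment of f.\<close>

lemma fourier_has_derivative:
  fixes f :: "real^'n \<Rightarrow> complex"
  assumes f: "schwartz f"
  shows "(fourier f has_derivative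
    (\<lambda>h. \<Sum>i\<in>UNIV. of_real (h $ i) * fourier (\<lambda>x. (- 2 * pi * \<i>) * (of_real (x $ i) * f x)) \<xi>)) (at \<xi>)"
    (is "(_ has_derivative ?D) _")
proof -
  have [measurable]: "f \<in> borel_measurable borel" by (rule schwartz_borel[OF f])
  define C where "C = (LINT x|lborel. (2 * pi\<^sup>2) * norm ((1 + norm x) ^ 2 *\<^sub>R f x))"
  have int_i: "integrable lborel (\<lambda>x. (- 2 * pi * \<i>) * (of_real (x $ i) * f x) * cis (- 2 * pi * (x \<bullet> \<xi>)))" for i
    by (intro integrable_mult_cis schwartz_integrable schwartz_cmult schwartz_coord_mult f) measurable
  have int: "integrable lborel (\<lambda>x. f x * cis (- 2 * pi * (x \<bullet> \<eta>)))" for \<eta>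
    by (intro integrable_mult_cis schwartz_integrable f) measurable
  have main: "norm (fourier f (\<xi> + h) - fourier f \<xi> - ?D h) \<le> C * norm h ^ 2" for h
  proof -
    let ?g = "\<lambda>x. f x * cis (- 2 * pi * (x \<bullet> \<xi>)) * (cis (- 2 * pi * (x \<bullet> h)) - 1 - \<i> * of_real (- 2 * pi * (x \<bullet> h)))"
    have D: "?D h = (LINT x|lborel. (\<Sum>i\<in>UNIV. of_real (h $ i) * ((- 2 * pi * \<i>) * (of_real (x $ i) * f x) * cis (- 2 * pi * (x \<bullet> \<xi>)))))"
      using int_i by (simp add: fourier_eq)
    have "fourier f (\<xi> + h) - fourier f \<xi> - ?D h = (LINT x|lborel. f x * cis (- 2 * pi * (x \<bullet> (\<xi> + h))) - f x * cis (- 2 * pi * (x \<bullet> \<xi>)) -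
      (\<Sum>i\<in>UNIV. of_real (h $ i) * ((- 2 * pi * \<i>) * (of_real (x $ i) * f x) * cis (- 2 * pi * (x \<bullet> \<xi>)))))"
      unfolding D fourier_eq[OF \<open>f \<in> borel_measurable borel\<close>]
      by (simp only: Bochner_Integration.integral_diff[OF Bochner_Integration.integrable_diff[OF int int]
            Bochner_Integration.integrable_sum[OF integrable_mult_right[OF int_i]]]
          Bochner_Integration.integral_diff[OF int int])
    also have "\<dots> = (LINT x|lborel. ?g x)"
    proof (intro Bochner_Integration.integral_cong refl)
      fix x :: "real^'n"
      have "(\<Sum>i\<in>UNIV. of_real (h $ i) * ((- 2 * pi * \<i>) * (of_real (x $ i) * f x) * cis (- 2 * pi * (x \<bullet> \<xi>)))) =
        (- 2 * pi * \<i>) * f x * cis (- 2 * pi * (x \<bullet> \<xi>)) * (\<Sum>i\<in>UNIV. of_real (x $ i * h $ i))"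
        by (simp add: sum_distrib_left sum_negf mult_ac)
      also have "(\<Sum>i\<in>UNIV. complex_of_real (x $ i * h $ i)) = of_real (x \<bullet> h)"
        by (simp add: inner_vec_def)
      finally have S: "(\<Sum>i\<in>UNIV. of_real (h $ i) * ((- 2 * pi * \<i>) * (of_real (x $ i) * f x) * cis (- 2 * pi * (x \<bullet> \<xi>)))) =
        (- 2 * pi * \<i>) * f x * cis (- 2 * pi * (x \<bullet> \<xi>)) * of_real (x \<bullet> h)" .
      have split: "cis (- 2 * pi * (x \<bullet> (\<xi> + h))) = cis (- 2 * pi * (x \<bullet> \<xi>)) * cis (- 2 * pi * (x \<bullet> h))"
        by (simp only: inner_add_right distrib_left cis_mult)
      show "f x * cis (- 2 * pi * (x \<bullet> (\<xi> + h))) - f x * cis (- 2 * pi * (x \<bullet> \<xi>)) -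
        (\<Sum>i\<in>UNIV. of_real (h $ i) * ((- 2 * pi * \<i>) * (of_real (x $ i) * f x) * cis (- 2 * pi * (x \<bullet> \<xi>)))) = ?g x"
        unfolding S split by (simp add: ring_distribs)
    qed
    finally have "norm (fourier f (\<xi> + h) - fourier f \<xi> - ?D h) \<le> (LINT x|lborel. norm (?g x))"
      by (simp only: integral_norm_bound)
    also have "\<dots> \<le> (LINT x|lborel. (2 * pi\<^sup>2) * norm ((1 + norm x) ^ 2 *\<^sub>R f x) * norm h ^ 2)"
    proof (rule integral_mono')
      show "integrable lborel (\<lambda>x. (2 * pi\<^sup>2) * norm ((1 + norm x) ^ 2 *\<^sub>R f x) * norm h ^ 2)"
        by (intro integrable_mult_left integrable_mult_right integrable_norm schwartz_integrable_power f)
      fix x :: "real^'n"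
      have "norm (?g x) \<le> norm (f x) * ((- 2 * pi * (x \<bullet> h))\<^sup>2 / 2)"
        unfolding norm_mult norm_cis mult_1_right by (intro mult_left_mono norm_cis_diff_le) simp
      also have "\<dots> = (2 * pi\<^sup>2) * norm (f x) * \<bar>x \<bullet> h\<bar>\<^sup>2"
        by (simp add: power2_eq_square)
      also have "\<dots> \<le> (2 * pi\<^sup>2) * norm (f x) * ((1 + norm x) * norm h)\<^sup>2"
      proof (intro mult_left_mono power_mono)
        show "\<bar>x \<bullet> h\<bar> \<le> (1 + norm x) * norm h"
          using Cauchy_Schwarz_ineq2[of x h] norm_ge_zero[of h] unfolding distrib_right by linarith
      qed auto
      finally show "norm (?g x) \<le> (2 * pi\<^sup>2) * norm ((1 + norm x) ^ 2 *\<^sub>R f x) * norm h ^ 2"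
        by (simp add: power_mult_distrib mult_ac abs_of_nonneg)
    qed auto
    also have "\<dots> = C * norm h ^ 2" by (simp add: C_def)
    finally show ?thesis .
  qed
  have C: "C \<ge> 0" unfolding C_def by (intro integral_nonneg_AE AE_I2) auto
  show ?thesis
    unfolding has_derivative_at
  proof
    show "bounded_linear ?D"
      by (intro bounded_linear_sum bounded_linear_compose[OF bounded_linear_mult_left]
         bounded_linear_compose[OF bounded_linear_of_real bounded_linear_vec_nth])
    have "isCont (\<lambda>h::real^'n. C * norm h) 0"
      by (intro continuous_intros)
    then have "((\<lambda>h::real^'n. C * norm h) \<longlongrightarrow> C * norm (0::real^'n)) (at 0)"
      by (simp only: isCont_def)
    then have lim: "((\<lambda>h::real^'n. C * norm h) \<longlongrightarrow> 0) (at 0)" by simp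
    show "((\<lambda>h. norm (fourier f (\<xi> + h) - fourier f \<xi> - ?D h) / norm h) \<longlongrightarrow> 0) (at 0)"
    proof (rule tendsto_sandwich[OF _ _ tendsto_const lim])
      show "\<forall>\<^sub>F h in at 0. norm (fourier f (\<xi> + h) - fourier f \<xi> - ?D h) / norm h \<le> C * norm h"
        using main C by (intro always_eventually allI) (auto simp: divide_simps power2_eq_square mult_ac)
    qed simp
  qed
qed

lemma fourier_differentiable: "schwartz f \<Longrightarrow> fourier f differentiable (at \<xi>)"
  using fourier_has_derivative unfolding differentiable_def by blast

lemma partial_deriv_fourier:
  assumes "schwartz f"
  shows "partial_deriv i (fourier f) = fourier (\<lambda>x. (- 2 * pi * \<i>) * (of_real (x $ i) * f x))"
  using partial_derivI[OF fourier_has_derivative[OF assms], of i]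
  by (intro ext) (simp add: axis_def if_distrib[of of_real] if_distrib[of "\<lambda>z. z * _"] sum.delta cong: if_cong)

text \<open>A translation argument replaces the decomposition of the space into lines. By the
  fundamental theorem of calculus the average of the derivative over the unit segment from x in
  direction e is F (x + e) - F x. Integrating over x, the right side vanishes by translation
  invariance, and by Fubini the left side is the integral of the derivative.\<close>

lemma integral_partial_deriv_eq_0:
  fixes F :: "real^'n \<Rightarrow> complex"
  assumes diff: "\<And>x. F differentiable (at x)" and F: "integrable lborel F"
    and cont: "continuous_on UNIV (partial_deriv i F)" and int: "integrable lborel (partial_deriv i F)"
  shows "(LINT x|lborel. partial_deriv i F x) = 0"
proof -
  let ?e = "axis i 1 :: real^'n" and ?d = "partial_deriv i F"
  let ?k = "\<lambda>(x, t). indicator {0..1::real} t *\<^sub>R ?d (x + t *\<^sub>R ?e)"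
  have [measurable]: "?d \<in> borel_measurable borel"
    by (rule borel_measurable_continuous_onI[OF cont])
  have FTC: "has_bochner_integral lborel (\<lambda>t. indicator {0..1} t *\<^sub>R ?d (x + t *\<^sub>R ?e)) (F (x + ?e) - F x)" for x
  proof -
    have "((\<lambda>t. F (x + t *\<^sub>R ?e)) has_vector_derivative ?d (x + t *\<^sub>R ?e)) (at t within {0..1})" for t
    proof -
      have *: "((\<lambda>t. x + t *\<^sub>R ?e) has_derivative (\<lambda>h. h *\<^sub>R ?e)) (at t within {0..1})"
        by (auto intro!: derivative_eq_intros)
      have "(F has_derivative (\<lambda>h. \<Sum>j\<in>UNIV. of_real (h $ j) * partial_deriv j F (x + t *\<^sub>R ?e))) (at (x + t *\<^sub>R ?e))"
        by (rule has_derivative_partial[OF diff])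
      from has_derivative_compose[OF * this]
      show ?thesis
        unfolding has_vector_derivative_def
        by (rule has_derivative_eq_rhs)
          (auto simp: axis_def if_distrib[of of_real] if_distrib[of "\<lambda>z. _ * z"] if_distrib[of "\<lambda>z. z * _"] sum.delta
            scaleR_conv_of_real[where 'a = complex] fun_eq_iff simp del: scaleR_conv_of_real cong: if_cong)
    qed
    moreover have "continuous_on {0..1} (\<lambda>t. ?d (x + t *\<^sub>R ?e))"
      by (rule continuous_on_compose2[OF cont]) (auto intro!: continuous_intros)
    ultimately show ?thesis
      using has_bochner_integral_FTC_Icc[of 0 1 "\<lambda>t. F (x + t *\<^sub>R ?e)" "\<lambda>t. ?d (x + t *\<^sub>R ?e)"] by simp
  qed
  have intk: "integrable (lborel \<Otimes>\<^sub>M lborel) ?k"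
  proof (rule integrableI_bounded)
    show "?k \<in> borel_measurable (lborel \<Otimes>\<^sub>M lborel)" by measurable
    have "(\<integral>\<^sup>+z. ennreal (norm (?k z)) \<partial>(lborel \<Otimes>\<^sub>M lborel)) =
       (\<integral>\<^sup>+t. \<integral>\<^sup>+x. ennreal (norm (?k (x, t))) \<partial>lborel \<partial>lborel)"
      by (rule lborel_pair.nn_integral_snd[symmetric]) measurable
    also have "\<dots> = (\<integral>\<^sup>+t. indicator {0..1::real} t * (\<integral>\<^sup>+x. ennreal (norm (?d x)) \<partial>lborel) \<partial>lborel)"
    proof (intro nn_integral_cong)
      fix t :: real
      have "(\<integral>\<^sup>+x. ennreal (norm (?k (x, t))) \<partial>lborel) = (\<integral>\<^sup>+x. indicator {0..1::real} t * ennreal (norm (?d (x + t *\<^sub>R ?e))) \<partial>lborel)"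
        by (intro nn_integral_cong) (auto simp: indicator_def)
      also have "\<dots> = indicator {0..1::real} t * (\<integral>\<^sup>+x. ennreal (norm (?d x)) \<partial>lborel)"
        by (simp add: nn_integral_cmult nn_integral_lborel_translate[of "\<lambda>x. ennreal (norm (?d x))"])
      finally show "(\<integral>\<^sup>+x. ennreal (norm (?k (x, t))) \<partial>lborel) = indicator {0..1::real} t * (\<integral>\<^sup>+x. ennreal (norm (?d x)) \<partial>lborel)" .
    qed
    also have "\<dots> = (\<integral>\<^sup>+x. ennreal (norm (?d x)) \<partial>lborel)"
      by (simp add: nn_integral_multc)
    also have "\<dots> < \<infinity>" using int by (simp add: integrable_iff_bounded)
    finally show "(\<integral>\<^sup>+z. ennreal (norm (?k z)) \<partial>(lborel \<Otimes>\<^sub>M lborel)) < \<infinity>" .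
  qed
  have "(LINT x|lborel. ?d x) = (LINT t|lborel. indicator {0..1::real} t *\<^sub>R (LINT x|lborel. ?d x))"
    by simp
  also have "\<dots> = (LINT t|lborel. LINT x|lborel. ?k (x, t))"
    by (simp add: integral_lborel_translate)
  also have "\<dots> = (LINT x|lborel. LINT t|lborel. ?k (x, t))"
    using lborel_pair.Fubini_integral[of "\<lambda>x t. ?k (x, t)"] intk by simp
  also have "\<dots> = (LINT x|lborel. F (x + ?e) - F x)"
    using has_bochner_integral_integral_eq[OF FTC] by simp
  also have "\<dots> = 0"
    using F borel_measurable_integrable[OF F]
    by (simp add: integrable_lborel_translate integral_lborel_translate)
  finally show ?thesis .
qed

lemma cis_inner_has_derivative:
  "((\<lambda>x. cis (c * (x \<bullet> \<xi>))) has_derivative (\<lambda>h. \<i> * of_real (c * (h \<bullet> \<xi>)) * cis (c * (x \<bullet> \<xi>)))) (at x)"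
proof -
  have 1: "((\<lambda>x. \<i> * complex_of_real (c * (x \<bullet> \<xi>))) has_derivative (\<lambda>h. \<i> * of_real (c * (h \<bullet> \<xi>)))) (at x)"
    by (intro bounded_linear_imp_has_derivative bounded_linear_compose[OF bounded_linear_mult_right]
      bounded_linear_compose[OF bounded_linear_of_real] bounded_linear_inner_left)
  have 2: "(exp has_derivative (\<lambda>h. exp (\<i> * complex_of_real (c * (x \<bullet> \<xi>))) * h)) (at (\<i> * complex_of_real (c * (x \<bullet> \<xi>))))"
    using DERIV_exp unfolding has_field_derivative_def by blast
  show ?thesis using has_derivative_compose[OF 1 2] by (simp add: cis_conv_exp mult_ac)
qed

text \<open>Integration by parts: the integral of the derivative of f times the character vanishes,
  and the product rule splits it into the two sides.\<close>

lemma fourier_partial_deriv: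
  fixes f :: "real^'n \<Rightarrow> complex"
  assumes f: "schwartz f"
  shows "fourier (partial_deriv i f) \<xi> = 2 * pi * \<i> * of_real (\<xi> $ i) * fourier f \<xi>"
proof -
  let ?c = "\<lambda>x. cis (- 2 * pi * (x \<bullet> \<xi>))"
  let ?F = "\<lambda>x. f x * ?c x"
  have cd: "?c differentiable (at x)" for x :: "real^'n"
    using cis_inner_has_derivative unfolding differentiable_def by blast
  have cp: "partial_deriv i ?c x = (- 2 * pi * \<i> * of_real (\<xi> $ i)) * ?c x" for x
    unfolding partial_derivI[OF cis_inner_has_derivative] by (simp add: inner_axis' algebra_simps)
  have pF: "partial_deriv i ?F = (\<lambda>x. (- 2 * pi * \<i> * of_real (\<xi> $ i)) * (f x * ?c x) + partial_deriv i f x * ?c x)"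
    by (intro ext, subst partial_deriv_mult[OF schwartz_differentiable[OF f] cd], subst cp)
      (simp add: mult_ac)
  have f': "schwartz (partial_deriv i f)" by (rule schwartz_partial_deriv[OF f])
  have i1: "integrable lborel (\<lambda>x. f x * ?c x)" "integrable lborel (\<lambda>x. partial_deriv i f x * ?c x)"
    by (intro integrable_mult_cis schwartz_integrable f f'; measurable)+
  have "(LINT x|lborel. partial_deriv i ?F x) = 0"
  proof (rule integral_partial_deriv_eq_0)
    show "?F differentiable (at x)" for x
      by (intro differentiable_mult cd schwartz_differentiable f)
    show "continuous_on UNIV (partial_deriv i ?F)"
      unfolding pF by (intro continuous_intros schwartz_continuous f f')
    show "integrable lborel (partial_deriv i ?F)"
      unfolding pF by (intro Bochner_Integration.integrable_add integrable_mult_right i1)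
  qed (rule i1)
  then have "(- 2 * pi * \<i> * of_real (\<xi> $ i)) * (LINT x|lborel. f x * ?c x) + (LINT x|lborel. partial_deriv i f x * ?c x) = 0"
    unfolding pF using i1 by simp
  then show ?thesis
    by (simp add: fourier_eq schwartz_borel f f' algebra_simps add_eq_0_iff)
qed

section \<open>The operator I - \<Delta>, its symbol, and decay of Fourier transforms\<close>

definition helmholtz :: "(real^'n \<Rightarrow> complex) \<Rightarrow> real^'n \<Rightarrow> complex" where
  "helmholtz f x = f x - (\<Sum>i\<in>UNIV. partial_deriv i (partial_deriv i f) x)"

definition bessel_sym :: "real^'n \<Rightarrow> real" where
  "bessel_sym \<xi> = 1 + 4 * pi\<^sup>2 * (norm \<xi>)\<^sup>2"

lemma bessel_sym_ge_1: "bessel_sym \<xi> \<ge> 1"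
  by (simp add: bessel_sym_def)

lemma bessel_sym_pos [simp]: "bessel_sym \<xi> > 0"
  using bessel_sym_ge_1[of \<xi>] by linarith

lemma continuous_on_bessel_sym [continuous_intros]: "continuous_on S bessel_sym"
  unfolding bessel_sym_def by (intro continuous_intros)

lemma borel_measurable_bessel_sym [measurable]: "bessel_sym \<in> borel_measurable borel"
  by (intro borel_measurable_continuous_onI continuous_intros)

lemma norm_le_bessel_sym: "norm \<xi> \<le> bessel_sym \<xi>"
proof -
  have "norm \<xi> \<le> 1 + (norm \<xi>)\<^sup>2"
    using sum_squares_bound[of 1 "norm \<xi>"] norm_ge_zero[of \<xi>] by (simp del: norm_ge_zero)
  also have "(norm \<xi>)\<^sup>2 \<le> 4 * pi\<^sup>2 * (norm \<xi>)\<^sup>2"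
  proof -
    have "1 \<le> 4 * pi\<^sup>2" using pi_gt3 one_le_power[of pi 2] by linarith
    then show ?thesis using mult_right_mono[of 1 "4 * pi\<^sup>2" "(norm \<xi>)\<^sup>2"] by simp
  qed
  finally show ?thesis by (simp add: bessel_sym_def)
qed

lemma schwartz_zero: "schwartz (\<lambda>x. 0)"
proof (rule schwartz_coinduct[where S = "\<lambda>f. f = (\<lambda>x. 0)"])
qed (auto simp: partial_deriv_const intro!: exI[of _ 0])

lemma schwartz_sum:
  assumes "\<And>i. i \<in> I \<Longrightarrow> schwartz (f i)"
  shows "schwartz (\<lambda>x. \<Sum>i\<in>I. f i x)"
  using assms by (induction I rule: infinite_finite_induct) (auto simp: schwartz_zero schwartz_add)

lemma schwartz_diff:
  assumes "schwartz f" "schwartz g"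
  shows "schwartz (\<lambda>x. f x - g x)"
  using schwartz_add[OF assms(1) schwartz_cmult[OF assms(2), of "- 1"]] by simp

lemma schwartz_helmholtz:
  assumes "schwartz f" shows "schwartz (helmholtz f)"
  unfolding helmholtz_def[abs_def]
  by (intro schwartz_diff schwartz_sum schwartz_partial_deriv assms)

lemma schwartz_helmholtz_power: "schwartz f \<Longrightarrow> schwartz ((helmholtz ^^ l) f)"
  by (induction l) (auto simp: schwartz_helmholtz)

lemma fourier_add:
  assumes "schwartz f" "schwartz g"
  shows "fourier (\<lambda>x. f x + g x) \<xi> = fourier f \<xi> + fourier g \<xi>"
proof -
  have "integrable lborel (\<lambda>x. f x * cis (- 2 * pi * (x \<bullet> \<xi>)))" "integrable lborel (\<lambda>x. g x * cis (- 2 * pi * (x \<bullet> \<xi>)))"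
    by (intro integrable_mult_cis schwartz_integrable assms; measurable)+
  then show ?thesis
    by (simp add: fourier_eq schwartz_borel schwartz_add assms distrib_right)
qed

lemma fourier_cmult: "fourier (\<lambda>x. c * f x) \<xi> = c * fourier f \<xi>"
  by (simp add: fourier_def mult.assoc)

lemma fourier_diff:
  assumes "schwartz f" "schwartz g"
  shows "fourier (\<lambda>x. f x - g x) \<xi> = fourier f \<xi> - fourier g \<xi>"
  using fourier_add[OF assms(1) schwartz_cmult[OF assms(2), of "- 1"]] fourier_cmult[of "- 1" g \<xi>]
  by simp

lemma fourier_sum:
  assumes "\<And>i. i \<in> I \<Longrightarrow> schwartz (f i)"
  shows "fourier (\<lambda>x. \<Sum>i\<in>I. f i x) \<xi> = (\<Sum>i\<in>I. fourier (f i) \<xi>)"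
  using assms
  by (induction I rule: infinite_finite_induct) (auto simp: fourier_add schwartz_sum fourier_def[of "\<lambda>x. 0"])

lemma fourier_helmholtz:
  assumes "schwartz f"
  shows "fourier (helmholtz f) \<xi> = bessel_sym \<xi> * fourier f \<xi>"
proof -
  have s: "schwartz (partial_deriv i (partial_deriv i f))" for i
    by (intro schwartz_partial_deriv assms)
  have "fourier (helmholtz f) \<xi> = fourier f \<xi> - (\<Sum>i\<in>UNIV. fourier (partial_deriv i (partial_deriv i f)) \<xi>)"
    unfolding helmholtz_def[abs_def] by (simp add: fourier_diff fourier_sum schwartz_sum s assms)
  also have "\<dots> = fourier f \<xi> + (\<Sum>i\<in>UNIV. 4 * pi\<^sup>2 * of_real (\<xi> $ i * \<xi> $ i) * fourier f \<xi>)"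
    by (simp add: fourier_partial_deriv schwartz_partial_deriv assms sum_negf[symmetric] power2_eq_square mult_ac)
  also have "\<dots> = fourier f \<xi> + 4 * pi\<^sup>2 * of_real (\<Sum>i\<in>UNIV. \<xi> $ i * \<xi> $ i) * fourier f \<xi>"
    by (simp add: sum_distrib_left sum_distrib_right mult_ac)
  also have "(\<Sum>i\<in>UNIV. \<xi> $ i * \<xi> $ i) = (norm \<xi>)\<^sup>2"
    by (simp add: power2_norm_eq_inner inner_vec_def)
  finally show ?thesis by (simp add: bessel_sym_def algebra_simps)
qed

lemma fourier_helmholtz_power:
  "schwartz f \<Longrightarrow> fourier ((helmholtz ^^ l) f) \<xi> = of_real (bessel_sym \<xi> ^ l) * fourier f \<xi>"
  by (induction l) (auto simp: fourier_helmholtz schwartz_helmholtz_power mult_ac)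

text \<open>Decay of the transform comes from smoothness of f: |\<xi>|^N is at most
  \<open>bessel_sym \<xi> ^ N\<close>, and that power times the transform is the transform of an
  N-fold \<open>helmholtz\<close> image, which is bounded by an L^1 norm. Derivatives of the
  transform are again transforms of Schwartz functions, namely of coordinate multiples.\<close>

lemma fourier_schwartz:
  assumes "schwartz f" shows "schwartz (fourier f)"
proof (rule schwartz_coinduct[where S = "\<lambda>k. \<exists>f. schwartz f \<and> k = fourier f"])
  show "\<exists>g. schwartz g \<and> fourier f = fourier g" using assms by blast
next
  fix k :: "real^'a \<Rightarrow> complex" and x
  assume "\<exists>f. schwartz f \<and> k = fourier f"
  then show "k differentiable at x" using fourier_differentiable by blast
next
  fix k :: "real^'a \<Rightarrow> complex" and N
  assume "\<exists>f. schwartz f \<and> k = fourier f"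
  then obtain f where f: "schwartz f" "k = fourier f" by blast
  have "norm x ^ N * norm (k x) \<le> (LINT x|lborel. norm ((helmholtz ^^ N) f x))" for x
  proof -
    have "norm x ^ N * norm (k x) \<le> bessel_sym x ^ N * norm (k x)"
      by (intro mult_right_mono power_mono norm_le_bessel_sym) auto
    also have "\<dots> = norm (fourier ((helmholtz ^^ N) f) x)"
      by (simp add: fourier_helmholtz_power f norm_mult norm_power abs_of_pos)
    also have "\<dots> \<le> (LINT x|lborel. norm ((helmholtz ^^ N) f x))"
      by (intro norm_fourier_le schwartz_borel schwartz_helmholtz_power f)
    finally show ?thesis .
  qed
  then show "\<exists>B. \<forall>x. norm x ^ N * norm (k x) \<le> B" by blast
next
  fix k :: "real^'a \<Rightarrow> complex" and i
  assume "\<exists>f. schwartz f \<and> k = fourier f"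
  then obtain f where f: "schwartz f" "k = fourier f" by blast
  show "\<exists>f. schwartz f \<and> partial_deriv i k = fourier f"
    unfolding f(2) partial_deriv_fourier[OF f(1)]
    by (intro exI[of _ "\<lambda>x. (- 2 * pi * \<i>) * (of_real (x $ i) * f x)"] conjI refl schwartz_cmult
      schwartz_coord_mult f(1))
qed

lemma inv_fourier_schwartz: "schwartz f \<Longrightarrow> schwartz (inv_fourier f)"
  unfolding inv_fourier_eq_fourier[abs_def] by (intro schwartz_reflect fourier_schwartz)

section \<open>Derivatives of Gaussians times a smooth function\<close>

text \<open>A complex scalar times a real vector is general enough for the linear term: an imaginary
  \<beta> modulates the Gaussian, and a \<beta> proportional to \<open>w\<close> translates it. All
  dilates and translates of \<open>gauss z\<close> have this form, so one derivative estimate covers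
  every scale.\<close>

definition gexp :: "complex \<Rightarrow> complex \<Rightarrow> real^'n \<Rightarrow> complex \<Rightarrow> real^'n \<Rightarrow> complex" where
  "gexp w \<beta> a c x = exp (- w * of_real ((norm x)\<^sup>2) + \<beta> * of_real (a \<bullet> x) + c)"

text \<open>The logarithmic derivative of \<open>gexp\<close> in direction i.\<close>

definition glin :: "complex \<Rightarrow> complex \<Rightarrow> real^'n \<Rightarrow> 'n \<Rightarrow> real^'n \<Rightarrow> complex" where
  "glin w \<beta> a i x = - 2 * w * of_real (x $ i) + \<beta> * of_real (a $ i)"

lemma gexp_has_derivative:
  "(gexp w \<beta> a c has_derivative
     (\<lambda>h. (- w * of_real (2 * (x \<bullet> h)) + \<beta> * of_real (a \<bullet> h)) * gexp w \<beta> a c x)) (at x)"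
proof -
  let ?e = "\<lambda>x. - w * of_real ((norm x)\<^sup>2) + \<beta> * of_real (a \<bullet> x) + c"
  have 0: "((\<lambda>x. x \<bullet> x) has_derivative (\<lambda>h. 2 * (x \<bullet> h))) (at x)"
    by (rule has_derivative_eq_rhs[OF has_derivative_inner[OF has_derivative_ident has_derivative_ident]])
      (simp add: fun_eq_iff inner_commute)
  have 1: "(?e has_derivative (\<lambda>h. - w * of_real (2 * (x \<bullet> h)) + \<beta> * of_real (a \<bullet> h))) (at x)"
    unfolding power2_norm_eq_inner
    by (rule has_derivative_eq_rhs[OF has_derivative_add[OF has_derivative_add[OF
       has_derivative_mult_right[OF bounded_linear.has_derivative[OF bounded_linear_of_real 0]]
       has_derivative_mult_right[OF bounded_linear.has_derivative[OF bounded_linear_of_real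
         bounded_linear_imp_has_derivative[OF bounded_linear_inner_right]]]] has_derivative_const]])
      simp
  have 2: "(exp has_derivative (\<lambda>h. exp (?e x) * h)) (at (?e x))"
    using DERIV_exp unfolding has_field_derivative_def by blast
  show ?thesis using has_derivative_compose[OF 1 2] by (simp add: gexp_def[abs_def] mult.commute)
qed

lemma gexp_differentiable: "gexp w \<beta> a c differentiable (at x)"
  using gexp_has_derivative unfolding differentiable_def by blast

lemma partial_deriv_gexp: "partial_deriv i (gexp w \<beta> a c) x = glin w \<beta> a i x * gexp w \<beta> a c x"
  unfolding partial_derivI[OF gexp_has_derivative] by (simp add: inner_axis glin_def)

lemma glin_differentiable: "glin w \<beta> a i differentiable (at x)"
  unfolding glin_def[abs_def]
  by (intro differentiable_add differentiable_mult differentiable_const differentiable_coord)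

lemma partial_deriv_glin: "partial_deriv j (glin w \<beta> a i) x = (if j = i then - 2 else 0) * w"
proof -
  have "partial_deriv j (\<lambda>x. (- 2 * w) * complex_of_real (x $ i)) x = (if j = i then - 2 else 0) * w"
    by (subst partial_deriv_mult[OF differentiable_const differentiable_coord])
      (simp add: partial_deriv_const partial_deriv_coord)
  then show ?thesis
    unfolding glin_def[abs_def]
    by (subst partial_deriv_add[OF differentiable_mult[OF differentiable_const differentiable_coord] differentiable_const])
      (simp only: partial_deriv_const add_0_right)
qed

text \<open>\<open>glin_class B j\<close> contains the factors that multiply the Gaussian in the derivatives of
  order \<open>j\<close> of \<open>gexp w \<beta> a c * B\<close>; \<open>w\<close> has weight two and \<open>glin w \<beta> a i\<close> weight one.\<close>

inductive glin_class :: "(real^'n \<Rightarrow> complex) \<Rightarrow> nat \<Rightarrow>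
    (complex \<Rightarrow> complex \<Rightarrow> real^'n \<Rightarrow> real^'n \<Rightarrow> complex) \<Rightarrow> bool" for B where
  base: "glin_class B 0 (\<lambda>w \<beta> a. iter_partial is B)"
| lin: "glin_class B j F \<Longrightarrow> glin_class B (Suc j) (\<lambda>w \<beta> a x. glin w \<beta> a i x * F w \<beta> a x)"
| quad: "glin_class B j F \<Longrightarrow> glin_class B (Suc (Suc j)) (\<lambda>w \<beta> a x. (k * w) * F w \<beta> a x)"
| add: "glin_class B j F \<Longrightarrow> glin_class B j G \<Longrightarrow> glin_class B j (\<lambda>w \<beta> a x. F w \<beta> a x + G w \<beta> a x)"
| mono: "glin_class B j F \<Longrightarrow> glin_class B (Suc j) F"

lemma glin_class_differentiable:
  fixes B :: "real^'n \<Rightarrow> complex"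
  assumes "glin_class B j F" "\<And>is x. iter_partial is B differentiable (at x)"
  shows "F w \<beta> a differentiable (at x)"
  using assms(1)
  by induction (auto intro!: assms(2) differentiable_add differentiable_mult glin_differentiable)

text \<open>Differentiating a factor \<open>glin\<close> of weight one leaves a multiple of
  \<open>w\<close>, of weight two, so the weight rises by exactly one. A derivative falling on B
  adds no weight by itself; \<open>glin_class.mono\<close> lifts it to the same level.\<close>

lemma glin_class_partial_deriv:
  fixes B :: "real^'n \<Rightarrow> complex"
  assumes "glin_class B j F" and B: "\<And>is x. iter_partial is B differentiable (at x)"
  shows "\<exists>F'. glin_class B (Suc j) F' \<and> (\<forall>w \<beta> a x. partial_deriv i (F w \<beta> a) x = F' w \<beta> a x)"
  using assms(1)
proof induction
  case (base "is")
  have "glin_class B (Suc 0) (\<lambda>w \<beta> a. iter_partial (i # is) B)"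
    by (intro glin_class.mono glin_class.base)
  then show ?case by (intro exI[of _ "\<lambda>w \<beta> a. iter_partial (i # is) B"]) simp
next
  case (lin j F l)
  then obtain F' where F': "glin_class B (Suc j) F'" "\<And>w \<beta> a x. partial_deriv i (F w \<beta> a) x = F' w \<beta> a x"
    by blast
  show ?case
  proof (intro exI[of _ "\<lambda>w \<beta> a x. glin w \<beta> a l x * F' w \<beta> a x + ((if i = l then - 2 else 0) * w) * F w \<beta> a x"] conjI allI)
    show "glin_class B (Suc (Suc j)) (\<lambda>w \<beta> a x. glin w \<beta> a l x * F' w \<beta> a x + ((if i = l then - 2 else 0) * w) * F w \<beta> a x)"
      by (intro glin_class.add glin_class.lin glin_class.quad F' lin)
  qed (subst partial_deriv_mult[OF glin_differentiable glin_class_differentiable[OF lin(1) B]],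
       simp only: F'(2) partial_deriv_glin)
next
  case (quad j F k)
  then obtain F' where F': "glin_class B (Suc j) F'" "\<And>w \<beta> a x. partial_deriv i (F w \<beta> a) x = F' w \<beta> a x"
    by blast
  show ?case
  proof (intro exI[of _ "\<lambda>w \<beta> a x. (k * w) * F' w \<beta> a x"] conjI allI)
    show "glin_class B (Suc (Suc (Suc j))) (\<lambda>w \<beta> a x. (k * w) * F' w \<beta> a x)"
      by (intro glin_class.quad F')
  qed (subst partial_deriv_mult[OF differentiable_const glin_class_differentiable[OF quad(1) B]],
       simp add: F'(2) partial_deriv_const)
next
  case (add j F G)
  then obtain F' G' where F': "glin_class B (Suc j) F'" "\<And>w \<beta> a x. partial_deriv i (F w \<beta> a) x = F' w \<beta> a x"
     "glin_class B (Suc j) G'" "\<And>w \<beta> a x. partial_deriv i (G w \<beta> a) x = G' w \<beta> a x"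
    by blast
  show ?case
  proof (intro exI[of _ "\<lambda>w \<beta> a x. F' w \<beta> a x + G' w \<beta> a x"] conjI allI)
    show "glin_class B (Suc j) (\<lambda>w \<beta> a x. F' w \<beta> a x + G' w \<beta> a x)"
      by (intro glin_class.add F')
  qed (subst partial_deriv_add[OF glin_class_differentiable[OF add(1) B] glin_class_differentiable[OF add(2) B]],
       simp add: F')
next
  case (mono j F)
  then show ?case using glin_class.mono by blast
qed

text \<open>K measures the frequency, with \<open>w\<close> of size K^2, while V absorbs the growth
  of \<open>glin\<close> in x and may change from point to point. The function \<rho> carries the
  support of B. What matters is that C is chosen before all Gaussian parameters; K and V being at
  least 1 lets terms of lower weight be absorbed.\<close>

lemma glin_class_bound:
  fixes B :: "real^'n \<Rightarrow> complex"
  assumes "glin_class B j F" and B: "\<And>is. \<exists>C. \<forall>x. norm (iter_partial is B x) \<le> C * \<rho> x"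
    and \<rho>: "\<And>x. \<rho> x \<ge> 0"
  shows "\<exists>C\<ge>0. \<forall>w \<beta> a x K V. 1 \<le> K \<longrightarrow> 1 \<le> V \<longrightarrow> norm w \<le> K\<^sup>2 \<longrightarrow> (\<forall>i. norm (glin w \<beta> a i x) \<le> K * V) \<longrightarrow>
     norm (F w \<beta> a x) \<le> C * (K * V) ^ j * \<rho> x"
  using assms(1)
proof induction
  case (base "is")
  obtain C where C: "\<And>x. norm (iter_partial is B x) \<le> C * \<rho> x" using B by blast
  show ?case
  proof (intro exI[of _ "\<bar>C\<bar>"] conjI allI impI)
    fix x :: "real^'n" show "norm (iter_partial is B x) \<le> \<bar>C\<bar> * (K * V) ^ 0 * \<rho> x" for K V :: real
      using order_trans[OF C[of x] mult_right_mono[OF abs_ge_self \<rho>]] by simp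
  qed auto
next
  case (lin j F l)
  then obtain C where C: "C \<ge> 0" "\<And>w \<beta> a x K V. 1 \<le> K \<Longrightarrow> 1 \<le> V \<Longrightarrow> norm w \<le> K\<^sup>2 \<Longrightarrow> (\<And>i. norm (glin w \<beta> a i x) \<le> K * V) \<Longrightarrow>
     norm (F w \<beta> a x) \<le> C * (K * V) ^ j * \<rho> x" by metis
  show ?case
  proof (intro exI[of _ C] conjI allI impI C(1))
    fix w \<beta> a and x :: "real^'n" and K V :: real
    assume *: "1 \<le> K" "1 \<le> V" "norm w \<le> K\<^sup>2" "\<forall>i. norm (glin w \<beta> a i x) \<le> K * V"
    have "norm (glin w \<beta> a l x * F w \<beta> a x) \<le> (K * V) * (C * (K * V) ^ j * \<rho> x)"
      unfolding norm_mult using * C by (intro mult_mono) auto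
    then show "norm (glin w \<beta> a l x * F w \<beta> a x) \<le> C * (K * V) ^ Suc j * \<rho> x"
      by (simp add: mult_ac)
  qed
next
  case (quad j F k)
  then obtain C where C: "C \<ge> 0" "\<And>w \<beta> a x K V. 1 \<le> K \<Longrightarrow> 1 \<le> V \<Longrightarrow> norm w \<le> K\<^sup>2 \<Longrightarrow> (\<And>i. norm (glin w \<beta> a i x) \<le> K * V) \<Longrightarrow>
     norm (F w \<beta> a x) \<le> C * (K * V) ^ j * \<rho> x" by metis
  show ?case
  proof (intro exI[of _ "norm k * C"] conjI allI impI)
    show "0 \<le> norm k * C" using C by simp
    fix w \<beta> a and x :: "real^'n" and K V :: real
    assume *: "1 \<le> K" "1 \<le> V" "norm w \<le> K\<^sup>2" "\<forall>i. norm (glin w \<beta> a i x) \<le> K * V"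
    have "K\<^sup>2 \<le> (K * V)\<^sup>2" using *(1,2) by (intro power_mono) auto
    then have "norm (k * w) \<le> norm k * (K * V)\<^sup>2"
      unfolding norm_mult using *(3) by (intro mult_left_mono) auto
    then have "norm ((k * w) * F w \<beta> a x) \<le> (norm k * (K * V)\<^sup>2) * (C * (K * V) ^ j * \<rho> x)"
      unfolding norm_mult[of "k * w"] using * C by (intro mult_mono) auto
    then show "norm ((k * w) * F w \<beta> a x) \<le> norm k * C * (K * V) ^ Suc (Suc j) * \<rho> x"
      by (simp add: mult_ac power2_eq_square)
  qed
next
  case (add j F G)
  then obtain C where C: "C \<ge> 0" "\<And>w \<beta> a x K V. 1 \<le> K \<Longrightarrow> 1 \<le> V \<Longrightarrow> norm w \<le> K\<^sup>2 \<Longrightarrow> (\<And>i. norm (glin w \<beta> a i x) \<le> K * V) \<Longrightarrow>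
     norm (F w \<beta> a x) \<le> C * (K * V) ^ j * \<rho> x" by metis
  from add obtain D where D: "D \<ge> 0" "\<And>w \<beta> a x K V. 1 \<le> K \<Longrightarrow> 1 \<le> V \<Longrightarrow> norm w \<le> K\<^sup>2 \<Longrightarrow> (\<And>i. norm (glin w \<beta> a i x) \<le> K * V) \<Longrightarrow>
     norm (G w \<beta> a x) \<le> D * (K * V) ^ j * \<rho> x" by metis
  show ?case
  proof (intro exI[of _ "C + D"] conjI allI impI)
    show "0 \<le> C + D" using C D by simp
    fix w \<beta> a and x :: "real^'n" and K V :: real
    assume *: "1 \<le> K" "1 \<le> V" "norm w \<le> K\<^sup>2" "\<forall>i. norm (glin w \<beta> a i x) \<le> K * V"
    have "norm (F w \<beta> a x + G w \<beta> a x) \<le> C * (K * V) ^ j * \<rho> x + D * (K * V) ^ j * \<rho> x"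
      using * by (intro norm_triangle_mono C(2) D(2)) auto
    then show "norm (F w \<beta> a x + G w \<beta> a x) \<le> (C + D) * (K * V) ^ j * \<rho> x"
      by (simp add: distrib_right)
  qed
next
  case (mono j F)
  then obtain C where C: "C \<ge> 0" "\<And>w \<beta> a x K V. 1 \<le> K \<Longrightarrow> 1 \<le> V \<Longrightarrow> norm w \<le> K\<^sup>2 \<Longrightarrow> (\<And>i. norm (glin w \<beta> a i x) \<le> K * V) \<Longrightarrow>
     norm (F w \<beta> a x) \<le> C * (K * V) ^ j * \<rho> x" by metis
  show ?case
  proof (intro exI[of _ C] conjI allI impI C(1))
    fix w \<beta> a and x :: "real^'n" and K V :: real
    assume *: "1 \<le> K" "1 \<le> V" "norm w \<le> K\<^sup>2" "\<forall>i. norm (glin w \<beta> a i x) \<le> K * V"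
    have "1 * 1 \<le> K * V" using *(1,2) by (intro mult_mono) auto
    then have "(K * V) ^ j \<le> (K * V) ^ Suc j" by (intro power_increasing) auto
    then have "C * (K * V) ^ j * \<rho> x \<le> C * (K * V) ^ Suc j * \<rho> x"
      using C(1) \<rho> by (intro mult_right_mono mult_left_mono) auto
    then show "norm (F w \<beta> a x) \<le> C * (K * V) ^ Suc j * \<rho> x"
      using C(2)[of K V w \<beta> a x] * by fastforce
  qed
qed

text \<open>F depends on B and the index list alone and serves all w, \<beta>, a and c at once. This
  order of quantifiers is the source of the uniformity over scales.\<close>

lemma iter_partial_gexp_mult:
  fixes B :: "real^'n \<Rightarrow> complex"
  assumes B: "\<And>is x. iter_partial is B differentiable (at x)"
  shows "\<exists>F. glin_class B (length is) F \<and>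
    (\<forall>w \<beta> a c. iter_partial is (\<lambda>x. gexp w \<beta> a c x * B x) = (\<lambda>x. gexp w \<beta> a c x * F w \<beta> a x))"
proof (induction "is")
  case Nil
  have "glin_class B 0 (\<lambda>w \<beta> a. iter_partial [] B)" by (rule glin_class.base)
  then show ?case by (intro exI[of _ "\<lambda>w \<beta> a. iter_partial [] B"]) simp
next
  case (Cons i "is")
  then obtain F where F: "glin_class B (length is) F"
    "\<And>w \<beta> a c. iter_partial is (\<lambda>x. gexp w \<beta> a c x * B x) = (\<lambda>x. gexp w \<beta> a c x * F w \<beta> a x)" by blast
  obtain F' where F': "glin_class B (Suc (length is)) F'" "\<And>w \<beta> a x. partial_deriv i (F w \<beta> a) x = F' w \<beta> a x"
    using glin_class_partial_deriv[OF F(1) B] by blast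
  show ?case
  proof (intro exI[of _ "\<lambda>w \<beta> a x. glin w \<beta> a i x * F w \<beta> a x + F' w \<beta> a x"] conjI allI)
    show "glin_class B (length (i # is)) (\<lambda>w \<beta> a x. glin w \<beta> a i x * F w \<beta> a x + F' w \<beta> a x)"
      by (auto intro!: glin_class.add glin_class.lin F F')
    fix w \<beta> a c
    show "iter_partial (i # is) (\<lambda>x. gexp w \<beta> a c x * B x) = (\<lambda>x. gexp w \<beta> a c x * (glin w \<beta> a i x * F w \<beta> a x + F' w \<beta> a x))"
      by (intro ext, simp only: iter_partial.simps F(2),
          subst partial_deriv_mult[OF gexp_differentiable glin_class_differentiable[OF F(1) B]])
        (simp add: F'(2) partial_deriv_gexp algebra_simps)
  qed
qed

lemma iter_partial_gexp_mult_bound: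
  fixes B :: "real^'n \<Rightarrow> complex"
  assumes B: "\<And>is x. iter_partial is B differentiable (at x)"
    and B': "\<And>is. \<exists>C. \<forall>x. norm (iter_partial is B x) \<le> C * \<rho> x" "\<And>x. \<rho> x \<ge> 0"
  shows "\<exists>C\<ge>0. \<forall>w \<beta> a c x K V. 1 \<le> K \<longrightarrow> 1 \<le> V \<longrightarrow> norm w \<le> K\<^sup>2 \<longrightarrow> (\<forall>i. norm (glin w \<beta> a i x) \<le> K * V) \<longrightarrow>
     norm (iter_partial is (\<lambda>x. gexp w \<beta> a c x * B x) x) \<le> C * (K * V) ^ length is * norm (gexp w \<beta> a c x) * \<rho> x"
proof -
  obtain F where F: "glin_class B (length is) F"
    "\<And>w \<beta> a c. iter_partial is (\<lambda>x. gexp w \<beta> a c x * B x) = (\<lambda>x. gexp w \<beta> a c x * F w \<beta> a x)"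
    using iter_partial_gexp_mult[OF B] by blast
  obtain C where C: "C \<ge> 0" "\<And>w \<beta> a x K V. 1 \<le> K \<Longrightarrow> 1 \<le> V \<Longrightarrow> norm w \<le> K\<^sup>2 \<Longrightarrow> (\<And>i. norm (glin w \<beta> a i x) \<le> K * V) \<Longrightarrow>
     norm (F w \<beta> a x) \<le> C * (K * V) ^ length is * \<rho> x"
    using glin_class_bound[OF F(1) B'] by metis
  show ?thesis
  proof (intro exI[of _ C] conjI allI impI C(1))
    fix w \<beta> a c and x :: "real^'n" and K V :: real
    assume *: "1 \<le> K" "1 \<le> V" "norm w \<le> K\<^sup>2" "\<forall>i. norm (glin w \<beta> a i x) \<le> K * V"
    have "norm (iter_partial is (\<lambda>x. gexp w \<beta> a c x * B x) x) \<le> norm (gexp w \<beta> a c x) * (C * (K * V) ^ length is * \<rho> x)"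
      unfolding F(2) norm_mult using * by (intro mult_left_mono C(2)) auto
    then show "norm (iter_partial is (\<lambda>x. gexp w \<beta> a c x * B x) x) \<le> C * (K * V) ^ length is * norm (gexp w \<beta> a c x) * \<rho> x"
      by (simp add: mult_ac)
  qed
qed

lemma iter_partial_gexp_mult_differentiable:
  fixes B :: "real^'n \<Rightarrow> complex"
  assumes B: "\<And>is x. iter_partial is B differentiable (at x)"
  shows "iter_partial is (\<lambda>x. gexp w \<beta> a c x * B x) differentiable (at x)"
proof -
  obtain F where F: "glin_class B (length is) F"
    "\<And>w \<beta> a c. iter_partial is (\<lambda>x. gexp w \<beta> a c x * B x) = (\<lambda>x. gexp w \<beta> a c x * F w \<beta> a x)"
    using iter_partial_gexp_mult[OF B] by blast
  show ?thesis unfolding F(2) by (intro differentiable_mult gexp_differentiable glin_class_differentiable[OF F(1) B])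
qed

text \<open>A single term of the exponential series at 1 + t.\<close>

lemma power_le_fact_exp: "(1 + t) ^ N \<le> fact N * exp (1 + t)" if "t \<ge> 0" for t :: real
proof -
  have "(1 + t) ^ N / fact N \<le> exp (1 + t)"
  proof -
    have s: "(\<lambda>n. (1 + t) ^ n /\<^sub>R fact n) sums exp (1 + t)" by (rule exp_converges)
    have "(\<Sum>n\<in>{N}. (1 + t) ^ n /\<^sub>R fact n) \<le> exp (1 + t)"
      using that by (intro sum_le_suminf[OF sums_summable[OF s], unfolded sums_unique[OF s, symmetric]]) auto
    then show ?thesis by (simp add: divide_inverse mult.commute)
  qed
  then show ?thesis by (simp add: field_simps)
qed

lemma norm_gexp: "norm (gexp w \<beta> a c x) = exp (- Re w * (norm x)\<^sup>2 + Re \<beta> * (a \<bullet> x) + Re c)"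
  by (simp add: gexp_def)

lemma gexp_decay:
  assumes "Re w > 0"
  shows "\<exists>D. \<forall>x. (1 + norm x) ^ N * norm (gexp w \<beta> a c x) \<le> D"
proof -
  \<comment> \<open>The summand 1 pays for the factor exp (norm x) with which the polynomial weight
    is bounded; what remains is completing the square.\<close>
  define b where "b = \<bar>Re \<beta>\<bar> * norm a + 1"
  have "(1 + norm x) ^ N * norm (gexp w \<beta> a c x) \<le> fact N * exp (1 + b\<^sup>2 / (4 * Re w) + Re c)" for x
  proof -
    have "Re \<beta> * (a \<bullet> x) \<le> \<bar>Re \<beta>\<bar> * \<bar>a \<bullet> x\<bar>" by (metis abs_ge_self abs_mult)
    also have "\<dots> \<le> \<bar>Re \<beta>\<bar> * (norm a * norm x)"
      by (intro mult_left_mono Cauchy_Schwarz_ineq2) auto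
    finally have 1: "norm x + Re \<beta> * (a \<bullet> x) \<le> b * norm x" by (simp add: b_def algebra_simps)
    have "0 \<le> (2 * Re w * norm x - b)\<^sup>2 / (4 * Re w)" using assms by simp
    also have "\<dots> = Re w * (norm x)\<^sup>2 - b * norm x + b\<^sup>2 / (4 * Re w)"
      using assms by (simp add: power2_eq_square field_simps)
    finally have "b * norm x - Re w * (norm x)\<^sup>2 \<le> b\<^sup>2 / (4 * Re w)" by simp
    with 1 have 2: "1 + norm x + (- Re w * (norm x)\<^sup>2 + Re \<beta> * (a \<bullet> x) + Re c) \<le> 1 + b\<^sup>2 / (4 * Re w) + Re c"
      by simp
    have "(1 + norm x) ^ N * norm (gexp w \<beta> a c x) \<le> (fact N * exp (1 + norm x)) * norm (gexp w \<beta> a c x)"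
      by (intro mult_right_mono power_le_fact_exp) auto
    also have "\<dots> = fact N * exp (1 + norm x + (- Re w * (norm x)\<^sup>2 + Re \<beta> * (a \<bullet> x) + Re c))"
      by (simp only: norm_gexp exp_add mult.assoc)
    also have "\<dots> \<le> fact N * exp (1 + b\<^sup>2 / (4 * Re w) + Re c)"
      using 2 by (intro mult_left_mono) auto
    finally show ?thesis .
  qed
  then show ?thesis by blast
qed

lemma schwartz_gexp_mult:
  fixes B :: "real^'n \<Rightarrow> complex"
  assumes B: "\<And>is x. iter_partial is B differentiable (at x)"
    and B': "\<And>is. \<exists>C. \<forall>x. norm (iter_partial is B x) \<le> C"
    and w: "Re w > 0"
  shows "schwartz (\<lambda>x. gexp w \<beta> a c x * B x)"
  unfolding schwartz_def
proof (intro allI conjI)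
  fix "is" and N :: nat
  obtain C where C: "C \<ge> 0" "\<And>w \<beta> a c x K V. 1 \<le> K \<Longrightarrow> 1 \<le> V \<Longrightarrow> norm w \<le> K\<^sup>2 \<Longrightarrow> (\<And>i. norm (glin w \<beta> a i x) \<le> K * V) \<Longrightarrow>
     norm (iter_partial is (\<lambda>x. gexp w \<beta> a c x * B x) x) \<le> C * (K * V) ^ length is * norm (gexp w \<beta> a c x) * 1"
    using iter_partial_gexp_mult_bound[of B "\<lambda>x. 1" "is"] B B' by force
  \<comment> \<open>K collects the coefficients of \<open>glin\<close>, and V = 1 + |x| its growth.
    The power of V that the derivatives produce is absorbed into the decay of the Gaussian, which is
    why the exponent below is N + length is.\<close>
  define K where "K = 1 + 2 * norm w + norm \<beta> * norm a"
  obtain D where D: "\<And>x. (1 + norm x) ^ (N + length is) * norm (gexp w \<beta> a c x) \<le> D"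
    using gexp_decay[OF w] by blast
  have K: "K \<ge> 1" by (simp add: K_def)
  have "norm w \<le> K" by (simp add: K_def add_increasing2)
  also have "K \<le> K\<^sup>2" using K by (simp add: self_le_power)
  finally have wK: "norm w \<le> K\<^sup>2" .
  have lin: "norm (glin w \<beta> a i x) \<le> K * (1 + norm x)" for i x
  proof -
    have "norm (glin w \<beta> a i x) \<le> 2 * norm w * \<bar>x $ i\<bar> + norm \<beta> * \<bar>a $ i\<bar>"
      unfolding glin_def by (rule order_trans[OF norm_triangle_ineq]) (simp add: norm_mult)
    also have "\<dots> \<le> 2 * norm w * (1 + norm x) + norm \<beta> * norm a * (1 + norm x)"
    proof (intro add_mono)
      show "2 * norm w * \<bar>x $ i\<bar> \<le> 2 * norm w * (1 + norm x)"
        using component_le_norm_cart[of x i] by (intro mult_left_mono) auto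
      have "norm \<beta> * \<bar>a $ i\<bar> * 1 \<le> norm \<beta> * norm a * (1 + norm x)"
        using component_le_norm_cart[of a i] by (intro mult_mono) auto
      then show "norm \<beta> * \<bar>a $ i\<bar> \<le> norm \<beta> * norm a * (1 + norm x)" by simp
    qed
    also have "\<dots> \<le> K * (1 + norm x)" by (simp add: K_def algebra_simps)
    finally show ?thesis .
  qed
  have "norm x ^ N * norm (iter_partial is (\<lambda>x. gexp w \<beta> a c x * B x) x) \<le> C * K ^ length is * D" for x
  proof -
    have "norm x ^ N * norm (iter_partial is (\<lambda>x. gexp w \<beta> a c x * B x) x) \<le>
       (1 + norm x) ^ N * (C * (K * (1 + norm x)) ^ length is * norm (gexp w \<beta> a c x) * 1)"
      by (intro mult_mono power_mono C(2) K wK lin) auto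
    also have "\<dots> = C * K ^ length is * ((1 + norm x) ^ (N + length is) * norm (gexp w \<beta> a c x))"
      by (simp add: power_mult_distrib power_add mult_ac)
    also have "\<dots> \<le> C * K ^ length is * D"
      using C(1) K by (intro mult_left_mono D) auto
    finally show ?thesis .
  qed
  then show "\<exists>B'. \<forall>x. norm x ^ N * norm (iter_partial is (\<lambda>x. gexp w \<beta> a c x * B x) x) \<le> B'"
    by blast
qed (rule iter_partial_gexp_mult_differentiable[OF B])

lemma schwartz_gexp:
  fixes a :: "real^'n"
  assumes "Re w > 0" shows "schwartz (gexp w \<beta> a c)"
proof -
  have it: "iter_partial is (\<lambda>x::real^'n. 1) = (\<lambda>x. if is = [] then 1 else 0)" for "is"
    by (induction "is") (auto simp: partial_deriv_const intro!: ext)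
  have "schwartz (\<lambda>x. gexp w \<beta> a c x * 1)"
    by (rule schwartz_gexp_mult) (auto simp: it assms)
  then show ?thesis by simp
qed

lemma iter_partial_eq_0_off:
  assumes S: "open S" and f: "\<And>x. x \<in> S \<Longrightarrow> f x = 0" and "x \<in> S"
  shows "iter_partial is f x = 0"
  using \<open>x \<in> S\<close>
proof (induction "is" arbitrary: x)
  case (Cons i "is")
  have "(iter_partial is f has_derivative (\<lambda>h. 0)) (at x)"
    by (rule has_derivative_transform_within_open[OF has_derivative_const S Cons.prems]) (simp add: Cons.IH)
  from partial_derivI[OF this] show ?case by simp
qed (simp add: f)

text \<open>Vanishing passes to derivatives only on open sets, and the complement of the open
  annulus is not open. Hence the closed annulus in the conclusion.\<close>

lemma fourier_annulus_bound:
  fixes \<Psi> :: "real^'n \<Rightarrow> complex"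
  assumes \<Psi>: "schwartz \<Psi>" and supp: "\<And>\<xi>. fourier \<Psi> \<xi> \<noteq> 0 \<Longrightarrow> 1/2 < norm \<xi> \<and> norm \<xi> < 2"
  shows "\<exists>C. \<forall>x. norm (iter_partial is (fourier \<Psi>) x) \<le> C * indicator {x. 1/2 \<le> norm x \<and> norm x \<le> 2} x"
proof -
  obtain C where C: "\<And>x. norm (iter_partial is (fourier \<Psi>) x) \<le> C"
    using fourier_schwartz[OF \<Psi>] unfolding schwartz_def by (metis mult_1 power_0)
  have "open {x::real^'n. norm x < 1/2 \<or> norm x > 2}"
    by (intro open_Collect_disj open_Collect_less continuous_intros)
  then have "iter_partial is (fourier \<Psi>) x = 0" if "norm x < 1/2 \<or> norm x > 2" for x
    by (rule iter_partial_eq_0_off) (use supp that in force)+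
  then show ?thesis using C by (intro exI[of _ C]) (auto simp: indicator_def not_le)
qed

section \<open>Gaussians and Fourier inversion\<close>

definition gauss :: "complex \<Rightarrow> real^'n \<Rightarrow> complex" where
  "gauss z = gexp (of_real pi * z) 0 0 0"

lemma gauss_eq: "gauss z x = exp (- (of_real (pi * (norm x)\<^sup>2) * z))"
  by (simp add: gauss_def gexp_def mult_ac)

lemma norm_gauss: "norm (gauss z x) = exp (- (pi * Re z) * (norm x)\<^sup>2)"
  by (simp add: gauss_eq mult_ac)

lemma gauss_mult: "gauss z x * gauss w x = gauss (z + w) x"
  by (simp add: gauss_eq exp_add[symmetric] algebra_simps)

lemma gauss_of_real: "gauss (of_real t) x = of_real (exp (- (pi * t) * (norm x)\<^sup>2))"
  by (simp add: gauss_eq exp_of_real[symmetric] mult_ac)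

lemma gauss_0 [simp]: "gauss z 0 = 1"
  by (simp add: gauss_eq)

lemma gauss_minus [simp]: "gauss z (- x) = gauss z x"
  by (simp add: gauss_eq)

lemma cnj_gauss: "cnj (gauss z x) = gauss (cnj z) x"
  by (simp add: gauss_eq exp_cnj)

lemma schwartz_gauss: "Re z > 0 \<Longrightarrow> schwartz (gauss z)"
  unfolding gauss_def by (rule schwartz_gexp) simp

lemma borel_measurable_gauss [measurable]: "gauss z \<in> borel_measurable borel"
  unfolding gauss_eq[abs_def] by (intro borel_measurable_continuous_onI continuous_intros)

lemma partial_deriv_gauss: "partial_deriv i (gauss z) x = (- 2 * of_real pi * z) * (of_real (x $ i) * gauss z x)"
  unfolding gauss_def partial_deriv_gexp glin_def by simp

lemma nn_integral_exp_square_real: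
  assumes "t > 0"
  shows "(\<integral>\<^sup>+x. ennreal (exp (- (pi * t) * x\<^sup>2)) \<partial>lborel) = ennreal (t powr (- 1 / 2))"
proof -
  \<comment> \<open>The standard deviation for which the normal density is a multiple of exp (- pi t
    x^2), so that its total mass 1 gives the integral.\<close>
  define \<sigma> where "\<sigma> = 1 / sqrt (2 * pi * t)"
  have \<sigma>: "\<sigma> > 0" using assms by (simp add: \<sigma>_def)
  have s2: "\<sigma>\<^sup>2 = 1 / (2 * pi * t)" using assms by (simp add: \<sigma>_def power_divide)
  have "exp (- (pi * t) * x\<^sup>2) = t powr (- 1 / 2) * normal_density 0 \<sigma> x" for x
    using assms by (simp add: normal_density_def s2 powr_minus powr_half_sqrt field_simps real_sqrt_divide)
  then have "(\<integral>\<^sup>+x. ennreal (exp (- (pi * t) * x\<^sup>2)) \<partial>lborel) =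
      (\<integral>\<^sup>+x. ennreal (t powr (- 1 / 2)) * ennreal (normal_density 0 \<sigma> x) \<partial>lborel)"
    by (simp add: ennreal_mult' normal_density_nonneg)
  also have "\<dots> = ennreal (t powr (- 1 / 2)) * (\<integral>\<^sup>+x. ennreal (normal_density 0 \<sigma> x) \<partial>lborel)"
    by (rule nn_integral_cmult) simp
  also have "(\<integral>\<^sup>+x. ennreal (normal_density 0 \<sigma> x) \<partial>lborel) = 1"
    using \<sigma> by (subst nn_integral_eq_integral) (auto simp: normal_density_nonneg)
  finally show ?thesis by simp
qed

lemma nn_integral_exp_square:
  assumes "t > 0"
  shows "(\<integral>\<^sup>+x. ennreal (exp (- (pi * t) * (norm x)\<^sup>2)) \<partial>(lborel :: 'a::euclidean_space measure)) =
    ennreal (t powr (- real DIM('a) / 2))"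
proof -
  have "ennreal (exp (- (pi * t) * (norm x)\<^sup>2)) = (\<Prod>b\<in>Basis. ennreal (exp (- (pi * t) * (x \<bullet> b)\<^sup>2)))" for x :: 'a
  proof -
    have "(norm x)\<^sup>2 = (\<Sum>b\<in>Basis. (x \<bullet> b)\<^sup>2)"
      unfolding power2_norm_eq_inner by (subst euclidean_inner) (simp add: power2_eq_square)
    then have "exp (- (pi * t) * (norm x)\<^sup>2) = (\<Prod>b\<in>Basis. exp (- (pi * t) * (x \<bullet> b)\<^sup>2))"
      by (simp add: sum_distrib_left exp_sum[symmetric] sum_negf)
    then show ?thesis by (simp add: prod_ennreal)
  qed
  then have "(\<integral>\<^sup>+x. ennreal (exp (- (pi * t) * (norm x)\<^sup>2)) \<partial>(lborel :: 'a measure)) =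
     (\<integral>\<^sup>+x. (\<Prod>b\<in>Basis. ennreal (exp (- (pi * t) * (x \<bullet> b)\<^sup>2))) \<partial>(lborel :: 'a measure))" by simp
  also have "\<dots> = (\<Prod>b\<in>(Basis :: 'a set). \<integral>\<^sup>+x. ennreal (exp (- (pi * t) * x\<^sup>2)) \<partial>lborel)"
    by (rule nn_integral_lborel_prod) auto
  also have "\<dots> = ennreal (t powr (- 1 / 2)) ^ DIM('a)"
    using nn_integral_exp_square_real[OF assms] by simp
  also have "\<dots> = ennreal (t powr (- real DIM('a) / 2))"
    using assms by (simp add: ennreal_power powr_realpow[symmetric] powr_powr)
  finally show ?thesis .
qed

lemma has_bochner_integral_exp_square:
  assumes "t > 0"
  shows "has_bochner_integral lborel (\<lambda>x::'a::euclidean_space. exp (- (pi * t) * (norm x)\<^sup>2)) (t powr (- real DIM('a) / 2))"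
  by (rule has_bochner_integral_nn_integral) (use nn_integral_exp_square[OF assms] in auto)

text \<open>The transform and \<open>gauss (1 / z)\<close> satisfy the same first-order system,
  since differentiating and multiplying by a coordinate exchange roles under the transform. So the
  product with the inverse Gaussian has zero derivative and is constant. This treats complex z
  without shifting contours, at the price of leaving the value at 0 undetermined for now.\<close>

lemma fourier_gauss:
  fixes \<xi> :: "real^'n"
  assumes z: "Re z > 0"
  shows "fourier (gauss z) \<xi> = fourier (gauss z) (0::real^'n) * gauss (1 / z) \<xi>"
proof -
  have z0: "z \<noteq> 0" using z by auto
  let ?G = "fourier (gauss z) :: real^'n \<Rightarrow> complex"
  let ?H = "\<lambda>\<xi>::real^'n. ?G \<xi> * gauss (- 1 / z) \<xi>"
  note sch = schwartz_gauss[OF z]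
  have pG: "partial_deriv i ?G \<xi> = - (2 * of_real pi / z) * of_real (\<xi> $ i) * ?G \<xi>" for i \<xi>
  proof -
    have "partial_deriv i ?G \<xi> = fourier (\<lambda>x. (\<i> / z) * partial_deriv i (gauss z) x) \<xi>"
      unfolding partial_deriv_fourier[OF sch] partial_deriv_gauss
      using z0 by (intro arg_cong[of _ _ "\<lambda>f. fourier f \<xi>"] ext) (simp add: field_simps)
    also have "\<dots> = (\<i> / z) * (2 * pi * \<i> * of_real (\<xi> $ i) * ?G \<xi>)"
      unfolding fourier_cmult fourier_partial_deriv[OF sch] ..
    finally show ?thesis using z0 by (simp add: field_simps)
  qed
  have dg: "gauss (- 1 / z) differentiable (at \<xi>)" for \<xi> :: "real^'n"
    unfolding gauss_def by (rule gexp_differentiable)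
  have "partial_deriv i ?H \<xi> = 0" for i \<xi>
    by (subst partial_deriv_mult[OF fourier_differentiable[OF sch] dg])
      (use z0 in \<open>simp add: pG partial_deriv_gauss field_simps\<close>)
  moreover have "?H differentiable (at \<xi>)" for \<xi>
    by (intro differentiable_mult fourier_differentiable[OF sch] dg)
  ultimately have "(?H has_derivative (\<lambda>h. 0)) (at \<xi>)" for \<xi>
    using has_derivative_partial[of ?H \<xi>] by simp
  then obtain c where c: "\<And>\<xi>. ?H \<xi> = c"
    using has_derivative_zero_constant[of UNIV ?H] by auto
  have "?G \<xi> = ?H \<xi> * gauss (1 / z) \<xi>"
    by (simp add: mult.assoc gauss_mult) (simp add: gauss_eq)
  also have "?H \<xi> = ?H 0" by (simp only: c)
  finally show ?thesis by simp
qed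

lemma fourier_gauss_of_real_0:
  assumes "t > 0"
  shows "fourier (gauss (of_real t)) (0::real^'n) = of_real (t powr (- real CARD('n) / 2))"
  using has_bochner_integral_integral_eq[OF has_bochner_integral_exp_square[OF assms, where 'a = "real^'n"]]
  by (simp add: fourier_eq gauss_of_real)

text \<open>The transform of \<open>gauss t\<close>, a probability density. In this normalisation
  the usual heat kernel at time \<tau> is the case t = 4 pi \<tau>.\<close>

definition heat_kernel :: "real \<Rightarrow> real^'n \<Rightarrow> real" where
  "heat_kernel t y = t powr (- real CARD('n) / 2) * exp (- (pi / t) * (norm y)\<^sup>2)"

lemma fourier_gauss_of_real:
  assumes "t > 0"
  shows "fourier (gauss (of_real t)) \<xi> = of_real (heat_kernel t \<xi>)"
  using assms gauss_of_real[of "1 / t" \<xi>]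
  by (subst fourier_gauss) (simp_all add: fourier_gauss_of_real_0 heat_kernel_def)

lemma heat_kernel_nonneg [simp]: "heat_kernel t y \<ge> 0"
  by (simp add: heat_kernel_def)

lemma borel_measurable_heat_kernel [measurable]: "heat_kernel t \<in> borel_measurable borel"
  unfolding heat_kernel_def[abs_def] by measurable

lemma has_bochner_integral_heat_kernel:
  assumes "t > 0"
  shows "has_bochner_integral lborel (heat_kernel t :: real^'n \<Rightarrow> real) 1"
proof -
  have "has_bochner_integral lborel (\<lambda>y::real^'n. t powr (- real CARD('n) / 2) * exp (- (pi * (1 / t)) * (norm y)\<^sup>2))
    (t powr (- real CARD('n) / 2) * (1 / t) powr (- real DIM(real^'n) / 2))"
    using assms by (intro has_bochner_integral_mult_right has_bochner_integral_exp_square) auto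
  also have "t powr (- real CARD('n) / 2) * (1 / t) powr (- real DIM(real^'n) / 2) = 1"
    using assms by (simp add: powr_divide powr_minus field_simps)
  finally show ?thesis by (simp add: heat_kernel_def[abs_def])
qed

lemma integrable_heat_kernel: "t > 0 \<Longrightarrow> integrable lborel (heat_kernel t)"
  and integral_heat_kernel: "t > 0 \<Longrightarrow> integral\<^sup>L lborel (heat_kernel t) = 1"
  using has_bochner_integral_heat_kernel has_bochner_integral_iff by blast+

section \<open>Multiplication formula and Fourier inversion\<close>

lemma integrable_pair_mult_cis:
  fixes f :: "'a::euclidean_space \<Rightarrow> complex" and g :: "'b::euclidean_space \<Rightarrow> complex"
  assumes f: "integrable lborel f" and g: "integrable lborel g"
    and [measurable]: "k \<in> borel_measurable (lborel \<Otimes>\<^sub>M lborel)"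
  shows "integrable (lborel \<Otimes>\<^sub>M lborel) (\<lambda>(x, y). f x * g y * cis (k (x, y)))"
proof -
  have [measurable]: "f \<in> borel_measurable borel" "g \<in> borel_measurable borel"
    using borel_measurable_integrable[OF f] borel_measurable_integrable[OF g] by simp_all
  show ?thesis
  proof (rule lborel_pair.Fubini_integrable)
    show "(\<lambda>(x, y). f x * g y * cis (k (x, y))) \<in> borel_measurable (lborel \<Otimes>\<^sub>M lborel)" by measurable
    show "integrable lborel (\<lambda>x. LINT y|lborel. norm (case (x, y) of (x, y) \<Rightarrow> f x * g y * cis (k (x, y))))"
      using f by (simp add: norm_mult)
    show "AE x in lborel. integrable lborel (\<lambda>y. case (x, y) of (x, y) \<Rightarrow> f x * g y * cis (k (x, y)))"
    proof (intro AE_I2)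
      fix x :: 'a
      have "(\<lambda>y. k (x, y)) \<in> borel_measurable borel" by measurable
      then show "integrable lborel (\<lambda>y. case (x, y) of (x, y) \<Rightarrow> f x * g y * cis (k (x, y)))"
        by (simp only: prod.case) (intro integrable_mult_cis integrable_mult_right g)
    qed
  qed
qed

text \<open>Fubini with the symmetric kernel. It stands in for convolution theorems, for
  Plancherel's identity, and for the duality behind transforms of distributions.\<close>

lemma fourier_multiplication_formula:
  fixes f g :: "real^'n \<Rightarrow> complex"
  assumes f: "integrable lborel f" and g: "integrable lborel g"
  shows "(LINT \<xi>|lborel. fourier f \<xi> * g \<xi>) = (LINT y|lborel. f y * fourier g y)"
proof -
  have [measurable]: "f \<in> borel_measurable borel" "g \<in> borel_measurable borel"
    using borel_measurable_integrable[OF f] borel_measurable_integrable[OF g] by simp_all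
  have "(LINT \<xi>|lborel. fourier f \<xi> * g \<xi>) = (LINT \<xi>|lborel. LINT y|lborel. f y * g \<xi> * cis (- 2 * pi * (y \<bullet> \<xi>)))"
  proof (intro Bochner_Integration.integral_cong refl)
    fix \<xi> :: "real^'n"
    have "fourier f \<xi> * g \<xi> = (LINT y|lborel. f y * cis (- 2 * pi * (y \<bullet> \<xi>)) * g \<xi>)"
      by (simp only: fourier_eq[OF \<open>f \<in> borel_measurable borel\<close>] integral_mult_left_zero)
    then show "fourier f \<xi> * g \<xi> = (LINT y|lborel. f y * g \<xi> * cis (- 2 * pi * (y \<bullet> \<xi>)))"
      by (simp only: mult_ac)
  qed
  also have "\<dots> = (LINT y|lborel. LINT \<xi>|lborel. f y * g \<xi> * cis (- 2 * pi * (y \<bullet> \<xi>)))"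
    using integrable_pair_mult_cis[OF f g, of "\<lambda>(y, \<xi>). - 2 * pi * (y \<bullet> \<xi>)"]
    by (intro lborel_pair.Fubini_integral) simp
  also have "\<dots> = (LINT y|lborel. f y * fourier g y)"
    by (intro Bochner_Integration.integral_cong refl) (simp add: fourier_eq inner_commute mult.assoc)
  finally show ?thesis .
qed

text \<open>A Gaussian damping on the frequency side is an average of translates of f. This serves
  twice: as approximate identity in the inversion theorem and as kernel of the heat
  semigroup.\<close>

lemma inv_fourier_gauss_mult_fourier:
  fixes f :: "real^'n \<Rightarrow> complex"
  assumes f: "integrable lborel f" and t: "t > 0"
  shows "inv_fourier (\<lambda>\<xi>. gauss (of_real t) \<xi> * fourier f \<xi>) x = (LINT y|lborel. f (x + y) * of_real (heat_kernel t y))"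
proof -
  have [measurable]: "f \<in> borel_measurable borel"
    using borel_measurable_integrable[OF f] by simp
  have [measurable]: "fourier f \<in> borel_measurable borel"
    unfolding fourier_eq[OF \<open>f \<in> borel_measurable borel\<close>, abs_def] by measurable
  have g: "integrable lborel (\<lambda>\<xi>::real^'n. gauss (of_real t) \<xi> * cis (2 * pi * (x \<bullet> \<xi>)))"
    using t by (intro integrable_mult_cis schwartz_integrable schwartz_gauss) auto
  have "inv_fourier (\<lambda>\<xi>. gauss (of_real t) \<xi> * fourier f \<xi>) x =
     (LINT \<xi>|lborel. fourier f \<xi> * (gauss (of_real t) \<xi> * cis (2 * pi * (x \<bullet> \<xi>))))"
    unfolding inv_fourier_def by (subst integral_lebesgue_lborel) (simp_all add: mult_ac)
  also have "\<dots> = (LINT y|lborel. f y * fourier (\<lambda>\<xi>. gauss (of_real t) \<xi> * cis (2 * pi * (x \<bullet> \<xi>))) y)"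
    by (rule fourier_multiplication_formula[OF f g])
  also have "\<dots> = (LINT y|lborel. f y * of_real (heat_kernel t (y - x)))"
  proof (intro Bochner_Integration.integral_cong refl arg_cong2[of _ _ _ _ "(*)"])
    fix y :: "real^'n"
    have "fourier (\<lambda>\<xi>. gauss (of_real t) \<xi> * cis (2 * pi * (x \<bullet> \<xi>))) y = fourier (gauss (of_real t)) (y - x)"
      by (subst (1 2) fourier_eq) (auto intro!: Bochner_Integration.integral_cong simp: mult.assoc cis_mult inner_diff_right algebra_simps inner_commute)
    then show "fourier (\<lambda>\<xi>. gauss (of_real t) \<xi> * cis (2 * pi * (x \<bullet> \<xi>))) y = of_real (heat_kernel t (y - x))"
      using t by (simp add: fourier_gauss_of_real)
  qed
  also have "\<dots> = (LINT y|lborel. f (y + x) * of_real (heat_kernel t (y + x - x)))"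
    by (intro integral_lborel_translate[symmetric]) measurable
  finally show ?thesis by (simp add: add.commute)
qed

lemma schwartz_lipschitz:
  fixes f :: "real^'n \<Rightarrow> complex"
  assumes f: "schwartz f"
  obtains L where "L \<ge> 0" "\<And>x y. norm (f (x + y) - f x) \<le> L * norm y"
proof -
  have "\<exists>B. \<forall>x. norm (partial_deriv i f x) \<le> B" for i
    using schwartz_decay0[OF schwartz_partial_deriv[OF f], of 0] by simp
  then obtain B where B: "\<And>i x. norm (partial_deriv i f x) \<le> B i" by metis
  have B0: "B i \<ge> 0" for i using B[of i 0] norm_ge_zero order_trans by blast
  define L where "L = (\<Sum>i\<in>UNIV. B i)"
  have "norm (f (x + y) - f x) \<le> L * norm (x + y - x)" for x y
  proof (rule differentiable_bound[of UNIV])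
    show "(f has_derivative (\<lambda>h. \<Sum>i\<in>UNIV. of_real (h $ i) * partial_deriv i f x)) (at x within UNIV)" for x
      by (rule has_derivative_partial[OF schwartz_differentiable[OF f]])
    show "onorm (\<lambda>h. \<Sum>i\<in>UNIV. of_real (h $ i) * partial_deriv i f x) \<le> L" for x
    proof (rule onorm_le)
      fix h :: "real^'n"
      have "norm (\<Sum>i\<in>UNIV. of_real (h $ i) * partial_deriv i f x) \<le> (\<Sum>i\<in>UNIV. norm (of_real (h $ i) * partial_deriv i f x))"
        by (rule norm_sum)
      also have "\<dots> \<le> (\<Sum>i\<in>UNIV. norm h * B i)"
        by (intro sum_mono) (simp add: norm_mult mult_mono component_le_norm_cart B)
      also have "\<dots> = L * norm h" by (simp add: L_def sum_distrib_left mult.commute sum_distrib_right)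
      finally show "norm (\<Sum>i\<in>UNIV. of_real (h $ i) * partial_deriv i f x) \<le> L * norm h" .
    qed
  qed auto
  then have "\<And>x y. norm (f (x + y) - f x) \<le> L * norm y" by simp
  moreover have "L \<ge> 0" unfolding L_def by (intro sum_nonneg B0)
  ultimately show ?thesis using that by blast
qed

text \<open>The factor |y| from a Lipschitz estimate is traded for a quarter of the exponent of the
  heat kernel. Three quarters of the exponent remain, so a first moment of order sqrt t is obtained
  from Gaussian integrals alone.\<close>

lemma norm_le_sqrt_mult_exp:
  fixes y :: "'a::real_normed_vector"
  assumes "t > 0"
  shows "norm y \<le> sqrt t * exp ((pi / (4 * t)) * (norm y)\<^sup>2)"
proof -
  define s where "s = (norm y)\<^sup>2 / t"
  have s: "s \<ge> 0" using assms by (simp add: s_def)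
  have "s \<le> exp ((pi / 4) * s) ^ 2"
  proof -
    have "s \<le> 1 + pi / 2 * s"
    proof -
      have "1 * s \<le> pi / 2 * s" using s pi_gt3 by (intro mult_right_mono) auto
      then show ?thesis by simp
    qed
    also have "\<dots> \<le> exp (pi / 2 * s)" by (rule exp_ge_add_one_self)
    also have "\<dots> = exp ((pi / 4) * s) ^ 2" by (simp add: power2_eq_square exp_add[symmetric])
    finally show ?thesis .
  qed
  then have "sqrt t * sqrt s \<le> sqrt t * exp ((pi / 4) * s)"
    by (intro mult_left_mono) (simp_all add: real_le_lsqrt s assms less_imp_le)
  moreover have "sqrt t * sqrt s = norm y" using assms by (simp add: s_def real_sqrt_divide)
  moreover have "(pi / 4) * s = (pi / (4 * t)) * (norm y)\<^sup>2" by (simp add: s_def)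
  ultimately show ?thesis by (simp only:)
qed

text \<open>The integral damped by \<open>gauss (t k)\<close> has two limits as t k tends to 0.
  Dominated convergence yields the undamped inverse transform. Written as an average of f against
  the heat kernel it tends to f x, with error of order sqrt (t k) because f is Lipschitz.\<close>

lemma fourier_inversion:
  fixes f :: "real^'n \<Rightarrow> complex"
  assumes f: "schwartz f"
  shows "inv_fourier (fourier f) x = f x"
proof -
  define t where "t k = 1 / real (Suc k)" for k
  have t: "t k > 0" for k by (simp add: t_def)
  let ?I = "\<lambda>k. inv_fourier (\<lambda>\<xi>. gauss (of_real (t k)) \<xi> * fourier f \<xi>) x"
  note F = fourier_schwartz[OF f]
  have [measurable]: "f \<in> borel_measurable borel" "fourier f \<in> borel_measurable borel"
    by (rule schwartz_borel[OF f] schwartz_borel[OF F])+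
  have t0: "t \<longlonglongrightarrow> 0" unfolding t_def using LIMSEQ_inverse_real_of_nat by (simp add: inverse_eq_divide)
  have "?I \<longlonglongrightarrow> inv_fourier (fourier f) x"
    unfolding inv_fourier_def
  proof (subst (1 2) integral_lebesgue_lborel)
    show "(\<lambda>k. LINT \<xi>|lborel. gauss (of_real (t k)) \<xi> * fourier f \<xi> * cis (2 * pi * (x \<bullet> \<xi>))) \<longlonglongrightarrow>
      (LINT \<xi>|lborel. fourier f \<xi> * cis (2 * pi * (x \<bullet> \<xi>)))"
    proof (rule integral_dominated_convergence[where w = "\<lambda>\<xi>. norm (fourier f \<xi>)"])
      show "integrable lborel (\<lambda>\<xi>. norm (fourier f \<xi>))"
        by (intro integrable_norm schwartz_integrable F)
      show "AE \<xi> in lborel. (\<lambda>k. gauss (of_real (t k)) \<xi> * fourier f \<xi> * cis (2 * pi * (x \<bullet> \<xi>))) \<longlonglongrightarrow> fourier f \<xi> * cis (2 * pi * (x \<bullet> \<xi>))"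
      proof (intro AE_I2)
        fix \<xi> :: "real^'n"
        have "(\<lambda>k. gauss (of_real (t k)) \<xi>) \<longlonglongrightarrow> exp (- (of_real (pi * (norm \<xi>)\<^sup>2) * of_real 0))"
          unfolding gauss_eq by (intro tendsto_intros t0)
        then have "(\<lambda>k. gauss (of_real (t k)) \<xi>) \<longlonglongrightarrow> 1" by simp
        from tendsto_mult[OF tendsto_mult[OF this tendsto_const[of "fourier f \<xi>"]] tendsto_const[of "cis (2 * pi * (x \<bullet> \<xi>))"]]
        show "(\<lambda>k. gauss (of_real (t k)) \<xi> * fourier f \<xi> * cis (2 * pi * (x \<bullet> \<xi>))) \<longlonglongrightarrow> fourier f \<xi> * cis (2 * pi * (x \<bullet> \<xi>))"
          by simp
      qed
      show "AE \<xi> in lborel. norm (gauss (of_real (t k)) \<xi> * fourier f \<xi> * cis (2 * pi * (x \<bullet> \<xi>))) \<le> norm (fourier f \<xi>)" for k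
        using t[of k] by (intro AE_I2) (simp add: norm_mult norm_gauss mult_left_le_one_le)
    qed measurable
  qed measurable
  moreover have "?I \<longlonglongrightarrow> f x"
  proof -
    obtain L where L: "L \<ge> 0" "\<And>x y. norm (f (x + y) - f x) \<le> L * norm y" using schwartz_lipschitz[OF f] by blast
    let ?n = "real CARD('n)"
    have bd: "norm (?I k - f x) \<le> L * ((3/4) powr (- ?n / 2)) * sqrt (t k)" for k
    proof -
      let ?h = "heat_kernel (t k) :: real^'n \<Rightarrow> real"
      obtain B where B: "B \<ge> 0" "\<And>x. norm (f x) \<le> B" using schwartz_bounded[OF f] by blast
      have hi: "integrable lborel ?h" by (rule integrable_heat_kernel[OF t])
      have i1: "integrable lborel (\<lambda>y. f (x + y) * of_real (?h y))"
        by (rule Bochner_Integration.integrable_bound[OF integrable_mult_right[OF hi, of B]])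
          (use B in \<open>auto simp: norm_mult intro!: AE_I2 mult_right_mono\<close>)
      have i2: "integrable lborel (\<lambda>y. f x * of_real (?h y))"
        by (intro integrable_mult_right integrable_of_real hi)
      have ih: "integral\<^sup>L lborel ?h = 1" by (rule integral_heat_kernel[OF t])
      have "f x = (LINT y|lborel. f x * of_real (?h y))"
        using ih by simp
      then have "?I k - f x = (LINT y|lborel. f (x + y) * of_real (?h y)) - (LINT y|lborel. f x * of_real (?h y))"
        using inv_fourier_gauss_mult_fourier[OF schwartz_integrable[OF f] t[of k], of x] by simp
      also have "\<dots> = (LINT y|lborel. (f (x + y) - f x) * of_real (?h y))"
        using i1 i2 by (simp add: left_diff_distrib)
      finally have "norm (?I k - f x) \<le> (LINT y|lborel. norm ((f (x + y) - f x) * of_real (?h y)))"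
        by (simp only: integral_norm_bound)
      also have "\<dots> \<le> (LINT y::real^'n|lborel. (L * sqrt (t k) * t k powr (- ?n / 2)) * exp (- (pi * (3 / (4 * t k))) * (norm y)\<^sup>2))"
      proof (rule integral_mono')
        show "integrable lborel (\<lambda>y::real^'n. (L * sqrt (t k) * t k powr (- ?n / 2)) * exp (- (pi * (3 / (4 * t k))) * (norm y)\<^sup>2))"
          using t[of k] has_bochner_integral_exp_square[of "3 / (4 * t k)", where 'a = "real^'n"]
          by (intro integrable_mult_right) (auto simp: has_bochner_integral_iff)
        fix y :: "real^'n"
        have "norm ((f (x + y) - f x) * of_real (?h y)) \<le> (L * (sqrt (t k) * exp ((pi / (4 * t k)) * (norm y)\<^sup>2))) * ?h y"
          unfolding norm_mult
          using order_trans[OF L(2)[of x y] mult_left_mono[OF norm_le_sqrt_mult_exp[OF t[of k], of y] L(1)]]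
          by (intro mult_mono) (use L(1) t[of k] in \<open>simp_all add: less_imp_le\<close>)
        also have "\<dots> = (L * sqrt (t k) * t k powr (- ?n / 2)) * (exp ((pi / (4 * t k)) * (norm y)\<^sup>2) * exp (- (pi / t k) * (norm y)\<^sup>2))"
          by (simp add: heat_kernel_def mult_ac)
        also have "exp ((pi / (4 * t k)) * (norm y)\<^sup>2) * exp (- (pi / t k) * (norm y)\<^sup>2) = exp (- (pi * (3 / (4 * t k))) * (norm y)\<^sup>2)"
          using t[of k] by (simp add: exp_add[symmetric] field_simps)
        finally show "norm ((f (x + y) - f x) * of_real (?h y)) \<le> (L * sqrt (t k) * t k powr (- ?n / 2)) * exp (- (pi * (3 / (4 * t k))) * (norm y)\<^sup>2)" .
      qed (use L(1) t[of k] in auto)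
      also have "\<dots> = (L * sqrt (t k) * t k powr (- ?n / 2)) * (3 / (4 * t k)) powr (- ?n / 2)"
        using t[of k] has_bochner_integral_integral_eq[OF has_bochner_integral_exp_square[of "3 / (4 * t k)", where 'a = "real^'n"]]
        by simp
      also have "\<dots> = L * sqrt (t k) * (t k * (3 / (4 * t k))) powr (- ?n / 2)"
        using t[of k] by (subst powr_mult) (simp_all del: times_divide_eq_right)
      also have "\<dots> = L * ((3/4) powr (- ?n / 2)) * sqrt (t k)"
        using t[of k] by simp
      finally show ?thesis .
    qed
    have "(\<lambda>k. L * ((3/4) powr (- ?n / 2)) * sqrt (t k)) \<longlonglongrightarrow> L * ((3/4) powr (- ?n / 2)) * sqrt 0"
      by (intro tendsto_intros t0)
    then have "(\<lambda>k. L * ((3/4) powr (- ?n / 2)) * sqrt (t k)) \<longlonglongrightarrow> 0" by simp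
    then have "(\<lambda>k. ?I k - f x) \<longlonglongrightarrow> 0"
      by (rule Lim_null_comparison[rotated]) (intro always_eventually allI bd)
    then show ?thesis by (simp add: LIM_zero_iff)
  qed
  ultimately show ?thesis by (rule LIMSEQ_unique)
qed

lemma integral_lborel_reflect:
  fixes f :: "'a::euclidean_space \<Rightarrow> 'b::{banach, second_countable_topology}"
  assumes [measurable]: "f \<in> borel_measurable borel"
  shows "(LINT x|lborel. f (- x)) = (LINT x|lborel. f x)"
proof -
  have "(lborel :: 'a measure) = distr lborel borel uminus"
    using lborel_affine[of "- 1" "0 :: 'a"] by (simp add: density_1)
  then have "(LINT x|lborel. f x) = (LINT x|distr lborel borel uminus. f x)" by simp
  also have "\<dots> = (LINT x|lborel. f (- x))" by (rule integral_distr) auto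
  finally show ?thesis by simp
qed

lemma fourier_reflect:
  assumes [measurable]: "g \<in> borel_measurable borel"
  shows "fourier (\<lambda>x. g (- x)) y = fourier g (- y)"
  using integral_lborel_reflect[of "\<lambda>x. g x * cis (- 2 * pi * (x \<bullet> (- y)))"]
  by (simp add: fourier_eq)

lemma borel_measurable_fourier:
  assumes "f \<in> borel_measurable borel"
  shows "fourier f \<in> borel_measurable borel"
proof -
  note [measurable] = assms
  show ?thesis unfolding fourier_eq[OF assms, abs_def] by measurable
qed

lemma inv_fourier_multiplication_formula:
  fixes f g :: "real^'n \<Rightarrow> complex"
  assumes f: "integrable lborel f" and g: "integrable lborel g"
  shows "(LINT \<xi>|lborel. inv_fourier f \<xi> * g \<xi>) = (LINT y|lborel. f y * inv_fourier g y)"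
proof -
  have [measurable]: "f \<in> borel_measurable borel" "g \<in> borel_measurable borel"
    using borel_measurable_integrable[OF f] borel_measurable_integrable[OF g] by simp_all
  note [measurable] = borel_measurable_fourier
  have g': "integrable lborel (\<lambda>x. g (- x))"
  proof -
    have "(lborel :: (real^'n) measure) = distr lborel borel uminus"
      using lborel_affine[of "- 1" "0 :: real^'n"] by (simp add: density_1)
    then have "integrable (distr lborel borel uminus) g" using g by simp
    then show ?thesis by (rule integrable_distr[rotated]) simp
  qed
  have "(LINT \<xi>|lborel. inv_fourier f \<xi> * g \<xi>) = (LINT \<xi>|lborel. fourier f \<xi> * g (- \<xi>))"
    using integral_lborel_reflect[of "\<lambda>\<xi>. fourier f \<xi> * g (- \<xi>)"] by (simp add: inv_fourier_eq_fourier)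
  also have "\<dots> = (LINT y|lborel. f y * fourier (\<lambda>x. g (- x)) y)"
    by (rule fourier_multiplication_formula[OF f g'])
  also have "\<dots> = (LINT y|lborel. f y * inv_fourier g y)"
    by (simp add: fourier_reflect inv_fourier_eq_fourier)
  finally show ?thesis .
qed

lemma Re_inverse_pos: "Re z > 0 \<Longrightarrow> Re (1 / z) > 0"
  by (auto simp: Re_divide intro!: divide_pos_pos add_pos_nonneg)

lemma Re_inverse_eq: "Re (1 / z) = Re z / (norm z)\<^sup>2"
  by (simp add: Re_divide cmod_power2)

text \<open>Plancherel's identity for Gaussians gives the modulus without choosing a branch of
  \<open>z powr (- n / 2)\<close>.\<close>

lemma norm_fourier_gauss_0:
  assumes z: "Re z > 0"
  shows "norm (fourier (gauss z) (0::real^'n)) = norm z powr (- real CARD('n) / 2)"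
proof -
  let ?c = "fourier (gauss z) (0::real^'n)" and ?d = "fourier (gauss (1 / z)) (0::real^'n)"
  let ?n = "real CARD('n)"
  let ?b = "Re z / (norm z)\<^sup>2"
  have z0: "z \<noteq> 0" using z by auto
  have z': "Re (1 / z) > 0" by (rule Re_inverse_pos[OF z])
  have "1 = inv_fourier (fourier (gauss z)) (0::real^'n)"
    by (simp add: fourier_inversion schwartz_gauss z)
  also have "\<dots> = fourier (\<lambda>\<xi>. ?c * gauss (1 / z) \<xi>) (0::real^'n)"
    unfolding inv_fourier_eq_fourier by (subst fourier_gauss[OF z, abs_def]) simp
  also have "\<dots> = ?c * ?d" by (rule fourier_cmult)
  finally have cd: "?c * ?d = 1" by simp
  have cnj_F: "fourier (gauss (cnj w)) (0::real^'n) = cnj (fourier (gauss w) (0::real^'n))" for w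
    by (simp add: fourier_eq flip: cnj_gauss)
  have "Re (cnj w) = Re w" for w by simp
  then have zc: "Re (cnj (1 / z)) > 0" using z' by (simp only:)
  \<comment> \<open>The conjugate of the transform of \<open>gauss z\<close>. Paired with that
    transform it gives the squared L^2 norm, and by the identity \<open>cd\<close> its own transform
    is \<open>gauss (cnj z)\<close>, so the other side of the multiplication formula is the squared
    L^2 norm of \<open>gauss z\<close>.\<close>
  let ?g = "\<lambda>\<xi>::real^'n. cnj ?c * gauss (cnj (1 / z)) \<xi>"
  have Fg: "fourier ?g y = gauss (cnj z) y" for y
  proof -
    have "fourier ?g y = cnj ?c * (cnj ?d * gauss (1 / cnj (1 / z)) y)"
      unfolding fourier_cmult by (subst fourier_gauss[OF zc]) (simp only: cnj_F)
    also have "\<dots> = cnj (?c * ?d) * gauss (cnj z) y" using z0 by simp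
    finally show ?thesis by (simp add: cd)
  qed
  have rez: "z + cnj z = of_real (2 * Re z)" for z by (simp add: complex_add_cnj)
  have "(LINT \<xi>|lborel. fourier (gauss z) \<xi> * ?g \<xi>) = (LINT y|lborel. gauss z y * fourier ?g y)"
    by (intro fourier_multiplication_formula integrable_mult_right schwartz_integrable schwartz_gauss z zc)
  also have "\<dots> = (LINT y::real^'n|lborel. of_real (exp (- (pi * (2 * Re z)) * (norm y)\<^sup>2)))"
    by (simp only: Fg gauss_mult rez gauss_of_real)
  also have "\<dots> = of_real ((2 * Re z) powr (- ?n / 2))"
    using z has_bochner_integral_integral_eq[OF has_bochner_integral_exp_square[of "2 * Re z", where 'a = "real^'n"]]
    by simp
  also have "(LINT \<xi>|lborel. fourier (gauss z) \<xi> * ?g \<xi>) = (LINT \<xi>::real^'n|lborel. (?c * cnj ?c) * of_real (exp (- (pi * (2 * ?b)) * (norm \<xi>)\<^sup>2)))"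
  proof (intro Bochner_Integration.integral_cong refl)
    fix \<xi> :: "real^'n"
    have "fourier (gauss z) \<xi> * ?g \<xi> = (?c * cnj ?c) * (gauss (1 / z) \<xi> * gauss (cnj (1 / z)) \<xi>)"
      by (subst fourier_gauss[OF z]) (simp only: mult_ac)
    also have "\<dots> = (?c * cnj ?c) * of_real (exp (- (pi * (2 * ?b)) * (norm \<xi>)\<^sup>2))"
      by (simp only: gauss_mult rez gauss_of_real Re_inverse_eq)
    finally show "fourier (gauss z) \<xi> * ?g \<xi> = (?c * cnj ?c) * of_real (exp (- (pi * (2 * ?b)) * (norm \<xi>)\<^sup>2))" .
  qed
  also have "\<dots> = of_real ((norm ?c)\<^sup>2 * (2 * ?b) powr (- ?n / 2))"
    using z z0 has_bochner_integral_integral_eq[OF has_bochner_integral_exp_square[of "2 * ?b", where 'a = "real^'n"]]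
    by (simp add: complex_norm_square[symmetric])
  finally have "(norm ?c)\<^sup>2 * (2 * ?b) powr (- ?n / 2) = (2 * Re z) powr (- ?n / 2)"
    unfolding of_real_eq_iff .
  moreover have "(2 * ?b) powr (- ?n / 2) = (2 * Re z) powr (- ?n / 2) / ((norm z)\<^sup>2) powr (- ?n / 2)"
    using z z0 by (subst powr_divide[symmetric]) simp_all
  \<comment> \<open>Cancels the factor (2 Re z) powr (- n / 2) that both squared norms
    contain.\<close>
  moreover have "x = R" if "x * P = Q" "P = Q / R" "Q > 0" "R > 0" for x P Q R :: real
    using that by (simp add: field_simps)
  ultimately have "(norm ?c)\<^sup>2 = ((norm z)\<^sup>2) powr (- ?n / 2)"
    using z z0 by (metis mult_pos_pos powr_gt_zero zero_less_norm_iff zero_less_numeral zero_less_power order_less_irrefl)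
  also have "\<dots> = (norm z powr (- ?n / 2))\<^sup>2"
    using z0 by (simp add: powr_powr flip: powr_numeral)
  finally show ?thesis by (simp add: power2_eq_iff_nonneg)
qed

section \<open>Lower bound for Gaussian multipliers\<close>

lemma Lp_norm_le:
  fixes f :: "real^'n \<Rightarrow> complex"
  assumes "(\<integral>\<^sup>+x. ennreal (norm (f x) powr p) \<partial>lborel) \<le> ennreal (B powr p)" "B \<ge> 0" "p > 0"
  shows "Lp_norm p f \<le> ennreal B"
proof -
  let ?I = "\<integral>\<^sup>+x. ennreal (norm (f x) powr p) \<partial>lborel"
  have "?I \<noteq> \<infinity>" using assms(1) by (auto simp: top_unique)
  moreover have "enn2real ?I powr (1 / p) \<le> (B powr p) powr (1 / p)"
    using assms by (intro powr_mono2) (auto simp: enn2real_leI)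
  moreover have "(B powr p) powr (1 / p) = B" using assms by (simp add: powr_powr)
  ultimately show ?thesis
    by (simp add: Lp_norm_def Let_def nn_integral_lebesgue_lborel ennreal_leI)
qed

lemma Lp_norm_exp_square:
  fixes f :: "real^'n \<Rightarrow> complex"
  assumes f: "\<And>x. norm (f x) = A * exp (- (pi * b) * (norm x)\<^sup>2)" and "A \<ge> 0" "b > 0" "p > 0"
  shows "Lp_norm p f = ennreal (A * (p * b) powr (- real CARD('n) / (2 * p)))"
proof -
  have "norm (f x) powr p = A powr p * exp (- (pi * (p * b)) * (norm x)\<^sup>2)" for x
    using assms by (simp add: f powr_mult exp_powr_real mult_ac)
  then have "(\<integral>\<^sup>+x. ennreal (norm (f x) powr p) \<partial>lborel) =
     ennreal (A powr p) * (\<integral>\<^sup>+x. ennreal (exp (- (pi * (p * b)) * (norm x)\<^sup>2)) \<partial>(lborel :: (real^'n) measure))"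
    by (subst nn_integral_cmult[symmetric]) (auto simp: ennreal_mult')
  also have "\<dots> = ennreal (A powr p * (p * b) powr (- real CARD('n) / 2))"
    using assms by (subst nn_integral_exp_square) (auto simp: ennreal_mult')
  finally have "Lp_norm p f = ennreal ((A powr p * (p * b) powr (- real CARD('n) / 2)) powr (1 / p))"
    by (simp add: Lp_norm_def Let_def nn_integral_lebesgue_lborel)
  also have "(A powr p * (p * b) powr (- real CARD('n) / 2)) powr (1 / p) = A * (p * b) powr (- real CARD('n) / (2 * p))"
    using assms by (simp add: powr_mult powr_powr)
  finally show ?thesis .
qed

text \<open>The test function is the modulated Gaussian whose transform is a multiple of
  \<open>gauss z0 (\<xi> - a)\<close>, so applying the multiplier just adds the parameters.
  Modulation does not change moduli, and both L^p norms are explicit: the first factor of the bound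
  is the ratio of amplitudes, the second the effect of the change of width, which is governed by Re
  (1 / z).\<close>

lemma Lp_op_norm_gauss_ge:
  fixes a :: "real^'n"
  assumes z0: "Re z0 > 0" and z1: "Re z1 > 0" and p: "p > 0"
  shows "ennreal ((norm z0 / norm (z0 + z1)) powr (real CARD('n) / 2) *
            (Re (1 / z0) / Re (1 / (z0 + z1))) powr (real CARD('n) / (2 * p)))
      \<le> Lp_op_norm p (multiplier_op (\<lambda>\<xi>. gauss z1 (\<xi> - a)))"
proof -
  let ?n = "real CARD('n)"
  define f where "f x = gauss (1 / z0) x * cis (2 * pi * (a \<bullet> x))" for x
  define d where "d = fourier (gauss (1 / z0)) (0::real^'n)"
  define e where "e = fourier (gauss (z0 + z1)) (0::real^'n)"
  have z00: "z0 \<noteq> 0" "z0 + z1 \<noteq> 0" using z0 z1 by (auto simp: complex_eq_iff)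
  have z0': "Re (1 / z0) > 0" by (rule Re_inverse_pos[OF z0])
  have zz: "Re (z0 + z1) > 0" using z0 z1 by simp
  have zz': "Re (1 / (z0 + z1)) > 0" by (rule Re_inverse_pos[OF zz])
  have "f = gexp (of_real pi * (1 / z0)) (2 * pi * \<i>) a 0"
    by (rule ext) (simp add: f_def gauss_def gexp_def cis_conv_exp mult_exp_exp mult_ac add_ac)
  moreover have "Re (of_real pi * w) = pi * Re w" for w by simp
  then have "Re (of_real pi * (1 / z0)) > 0" using z0' by (simp only:) simp
  ultimately have fs: "schwartz f" by (simp only: schwartz_gexp)
  have "f 0 = 1" by (simp add: f_def)
  then have fn: "f \<noteq> (\<lambda>x. 0)" by auto
  have Ff: "fourier f \<xi> = d * gauss z0 (\<xi> - a)" for \<xi>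
  proof -
    have "fourier f \<xi> = fourier (gauss (1 / z0)) (\<xi> - a)"
      unfolding f_def by (subst (1 2) fourier_eq)
        (auto intro!: Bochner_Integration.integral_cong simp: mult.assoc cis_mult inner_diff_right inner_commute algebra_simps)
    also have "\<dots> = d * gauss (1 / (1 / z0)) (\<xi> - a)"
      unfolding d_def by (rule fourier_gauss[OF z0'])
    finally show ?thesis by simp
  qed
  have Tf: "multiplier_op (\<lambda>\<xi>. gauss z1 (\<xi> - a)) f x = d * cis (2 * pi * (x \<bullet> a)) * (e * gauss (1 / (z0 + z1)) x)" for x
  proof -
    have "multiplier_op (\<lambda>\<xi>. gauss z1 (\<xi> - a)) f x = (LINT \<xi>|lborel. d * gauss (z0 + z1) (\<xi> - a) * cis (2 * pi * (x \<bullet> \<xi>)))"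
      unfolding multiplier_op_def inv_fourier_def Ff mult.assoc gauss_mult
      by (rule integral_lebesgue_lborel) measurable
    also have "\<dots> = (LINT \<xi>|lborel. d * gauss (z0 + z1) (\<xi> + a - a) * cis (2 * pi * (x \<bullet> (\<xi> + a))))"
      by (rule integral_lborel_translate[symmetric]) measurable
    also have "\<dots> = (LINT \<xi>|lborel. (d * cis (2 * pi * (x \<bullet> a))) * (gauss (z0 + z1) \<xi> * cis (- 2 * pi * (\<xi> \<bullet> (- x)))))"
      by (intro Bochner_Integration.integral_cong refl) (simp add: inner_add_right inner_commute distrib_left cis_mult[symmetric])
    also have "\<dots> = (d * cis (2 * pi * (x \<bullet> a))) * fourier (gauss (z0 + z1)) (- x)"
      by (simp only: fourier_eq[OF borel_measurable_gauss] integral_mult_right_zero)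
    also have "fourier (gauss (z0 + z1)) (- x) = e * gauss (1 / (z0 + z1)) x"
      using fourier_gauss[OF zz, of "- x"] by (simp add: e_def)
    finally show ?thesis .
  qed
  have nd: "norm d = norm z0 powr (?n / 2)"
    unfolding d_def norm_fourier_gauss_0[OF z0'] using z00
    by (simp add: norm_divide powr_divide powr_minus field_simps)
  have ne: "norm e = norm (z0 + z1) powr (- ?n / 2)"
    unfolding e_def by (rule norm_fourier_gauss_0[OF zz])
  have 1: "Lp_norm p f = ennreal (1 * (p * Re (1 / z0)) powr (- ?n / (2 * p)))"
    using z0' p by (intro Lp_norm_exp_square) (simp_all add: f_def norm_mult norm_gauss)
  have 2: "Lp_norm p (multiplier_op (\<lambda>\<xi>. gauss z1 (\<xi> - a)) f) =
      ennreal ((norm d * norm e) * (p * Re (1 / (z0 + z1))) powr (- ?n / (2 * p)))"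
    using zz' p by (intro Lp_norm_exp_square) (simp_all add: Tf norm_mult norm_gauss)
  have "norm d * norm e * (p * Re (1 / (z0 + z1))) powr (- ?n / (2 * p)) / (1 * (p * Re (1 / z0)) powr (- ?n / (2 * p)))
     = (norm z0 / norm (z0 + z1)) powr (?n / 2) * (Re (1 / z0) / Re (1 / (z0 + z1))) powr (?n / (2 * p))"
  proof -
    have "norm d * norm e = (norm z0 / norm (z0 + z1)) powr (?n / 2)"
    proof -
      have "norm (z0 + z1) powr (- ?n / 2) = 1 / norm (z0 + z1) powr (?n / 2)"
        by (simp only: minus_divide_left[symmetric] powr_minus_divide)
      then show ?thesis unfolding nd ne by (subst powr_divide) simp_all
    qed
    moreover have "(p * Re (1 / (z0 + z1))) powr (- ?n / (2 * p)) / (1 * (p * Re (1 / z0)) powr (- ?n / (2 * p))) =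
       (Re (1 / z0) / Re (1 / (z0 + z1))) powr (?n / (2 * p))"
    proof -
      have "(p * Re (1 / (z0 + z1))) powr (- ?n / (2 * p)) / (1 * (p * Re (1 / z0)) powr (- ?n / (2 * p))) =
        (p * Re (1 / z0)) powr (?n / (2 * p)) / (p * Re (1 / (z0 + z1))) powr (?n / (2 * p))"
      proof -
        have "inverse P / (1 * inverse Q) = Q / P" for P Q :: real by (simp add: field_simps)
        then show ?thesis by (simp only: minus_divide_left[symmetric] powr_minus)
      qed
      also have "\<dots> = ((p * Re (1 / z0)) / (p * Re (1 / (z0 + z1)))) powr (?n / (2 * p))"
        by (rule powr_divide[symmetric]; intro mult_nonneg_nonneg less_imp_le z0' zz' p)
      also have "(p * Re (1 / z0)) / (p * Re (1 / (z0 + z1))) = Re (1 / z0) / Re (1 / (z0 + z1))"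
        using p by simp
      finally show ?thesis .
    qed
    ultimately show ?thesis by (simp only: times_divide_eq_right[symmetric])
  qed
  then have "ennreal ((norm z0 / norm (z0 + z1)) powr (?n / 2) * (Re (1 / z0) / Re (1 / (z0 + z1))) powr (?n / (2 * p)))
     = Lp_norm p (multiplier_op (\<lambda>\<xi>. gauss z1 (\<xi> - a)) f) / Lp_norm p f"
    unfolding 1 2 using mult_pos_pos[OF p z0']
    by (subst divide_ennreal; simp only: mult_1_left powr_gt_zero norm_ge_zero powr_ge_zero mult_nonneg_nonneg simp_thms)
  also have "\<dots> \<le> Lp_op_norm p (multiplier_op (\<lambda>\<xi>. gauss z1 (\<xi> - a)))"
    unfolding Lp_op_norm_def using fs fn by (intro SUP_upper) auto
  finally show ?thesis .
qed

section \<open>The Bessel operator on Schwartz functions\<close>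

lemma bessel_sym_le: "bessel_sym \<xi> \<le> (1 + 4 * pi\<^sup>2) * (1 + norm \<xi>)\<^sup>2"
  unfolding bessel_sym_def by (simp add: power2_sum algebra_simps)

lemma integrable_bessel_sym_powr_mult:
  fixes \<phi> :: "real^'n \<Rightarrow> complex"
  assumes \<phi>: "schwartz \<phi>"
  shows "integrable lborel (\<lambda>\<xi>. of_real (bessel_sym \<xi> powr u) * \<phi> \<xi>)"
proof -
  obtain N where N: "u \<le> real N" using real_arch_simple by blast
  have [measurable]: "\<phi> \<in> borel_measurable borel" by (rule schwartz_borel[OF \<phi>])
  show ?thesis
  proof (rule Bochner_Integration.integrable_bound)
    show "integrable lborel (\<lambda>\<xi>. (1 + 4 * pi\<^sup>2) ^ N *\<^sub>R ((1 + norm \<xi>) ^ (2 * N) *\<^sub>R \<phi> \<xi>))"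
      by (intro integrable_scaleR_right schwartz_integrable_power \<phi>)
    show "AE \<xi> in lborel. norm (of_real (bessel_sym \<xi> powr u) * \<phi> \<xi>) \<le> norm ((1 + 4 * pi\<^sup>2) ^ N *\<^sub>R ((1 + norm \<xi>) ^ (2 * N) *\<^sub>R \<phi> \<xi>))"
    proof (intro AE_I2)
      fix \<xi> :: "real^'n"
      have "bessel_sym \<xi> powr u \<le> bessel_sym \<xi> powr real N" using N bessel_sym_ge_1 by (intro powr_mono) auto
      also have "\<dots> = bessel_sym \<xi> ^ N" by (simp add: powr_realpow)
      also have "\<dots> \<le> ((1 + 4 * pi\<^sup>2) * (1 + norm \<xi>)\<^sup>2) ^ N"
        by (intro power_mono bessel_sym_le less_imp_le[OF bessel_sym_pos])
      also have "\<dots> = (1 + 4 * pi\<^sup>2) ^ N * (1 + norm \<xi>) ^ (2 * N)"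
        by (simp add: power_mult_distrib power_mult)
      finally have "bessel_sym \<xi> powr u * norm (\<phi> \<xi>) \<le> (1 + 4 * pi\<^sup>2) ^ N * (1 + norm \<xi>) ^ (2 * N) * norm (\<phi> \<xi>)"
        by (rule mult_right_mono) simp
      then show "norm (of_real (bessel_sym \<xi> powr u) * \<phi> \<xi>) \<le> norm ((1 + 4 * pi\<^sup>2) ^ N *\<^sub>R ((1 + norm \<xi>) ^ (2 * N) *\<^sub>R \<phi> \<xi>))"
        by (simp add: norm_mult mult.assoc abs_of_nonneg)
    qed
  qed measurable
qed

lemma integrable_lebesgue_lborel: "integrable lborel f \<Longrightarrow> integrable lebesgue f"
  for f :: "'a::euclidean_space \<Rightarrow> 'b::{banach, second_countable_topology}"
  using integrable_completion[of f lborel] borel_measurable_integrable by blast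

lemma borel_measurable_lebesgue: "f \<in> borel_measurable borel \<Longrightarrow> f \<in> borel_measurable lebesgue"
  for f :: "'a::euclidean_space \<Rightarrow> 'b::topological_space"
  by (rule measurable_completion) simp

lemma tempered_fun_bounded:
  assumes [measurable]: "g \<in> borel_measurable borel" and B: "\<And>x. norm (g x) \<le> B"
  shows "tempered_fun g"
  unfolding tempered_fun_def
proof (intro conjI allI impI)
  show "g \<in> borel_measurable lebesgue" by (rule borel_measurable_lebesgue) fact
  fix \<phi> :: "real^'a \<Rightarrow> complex" assume \<phi>: "schwartz \<phi>"
  have [measurable]: "\<phi> \<in> borel_measurable borel" by (rule schwartz_borel[OF \<phi>])
  have "B \<ge> 0" using B[of 0] norm_ge_zero order_trans by blast
  then have "integrable lborel (\<lambda>x. g x * \<phi> x)"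
    by (intro Bochner_Integration.integrable_bound[OF integrable_mult_right[OF schwartz_integrable[OF \<phi>], of "of_real B"]])
      (auto simp: norm_mult intro!: AE_I2 mult_right_mono B)
  then show "integrable lebesgue (\<lambda>x. g x * \<phi> x)" by (rule integrable_lebesgue_lborel)
qed

text \<open>The infimum is bounded by exhibiting one representative. That it represents the
  distribution follows by moving first the inverse transform and then the transform across the
  pairing; both functions are bounded, which makes them tempered.\<close>

lemma sobolev_norm_le_Lp_norm:
  fixes h :: "real^'n \<Rightarrow> complex"
  assumes h: "schwartz h"
  shows "sobolev_norm r s h \<le> Lp_norm r (inv_fourier (\<lambda>\<xi>. of_real (bessel_sym \<xi> powr (s / 2)) * fourier h \<xi>))"
proof -
  let ?m = "\<lambda>\<xi>::real^'n. complex_of_real (bessel_sym \<xi> powr (s / 2))"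
  let ?G = "\<lambda>\<xi>. ?m \<xi> * fourier h \<xi>"
  let ?g = "inv_fourier ?G"
  have G: "integrable lborel ?G" by (rule integrable_bessel_sym_powr_mult[OF fourier_schwartz[OF h]])
  then have [measurable]: "?G \<in> borel_measurable borel" using borel_measurable_integrable by auto
  have [measurable]: "?g \<in> borel_measurable borel"
    unfolding inv_fourier_eq_fourier[abs_def] using borel_measurable_fourier[OF \<open>?G \<in> borel_measurable borel\<close>] by measurable
  have [measurable]: "h \<in> borel_measurable borel" by (rule schwartz_borel[OF h])
  have "norm (?g x) \<le> (LINT x|lborel. norm (?G x))" for x
    unfolding inv_fourier_eq_fourier by (rule norm_fourier_le) measurable
  then have tg: "tempered_fun ?g" by (intro tempered_fun_bounded) measurable
  obtain B where "\<And>x. norm (h x) \<le> B" using schwartz_bounded[OF h] by blast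
  then have th: "tempered_fun h" by (intro tempered_fun_bounded) measurable
  have "distr_of_fun ?g \<phi> = bessel_op s (distr_of_fun h) \<phi>" if \<phi>: "schwartz \<phi>" for \<phi>
  proof -
    note \<phi>' = inv_fourier_schwartz[OF \<phi>]
    have [measurable]: "\<phi> \<in> borel_measurable borel" by (rule schwartz_borel[OF \<phi>])
    have m: "integrable lborel (\<lambda>\<xi>. ?m \<xi> * inv_fourier \<phi> \<xi>)" by (rule integrable_bessel_sym_powr_mult[OF \<phi>'])
    then have "(\<lambda>\<xi>. ?m \<xi> * inv_fourier \<phi> \<xi>) \<in> borel_measurable borel" using borel_measurable_integrable by auto
    from borel_measurable_fourier[OF this]
    have [measurable]: "fourier (\<lambda>\<xi>. ?m \<xi> * inv_fourier \<phi> \<xi>) \<in> borel_measurable borel" .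
    have "distr_of_fun ?g \<phi> = (LINT x|lborel. ?g x * \<phi> x)"
      unfolding distr_of_fun_def by (rule integral_lebesgue_lborel) measurable
    also have "\<dots> = (LINT \<xi>|lborel. ?G \<xi> * inv_fourier \<phi> \<xi>)"
      by (rule inv_fourier_multiplication_formula[OF G schwartz_integrable[OF \<phi>]])
    also have "\<dots> = (LINT \<xi>|lborel. fourier h \<xi> * (?m \<xi> * inv_fourier \<phi> \<xi>))"
      by (simp add: mult_ac)
    also have "\<dots> = (LINT x|lborel. h x * fourier (\<lambda>\<xi>. ?m \<xi> * inv_fourier \<phi> \<xi>) x)"
      by (rule fourier_multiplication_formula[OF schwartz_integrable[OF h] m])
    also have "\<dots> = (LINT x|lebesgue. h x * fourier (\<lambda>\<xi>. ?m \<xi> * inv_fourier \<phi> \<xi>) x)"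
      by (rule integral_lebesgue_lborel[symmetric]) measurable
    also have "\<dots> = bessel_op s (distr_of_fun h) \<phi>"
      by (simp add: bessel_op_def inv_fourier_distr_def mult_distr_def fourier_distr_def distr_of_fun_def bessel_sym_def)
    finally show ?thesis .
  qed
  then show ?thesis
    unfolding sobolev_norm_def using th tg by (auto intro!: INF_lower)
qed

section \<open>Moment inequality for fractional powers\<close>

lemma powr_add_le:
  fixes a b r :: real
  assumes "a \<ge> 0" "b \<ge> 0" "r \<ge> 0"
  shows "(a + b) powr r \<le> 2 powr r * (a powr r + b powr r)"
proof -
  have "(a + b) powr r \<le> (2 * max a b) powr r"
    using assms by (intro powr_mono2) auto
  also have "\<dots> = 2 powr r * max a b powr r"
    using assms by (simp add: powr_mult)
  also have "max a b powr r \<le> a powr r + b powr r"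
    by (simp add: max_def)
  finally show ?thesis by simp
qed

text \<open>The graph of t powr r lies above its tangent at y, rearranged. Young's inequality is the
  same statement and also covers y = 0.\<close>

lemma powr_tangent_le:
  fixes y f r :: real
  assumes "r > 1" "y \<ge> 0" "f \<ge> 0"
  shows "r * y powr (r - 1) * f \<le> f powr r + (r - 1) * y powr r"
proof -
  have "f * y powr (r - 1) \<le> f powr r / r + (y powr (r - 1)) powr (r / (r - 1)) / (r / (r - 1))"
    using assms by (intro Youngs_inequality) (auto simp: field_simps)
  also have "(y powr (r - 1)) powr (r / (r - 1)) = y powr r"
    using assms by (simp add: powr_powr)
  finally have "r * (f * y powr (r - 1)) \<le> r * (f powr r / r + y powr r / (r / (r - 1)))"
    using assms by (intro mult_left_mono) auto
  also have "\<dots> = f powr r + (r - 1) * y powr r"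
    using assms by (simp add: field_simps)
  finally show ?thesis by (simp add: mult_ac)
qed

lemma jensen_powr:
  fixes f \<rho> :: "'a \<Rightarrow> real"
  assumes [measurable]: "f \<in> borel_measurable M" and \<rho>: "has_bochner_integral M \<rho> T" "\<And>m. \<rho> m \<ge> 0" and "T > 0" "r > 1"
    and f: "\<And>m. f m \<ge> 0" "\<And>m. f m \<le> b"
  shows "integrable M (\<lambda>m. \<rho> m * f m powr r)"
    and "(LINT m|M. \<rho> m * f m) powr r \<le> T powr (r - 1) * (LINT m|M. \<rho> m * f m powr r)"
proof -
  have [measurable]: "\<rho> \<in> borel_measurable M" and \<rho>i: "integrable M \<rho>" and \<rho>T: "integral\<^sup>L M \<rho> = T"
    using \<rho>(1) by (auto simp: has_bochner_integral_iff)
  have i1: "integrable M (\<lambda>m. \<rho> m * f m)"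
    using f \<rho>(2) by (intro Bochner_Integration.integrable_bound[OF integrable_mult_left[OF \<rho>i, of b]])
      (auto intro!: AE_I2 order_trans[OF mult_left_mono abs_ge_self])
  have fb: "f m powr r \<le> b powr r" for m using f \<open>r > 1\<close> by (intro powr_mono2) auto
  show i2: "integrable M (\<lambda>m. \<rho> m * f m powr r)"
  proof (rule Bochner_Integration.integrable_bound[OF integrable_mult_left[OF \<rho>i, of "b powr r"]])
    show "AE m in M. norm (\<rho> m * f m powr r) \<le> norm (\<rho> m * b powr r)"
      using mult_left_mono[OF fb \<rho>(2)] \<rho>(2) by (intro AE_I2) (simp add: abs_mult)
  qed measurable
  \<comment> \<open>The \<rho>-average of f. Integrating the tangent inequality at this point
    against \<rho> is Jensen's inequality.\<close>
  define y where "y = (LINT m|M. \<rho> m * f m) / T"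
  have y: "y \<ge> 0" unfolding y_def using f \<rho>(2) \<open>T > 0\<close> by (intro divide_nonneg_pos integral_nonneg_AE AE_I2) auto
  have I: "(LINT m|M. \<rho> m * f m) = y * T" using \<open>T > 0\<close> by (simp add: y_def)
  have "(LINT m|M. (r * y powr (r - 1)) * (\<rho> m * f m)) \<le> (LINT m|M. \<rho> m * f m powr r + ((r - 1) * y powr r) * \<rho> m)"
  proof (rule integral_mono)
    show "integrable M (\<lambda>m. (r * y powr (r - 1)) * (\<rho> m * f m))" by (intro integrable_mult_right i1)
    show "integrable M (\<lambda>m. \<rho> m * f m powr r + ((r - 1) * y powr r) * \<rho> m)"
      by (intro Bochner_Integration.integrable_add i2 integrable_mult_right \<rho>i)
    fix m
    show "(r * y powr (r - 1)) * (\<rho> m * f m) \<le> \<rho> m * f m powr r + ((r - 1) * y powr r) * \<rho> m"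
      using mult_left_mono[OF powr_tangent_le[OF \<open>r > 1\<close> y f(1)[of m]] \<rho>(2)[of m]] by (simp add: algebra_simps)
  qed
  also have "\<dots> = (LINT m|M. \<rho> m * f m powr r) + ((r - 1) * y powr r) * T"
    using i2 \<rho>i by (simp add: \<rho>T)
  also have "(LINT m|M. (r * y powr (r - 1)) * (\<rho> m * f m)) = r * (y powr (r - 1) * y) * T"
    by (simp add: I)
  also have "y powr (r - 1) * y = y powr r"
    using y by (cases "y = 0") (auto simp: powr_diff)
  finally have "y powr r * T \<le> (LINT m|M. \<rho> m * f m powr r)" by (simp add: algebra_simps)
  then have "T powr (r - 1) * (y powr r * T) \<le> T powr (r - 1) * (LINT m|M. \<rho> m * f m powr r)"
    by (intro mult_left_mono) auto
  also have "T powr (r - 1) * (y powr r * T) = (y * T) powr r"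
    using \<open>T > 0\<close> y by (simp add: powr_mult powr_diff)
  finally show "(LINT m|M. \<rho> m * f m) powr r \<le> T powr (r - 1) * (LINT m|M. \<rho> m * f m powr r)"
    by (simp add: I)
qed

text \<open>Jensen in m for each x, then Tonelli. When all the functions share one L^r bound R, this
  gives the constant of Minkowski's integral inequality. The bound R is asked for only where \<rho>
  is positive, which permits integrands that are bad off the support of the weight; b secures
  integrability in m.\<close>

lemma minkowski_superposition:
  fixes F :: "'a::euclidean_space \<Rightarrow> 'b::euclidean_space \<Rightarrow> complex" and \<rho> :: "'b \<Rightarrow> real"
  assumes [measurable]: "(\<lambda>(x, m). F x m) \<in> borel_measurable (borel \<Otimes>\<^sub>M borel)"
    and \<rho>: "has_bochner_integral lborel \<rho> T" "\<And>m. \<rho> m \<ge> 0" and "T > 0" "r > 1"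
    and b: "\<And>x m. norm (F x m) \<le> b"
    and R: "\<And>m. \<rho> m > 0 \<Longrightarrow> (\<integral>\<^sup>+x. ennreal (norm (F x m) powr r) \<partial>lborel) \<le> ennreal (R powr r)" and "R \<ge> 0"
  shows "(\<integral>\<^sup>+x. ennreal (norm (LINT m|lborel. \<rho> m *\<^sub>R F x m) powr r) \<partial>lborel) \<le> ennreal ((T * R) powr r)"
proof -
  have [measurable]: "\<rho> \<in> borel_measurable borel" using \<rho>(1) by (auto simp: has_bochner_integral_iff)
  have "(\<integral>\<^sup>+x. ennreal (norm (LINT m|lborel. \<rho> m *\<^sub>R F x m) powr r) \<partial>lborel) \<le>
     (\<integral>\<^sup>+x. ennreal (T powr (r - 1)) * (\<integral>\<^sup>+m. ennreal (\<rho> m) * ennreal (norm (F x m) powr r) \<partial>lborel) \<partial>lborel)"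
  proof (rule nn_integral_mono)
    fix x :: 'a
    have "norm (LINT m|lborel. \<rho> m *\<^sub>R F x m) \<le> (LINT m|lborel. norm (\<rho> m *\<^sub>R F x m))"
      by (rule integral_norm_bound)
    also have "\<dots> = (LINT m|lborel. \<rho> m * norm (F x m))" using \<rho>(2) by simp
    finally have "norm (LINT m|lborel. \<rho> m *\<^sub>R F x m) powr r \<le> (LINT m|lborel. \<rho> m * norm (F x m)) powr r"
      using \<open>r > 1\<close> by (intro powr_mono2) auto
    also have "\<dots> \<le> T powr (r - 1) * (LINT m|lborel. \<rho> m * norm (F x m) powr r)"
      by (rule jensen_powr[OF _ \<rho> \<open>T > 0\<close> \<open>r > 1\<close> norm_ge_zero b]) measurable
    finally have "ennreal (norm (LINT m|lborel. \<rho> m *\<^sub>R F x m) powr r) \<le>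
       ennreal (T powr (r - 1)) * ennreal (LINT m|lborel. \<rho> m * norm (F x m) powr r)"
      by (simp add: ennreal_mult'[symmetric] ennreal_leI)
    also have "ennreal (LINT m|lborel. \<rho> m * norm (F x m) powr r) = (\<integral>\<^sup>+m. ennreal (\<rho> m * norm (F x m) powr r) \<partial>lborel)"
    proof (rule nn_integral_eq_integral[symmetric])
      show "integrable lborel (\<lambda>m. \<rho> m * norm (F x m) powr r)"
        by (rule jensen_powr(1)[OF _ \<rho> \<open>T > 0\<close> \<open>r > 1\<close> norm_ge_zero b]) measurable
    qed (use \<rho>(2) in auto)
    finally show "ennreal (norm (LINT m|lborel. \<rho> m *\<^sub>R F x m) powr r) \<le>
       ennreal (T powr (r - 1)) * (\<integral>\<^sup>+m. ennreal (\<rho> m) * ennreal (norm (F x m) powr r) \<partial>lborel)"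
      using \<rho>(2) by (simp add: ennreal_mult')
  qed
  also have "\<dots> = ennreal (T powr (r - 1)) * (\<integral>\<^sup>+x. \<integral>\<^sup>+m. ennreal (\<rho> m) * ennreal (norm (F x m) powr r) \<partial>lborel \<partial>lborel)"
    by (rule nn_integral_cmult) measurable
  also have "(\<integral>\<^sup>+x. \<integral>\<^sup>+m. ennreal (\<rho> m) * ennreal (norm (F x m) powr r) \<partial>lborel \<partial>lborel) =
      (\<integral>\<^sup>+m. \<integral>\<^sup>+x. ennreal (\<rho> m) * ennreal (norm (F x m) powr r) \<partial>lborel \<partial>lborel)"
    by (rule lborel_pair.Fubini'[symmetric]) measurable
  also have "\<dots> \<le> (\<integral>\<^sup>+m. ennreal (\<rho> m) * ennreal (R powr r) \<partial>lborel)"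
  proof (rule nn_integral_mono)
    fix m :: 'b
    have "(\<integral>\<^sup>+x. ennreal (\<rho> m) * ennreal (norm (F x m) powr r) \<partial>lborel) = ennreal (\<rho> m) * (\<integral>\<^sup>+x. ennreal (norm (F x m) powr r) \<partial>lborel)"
      by (rule nn_integral_cmult) measurable
    also have "\<dots> \<le> ennreal (\<rho> m) * ennreal (R powr r)"
    proof (cases "\<rho> m > 0")
      case True then show ?thesis by (intro mult_left_mono R) auto
    next
      case False then have "\<rho> m = 0" using \<rho>(2)[of m] by simp
      then show ?thesis by simp
    qed
    finally show "(\<integral>\<^sup>+x. ennreal (\<rho> m) * ennreal (norm (F x m) powr r) \<partial>lborel) \<le> ennreal (\<rho> m) * ennreal (R powr r)" .
  qed
  also have "\<dots> = (\<integral>\<^sup>+m. ennreal (\<rho> m) \<partial>lborel) * ennreal (R powr r)"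
    by (rule nn_integral_multc) measurable
  also have "(\<integral>\<^sup>+m. ennreal (\<rho> m) \<partial>lborel) = ennreal T"
    using \<rho> by (subst nn_integral_eq_integral) (auto simp: has_bochner_integral_iff)
  also have "ennreal (T powr (r - 1)) * (ennreal T * ennreal (R powr r)) = ennreal ((T * R) powr r)"
    using \<open>T > 0\<close> \<open>R \<ge> 0\<close> by (simp add: ennreal_mult'[symmetric] powr_mult powr_diff)
  finally show ?thesis by (simp add: mult_left_mono)
qed

section \<open>Scalar integrals for the fractional power\<close>

lemma has_bochner_integral_powr_Icc:
  fixes \<alpha> \<delta> :: real
  assumes "\<alpha> < 1" "\<delta> > 0"
  shows "has_bochner_integral lborel (\<lambda>t. indicat_real {0..\<delta>} t * t powr (- \<alpha>)) (\<delta> powr (1 - \<alpha>) / (1 - \<alpha>))"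
proof (rule has_bochner_integral_nn_integral)
  have "((\<lambda>t. t powr (- \<alpha>)) has_integral (\<delta> powr (- \<alpha> + 1) / (- \<alpha> + 1))) {0..\<delta>}"
    using assms by (intro has_integral_powr_from_0) auto
  from nn_integral_has_integral_lebesgue[OF _ this]
  show "(\<integral>\<^sup>+t. ennreal (indicator {0..\<delta>} t * t powr (- \<alpha>)) \<partial>lborel) = ennreal (\<delta> powr (1 - \<alpha>) / (1 - \<alpha>))"
    by simp
qed (use assms in auto)

lemma has_bochner_integral_powr_Ioi:
  fixes \<alpha> \<delta> :: real
  assumes "\<alpha> > 0" "\<delta> > 0"
  shows "has_bochner_integral lborel (\<lambda>t. indicat_real {\<delta><..} t * t powr (- \<alpha> - 1)) (\<delta> powr (- \<alpha>) / \<alpha>)"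
proof (rule has_bochner_integral_nn_integral)
  have "((\<lambda>t. t powr (- \<alpha> - 1)) has_integral - (\<delta> powr (- \<alpha> - 1 + 1)) / (- \<alpha> - 1 + 1)) {\<delta>..}"
    using assms by (intro has_integral_powr_to_inf) auto
  from nn_integral_has_integral_lebesgue[OF _ this]
  have "(\<integral>\<^sup>+t. ennreal (indicator {\<delta>..} t * t powr (- \<alpha> - 1)) \<partial>lborel) = ennreal (\<delta> powr (- \<alpha>) / \<alpha>)"
    by simp
  moreover have "(\<integral>\<^sup>+t. ennreal (indicator {\<delta><..} t * t powr (- \<alpha> - 1)) \<partial>lborel) = (\<integral>\<^sup>+t. ennreal (indicator {\<delta>..} t * t powr (- \<alpha> - 1)) \<partial>lborel)"
  proof (rule nn_integral_cong_AE)
    show "AE t in lborel. ennreal (indicat_real {\<delta><..} t * t powr (- \<alpha> - 1)) = ennreal (indicat_real {\<delta>..} t * t powr (- \<alpha> - 1))"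
      using AE_lborel_singleton[of \<delta>] by eventually_elim (simp add: indicator_def)
  qed
  ultimately show "(\<integral>\<^sup>+t. ennreal (indicator {\<delta><..} t * t powr (- \<alpha> - 1)) \<partial>lborel) = ennreal (\<delta> powr (- \<alpha>) / \<alpha>)"
    by simp
qed (use assms in auto)

text \<open>The substitution of a t for t reduces everything to a = 1. There the integral converges
  because 1 - exp (- t) is at most t near 0 and at most 1 at infinity, which uses \<alpha> < 1 and
  \<alpha> > 0 respectively; it is positive because of the part with t > 1.\<close>

lemma fractional_power_integral:
  fixes \<alpha> :: real
  assumes \<alpha>: "0 < \<alpha>" "\<alpha> < 1"
  obtains c where "c > 0" "\<And>a. a > 0 \<Longrightarrow>
    has_bochner_integral lborel (\<lambda>t. indicat_real {0<..} t * t powr (- \<alpha> - 1) * (1 - exp (- t * a))) (c * a powr \<alpha>)"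
proof -
  define f where "f t = indicat_real {0<..} t * t powr (- \<alpha> - 1) * (1 - exp (- t))" for t :: real
  define c where "c = integral\<^sup>L lborel f"
  let ?I0 = "\<lambda>t. indicat_real {0..1} t * t powr (- \<alpha>)" and ?I1 = "\<lambda>t. indicat_real {1<..} t * t powr (- \<alpha> - 1)"
  have I0: "integrable lborel ?I0" and I1: "has_bochner_integral lborel ?I1 (1 powr (- \<alpha>) / \<alpha>)"
    using has_bochner_integral_powr_Icc[of \<alpha> 1] has_bochner_integral_powr_Ioi[of \<alpha> 1] \<alpha>
    by (auto simp: has_bochner_integral_iff)
  have nonneg: "f t \<ge> 0" for t by (simp add: f_def indicator_def)
  have bd: "f t \<le> ?I0 t + ?I1 t" for t
  proof -
    consider "t \<le> 0" | "0 < t" "t \<le> 1" | "t > 1" by linarith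
    then show ?thesis
    proof cases
      case 2
      have "1 - exp (- t) \<le> t" using exp_ge_add_one_self[of "- t"] by simp
      then have "t powr (- \<alpha> - 1) * (1 - exp (- t)) \<le> t powr (- \<alpha> - 1) * t" by (intro mult_left_mono) auto
      also have "\<dots> = t powr (- \<alpha>)" using 2 by (simp add: powr_diff)
      finally show ?thesis using 2 by (simp add: f_def)
    next
      case 3
      then have "t powr (- \<alpha> - 1) * (1 - exp (- t)) \<le> t powr (- \<alpha> - 1) * 1" by (intro mult_left_mono) auto
      then show ?thesis using 3 by (simp add: f_def)
    qed (auto simp: f_def)
  qed
  have fi: "integrable lborel f"
  proof (rule Bochner_Integration.integrable_bound)
    show "integrable lborel (\<lambda>t. ?I0 t + ?I1 t)" using I0 I1 by (auto simp: has_bochner_integral_iff)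
    show "f \<in> borel_measurable lborel" unfolding f_def[abs_def] by measurable
    show "AE t in lborel. norm (f t) \<le> norm (?I0 t + ?I1 t)"
      using bd nonneg by (intro AE_I2) (auto intro: order_trans[OF _ abs_ge_self])
  qed
  have "c > 0"
  proof -
    have "0 < (1 - exp (- 1)) * (1 powr (- \<alpha>) / \<alpha>)" using \<alpha> by simp
    also have "\<dots> = (LINT t|lborel. (1 - exp (- 1)) * ?I1 t)"
      using has_bochner_integral_integral_eq[OF I1] by simp
    also have "\<dots> \<le> c"
      unfolding c_def
    proof (rule integral_mono'[OF fi])
      fix t :: real
      show "(1 - exp (- 1)) * ?I1 t \<le> f t" by (auto simp: f_def indicator_def mult_ac intro!: mult_right_mono)
    qed (rule nonneg)
    finally show ?thesis .
  qed
  moreover have "has_bochner_integral lborel (\<lambda>t. indicat_real {0<..} t * t powr (- \<alpha> - 1) * (1 - exp (- t * a))) (c * a powr \<alpha>)" if a: "a > 0" for a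
  proof -
    have "has_bochner_integral lborel f c" using fi by (simp add: c_def has_bochner_integral_iff)
    then have "has_bochner_integral lborel (\<lambda>t. f (0 + a * t)) (c /\<^sub>R \<bar>a\<bar>)"
      using a by (subst lborel_has_bochner_integral_real_affine_iff[symmetric]) auto
    then have "has_bochner_integral lborel (\<lambda>t. a powr (\<alpha> + 1) * f (0 + a * t)) (a powr (\<alpha> + 1) * (c /\<^sub>R \<bar>a\<bar>))"
      by (rule has_bochner_integral_mult_right)
    moreover have "a powr (\<alpha> + 1) * f (0 + a * t) = indicator {0<..} t * t powr (- \<alpha> - 1) * (1 - exp (- t * a))" for t
    proof (cases "t > 0")
      case True
      have "a powr (\<alpha> + 1) * (a * t) powr (- \<alpha> - 1) = t powr (- \<alpha> - 1)"
        using a True by (simp add: powr_mult powr_add[symmetric] mult.assoc[symmetric])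
      then show ?thesis using a True by (simp add: f_def mult_ac)
    next
      case False
      then show ?thesis using a by (simp add: f_def zero_less_mult_iff)
    qed
    moreover have "a powr (\<alpha> + 1) * (c /\<^sub>R \<bar>a\<bar>) = c * a powr \<alpha>"
      using a by (simp add: powr_add field_simps)
    ultimately show ?thesis by (simp only:)
  qed
  ultimately show ?thesis using that by blast
qed

section \<open>The heat semigroup of I - \<Delta> and Balakrishnan's integral\<close>

lemma inv_fourier_eq:
  assumes [measurable]: "f \<in> borel_measurable borel"
  shows "inv_fourier f x = (LINT \<xi>|lborel. f \<xi> * cis (2 * pi * (x \<bullet> \<xi>)))"
  unfolding inv_fourier_def by (rule integral_lebesgue_lborel) measurable

text \<open>The semigroup exp (- t A) for A = I - \<Delta>: the usual heat flow times the factor exp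
  (- t).\<close>

definition heat :: "real \<Rightarrow> (real^'n \<Rightarrow> complex) \<Rightarrow> real^'n \<Rightarrow> complex" where
  "heat t f = inv_fourier (\<lambda>\<xi>. of_real (exp (- t * bessel_sym \<xi>)) * fourier f \<xi>)"

lemma heat_eq:
  assumes "schwartz f"
  shows "heat t f x = (LINT \<xi>|lborel. of_real (exp (- t * bessel_sym \<xi>)) * fourier f \<xi> * cis (2 * pi * (x \<bullet> \<xi>)))"
proof -
  have [measurable]: "fourier f \<in> borel_measurable borel" by (rule schwartz_borel[OF fourier_schwartz[OF assms]])
  show ?thesis unfolding heat_def by (rule inv_fourier_eq) measurable
qed

lemma measurable_heat:
  fixes f :: "real^'n \<Rightarrow> complex"
  assumes "schwartz f"
  shows "(\<lambda>(x, t). heat t f x) \<in> borel_measurable (borel \<Otimes>\<^sub>M borel)"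
proof -
  have [measurable]: "fourier f \<in> borel_measurable borel" by (rule schwartz_borel[OF fourier_schwartz[OF assms]])
  show ?thesis unfolding heat_eq[OF assms] by measurable
qed

lemma heat_0: "schwartz f \<Longrightarrow> heat 0 f x = f x"
  by (simp add: heat_def fourier_inversion)

lemma heat_eq_kernel:
  fixes f :: "real^'n \<Rightarrow> complex"
  assumes f: "schwartz f" and t: "t > 0"
  shows "heat t f x = of_real (exp (- t)) * (LINT y|lborel. f (x + y) * of_real (heat_kernel (4 * pi * t) y))"
proof -
  have "- t * bessel_sym \<xi> = - t + - (pi * (4 * pi * t)) * (norm \<xi>)\<^sup>2" for \<xi> :: "real^'n"
    by (simp add: bessel_sym_def algebra_simps power2_eq_square)
  then have e: "exp (- t * bessel_sym \<xi>) = exp (- t) * exp (- (pi * (4 * pi * t)) * (norm \<xi>)\<^sup>2)" for \<xi> :: "real^'n"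
    by (simp only: exp_add)
  have "heat t f x = inv_fourier (\<lambda>\<xi>. of_real (exp (- t)) * (gauss (of_real (4 * pi * t)) \<xi> * fourier f \<xi>)) x"
    unfolding heat_def gauss_of_real unfolding e of_real_mult mult.assoc ..
  also have "\<dots> = of_real (exp (- t)) * inv_fourier (\<lambda>\<xi>. gauss (of_real (4 * pi * t)) \<xi> * fourier f \<xi>) x"
    unfolding inv_fourier_eq_fourier by (rule fourier_cmult)
  also have "inv_fourier (\<lambda>\<xi>. gauss (of_real (4 * pi * t)) \<xi> * fourier f \<xi>) x = (LINT y|lborel. f (x + y) * of_real (heat_kernel (4 * pi * t) y))"
    using t by (intro inv_fourier_gauss_mult_fourier schwartz_integrable f) simp
  finally show ?thesis .
qed

text \<open>For t > 0 the function is exp (- t) times an average of translates of f with a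
  probability weight. Translates have the same norm as f, and the factor exp (- t) is at most
  1.\<close>

lemma heat_contraction:
  fixes f :: "real^'n \<Rightarrow> complex"
  assumes f: "schwartz f" and "t \<ge> 0" "r > 1" "R \<ge> 0"
    and R: "(\<integral>\<^sup>+x. ennreal (norm (f x) powr r) \<partial>lborel) \<le> ennreal (R powr r)"
  shows "(\<integral>\<^sup>+x. ennreal (norm (heat t f x) powr r) \<partial>lborel) \<le> ennreal (R powr r)"
proof (cases "t = 0")
  case True then show ?thesis using R by (simp add: heat_0 f)
next
  case False
  then have t: "t > 0" using \<open>t \<ge> 0\<close> by simp
  have [measurable]: "f \<in> borel_measurable borel" by (rule schwartz_borel[OF f])
  obtain b where b: "\<And>x. norm (f x) \<le> b" using schwartz_bounded[OF f] by blast
  let ?k = "heat_kernel (4 * pi * t) :: real^'n \<Rightarrow> real"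
  have "(\<integral>\<^sup>+x. ennreal (norm (heat t f x) powr r) \<partial>lborel) \<le> (\<integral>\<^sup>+x. ennreal (norm (LINT y|lborel. ?k y *\<^sub>R f (x + y)) powr r) \<partial>lborel)"
  proof (intro nn_integral_mono ennreal_leI powr_mono2)
    fix x :: "real^'n"
    have "norm (heat t f x) = exp (- t) * norm (LINT y|lborel. ?k y *\<^sub>R f (x + y))"
      by (simp add: heat_eq_kernel[OF f t] norm_mult scaleR_conv_of_real mult.commute)
    then show "norm (heat t f x) \<le> norm (LINT y|lborel. ?k y *\<^sub>R f (x + y))"
      using t by (simp add: mult_left_le_one_le)
  qed (use \<open>r > 1\<close> in auto)
  also have "\<dots> \<le> ennreal ((1 * R) powr r)"
  proof (rule minkowski_superposition)
    show "has_bochner_integral lborel ?k 1" using t by (intro has_bochner_integral_heat_kernel) simp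
    show "(\<integral>\<^sup>+x. ennreal (norm (f (x + y)) powr r) \<partial>lborel) \<le> ennreal (R powr r)" for y
      using R nn_integral_lborel_translate[of "\<lambda>x. ennreal (norm (f x) powr r)" y] by simp
    show "(\<lambda>(x, y). f (x + y)) \<in> borel_measurable (borel \<Otimes>\<^sub>M borel)" by measurable
  qed (use assms b in auto)
  finally show ?thesis by simp
qed

lemma one_minus_exp_bounds:
  fixes t a :: real
  assumes "t \<ge> 0" "a \<ge> 0"
  shows "0 \<le> 1 - exp (- t * a)" "1 - exp (- t * a) \<le> 1" "1 - exp (- t * a) \<le> t * a"
  using assms exp_ge_add_one_self[of "- t * a"] by auto

lemma heat_diff_eq:
  fixes u :: "real^'n \<Rightarrow> complex"
  assumes u: "schwartz u" and t: "t \<ge> 0"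
  shows "u x - heat t u x = (LINT \<xi>|lborel. (1 - exp (- t * bessel_sym \<xi>)) *\<^sub>R (fourier u \<xi> * cis (2 * pi * (x \<bullet> \<xi>))))"
proof -
  let ?e = "\<lambda>\<xi>. fourier u \<xi> * cis (2 * pi * (x \<bullet> \<xi>))"
  note U = fourier_schwartz[OF u]
  have [measurable]: "fourier u \<in> borel_measurable borel" by (rule schwartz_borel[OF U])
  have i: "integrable lborel ?e" by (intro integrable_mult_cis schwartz_integrable U) measurable
  have i': "integrable lborel (\<lambda>\<xi>. exp (- t * bessel_sym \<xi>) *\<^sub>R ?e \<xi>)"
  proof (rule Bochner_Integration.integrable_bound[OF i])
    show "AE \<xi> in lborel. norm (exp (- t * bessel_sym \<xi>) *\<^sub>R ?e \<xi>) \<le> norm (?e \<xi>)"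
      using t by (intro AE_I2) (simp add: mult_left_le_one_le less_imp_le norm_mult)
  qed measurable
  have "u x - heat t u x = (LINT \<xi>|lborel. ?e \<xi>) - (LINT \<xi>|lborel. exp (- t * bessel_sym \<xi>) *\<^sub>R ?e \<xi>)"
    unfolding heat_eq[OF u] by (subst fourier_inversion[OF u, symmetric], subst inv_fourier_eq)
      (simp_all add: scaleR_conv_of_real mult.assoc)
  also have "\<dots> = (LINT \<xi>|lborel. ?e \<xi> - exp (- t * bessel_sym \<xi>) *\<^sub>R ?e \<xi>)"
    by (rule Bochner_Integration.integral_diff[OF i i', symmetric])
  also have "\<dots> = (LINT \<xi>|lborel. (1 - exp (- t * bessel_sym \<xi>)) *\<^sub>R ?e \<xi>)"
    by (simp only: scaleR_left_diff_distrib scaleR_one)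
  finally show ?thesis .
qed

text \<open>The integral of A exp (- \<tau> A) over 0 \<le> \<tau> \<le> t is 1 - exp (- t A). This
  is elementary calculus for the number A = \<open>bessel_sym \<xi>\<close>, and Fubini over the
  frequencies carries it to the operator.\<close>

lemma heat_diff_eq_integral:
  fixes u :: "real^'n \<Rightarrow> complex"
  assumes u: "schwartz u" and t: "t \<ge> 0"
  shows "u x - heat t u x = (LINT \<tau>|lborel. indicat_real {0..t} \<tau> *\<^sub>R heat \<tau> (helmholtz u) x)"
proof -
  let ?e = "\<lambda>\<xi>. fourier u \<xi> * cis (2 * pi * (x \<bullet> \<xi>))"
  let ?w = "\<lambda>\<xi>::real^'n. \<lambda>\<tau>. indicat_real {0..t} \<tau> * (bessel_sym \<xi> * exp (- \<tau> * bessel_sym \<xi>))"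
  let ?k = "\<lambda>\<xi> \<tau>. ?w \<xi> \<tau> *\<^sub>R ?e \<xi>"
  note U = fourier_schwartz[OF u]
  have [measurable]: "fourier u \<in> borel_measurable borel" by (rule schwartz_borel[OF U])
  have i: "integrable lborel ?e" by (intro integrable_mult_cis schwartz_integrable U) measurable
  have w: "has_bochner_integral lborel (?w \<xi>) (1 - exp (- t * bessel_sym \<xi>))" for \<xi> :: "real^'n"
  proof -
    have "has_bochner_integral lborel (\<lambda>\<tau>. indicat_real {0..t} \<tau> *\<^sub>R (bessel_sym \<xi> * exp (- \<tau> * bessel_sym \<xi>))) (- exp (- t * bessel_sym \<xi>) - (- exp (- 0 * bessel_sym \<xi>)))"
    proof (rule has_bochner_integral_FTC_Icc)
      show "((\<lambda>\<tau>. - exp (- \<tau> * bessel_sym \<xi>)) has_vector_derivative bessel_sym \<xi> * exp (- \<tau> * bessel_sym \<xi>)) (at \<tau> within {0..t})" for \<tau>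
        by (auto intro!: derivative_eq_intros simp flip: has_real_derivative_iff_has_vector_derivative)
      show "continuous_on {0..t} (\<lambda>\<tau>. bessel_sym \<xi> * exp (- \<tau> * bessel_sym \<xi>))" by (intro continuous_intros)
    qed (rule t)
    then show ?thesis by simp
  qed
  have w0: "?w \<xi> \<tau> \<ge> 0" for \<xi> :: "real^'n" and \<tau> by (simp add: less_imp_le)
  have int: "integrable (lborel \<Otimes>\<^sub>M lborel) (\<lambda>(\<xi>, \<tau>). ?k \<xi> \<tau>)"
  proof (rule lborel_pair.Fubini_integrable)
    show "(\<lambda>(\<xi>, \<tau>). ?k \<xi> \<tau>) \<in> borel_measurable (lborel \<Otimes>\<^sub>M lborel)" by measurable
    have "(LINT \<tau>|lborel. norm (case (\<xi>, \<tau>) of (\<xi>, \<tau>) \<Rightarrow> ?k \<xi> \<tau>)) = (1 - exp (- t * bessel_sym \<xi>)) * norm (?e \<xi>)" for \<xi>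
      using has_bochner_integral_integral_eq[OF w[of \<xi>]] w0 by simp
    moreover have "integrable lborel (\<lambda>\<xi>. (1 - exp (- t * bessel_sym \<xi>)) * norm (?e \<xi>))"
    proof (rule Bochner_Integration.integrable_bound[OF i])
      show "AE \<xi> in lborel. norm ((1 - exp (- t * bessel_sym \<xi>)) * norm (?e \<xi>)) \<le> norm (?e \<xi>)"
        using t one_minus_exp_bounds[of t "bessel_sym \<xi>" for \<xi> :: "real^'n"]
        by (intro AE_I2) (simp only: abs_mult real_norm_def abs_norm_cancel abs_of_nonneg less_imp_le[OF bessel_sym_pos] mult_left_le_one_le norm_ge_zero)
    qed measurable
    ultimately show "integrable lborel (\<lambda>\<xi>. LINT \<tau>|lborel. norm (case (\<xi>, \<tau>) of (\<xi>, \<tau>) \<Rightarrow> ?k \<xi> \<tau>))"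
      by (simp only:)
    show "AE \<xi> in lborel. integrable lborel (\<lambda>\<tau>. case (\<xi>, \<tau>) of (\<xi>, \<tau>) \<Rightarrow> ?k \<xi> \<tau>)"
      unfolding prod.case by (intro AE_I2 integrable_scaleR_left) (use w in \<open>simp only: has_bochner_integral_iff\<close>)
  qed
  have "u x - heat t u x = (LINT \<xi>|lborel. (1 - exp (- t * bessel_sym \<xi>)) *\<^sub>R ?e \<xi>)"
    by (rule heat_diff_eq[OF u t])
  also have "\<dots> = (LINT \<xi>|lborel. LINT \<tau>|lborel. ?k \<xi> \<tau>)"
    using w by (simp only: integral_scaleR_left has_bochner_integral_iff)
  also have "\<dots> = (LINT \<tau>|lborel. LINT \<xi>|lborel. ?k \<xi> \<tau>)"
    using lborel_pair.Fubini_integral[OF int] by simp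
  also have "\<dots> = (LINT \<tau>|lborel. indicat_real {0..t} \<tau> *\<^sub>R heat \<tau> (helmholtz u) x)"
    by (simp add: heat_eq[OF schwartz_helmholtz[OF u]] fourier_helmholtz[OF u] scaleR_conv_of_real mult_ac
        flip: integral_mult_right_zero)
  finally show ?thesis .
qed

lemma heat_diff_Lp_small:
  fixes u :: "real^'n \<Rightarrow> complex"
  assumes u: "schwartz u" and t: "t > 0" and "r > 1" "R \<ge> 0"
    and R: "(\<integral>\<^sup>+x. ennreal (norm (helmholtz u x) powr r) \<partial>lborel) \<le> ennreal (R powr r)"
  shows "(\<integral>\<^sup>+x. ennreal (norm (u x - heat t u x) powr r) \<partial>lborel) \<le> ennreal ((t * R) powr r)"
proof -
  note v = schwartz_helmholtz[OF u]
  have bd: "norm (heat \<tau> (helmholtz u) x) \<le> (LINT \<xi>|lborel. norm (fourier (helmholtz u) \<xi>))" if "\<tau> \<ge> 0" for \<tau> x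
    unfolding heat_eq[OF v]
    by (rule order_trans[OF integral_norm_bound], rule integral_mono')
      (use that in \<open>auto simp: norm_mult mult_left_le_one_le less_imp_le intro!: integrable_norm schwartz_integrable fourier_schwartz v\<close>)
  note [measurable] = measurable_heat[OF v]
  \<comment> \<open>The second indicator does not change the integrand. It cuts off negative times,
    where exp (- \<tau> A) is unbounded, since the superposition inequality wants a bound for every
    \<tau>.\<close>
  have "(\<integral>\<^sup>+x. ennreal (norm (LINT \<tau>|lborel. indicat_real {0..t} \<tau> *\<^sub>R (indicat_real {0..} \<tau> *\<^sub>R heat \<tau> (helmholtz u) x)) powr r) \<partial>lborel) \<le> ennreal ((t * R) powr r)"
  proof (rule minkowski_superposition)
    have "integrable lborel (indicat_real {0..t})" using t by (intro integrable_real_indicator) auto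
    then show "has_bochner_integral lborel (indicat_real {0..t}) t"
      using t by (simp add: has_bochner_integral_iff)
    show "(\<lambda>(x, \<tau>). indicat_real {0..} \<tau> *\<^sub>R heat \<tau> (helmholtz u) x) \<in> borel_measurable (borel \<Otimes>\<^sub>M borel)"
    proof -
      have "(\<lambda>z. indicat_real {0..} (snd z) *\<^sub>R (case z of (x, \<tau>) \<Rightarrow> heat \<tau> (helmholtz u) x)) \<in> borel_measurable (borel \<Otimes>\<^sub>M borel)"
        by measurable
      then show ?thesis by (simp add: case_prod_unfold)
    qed
    show "norm (indicat_real {0..} \<tau> *\<^sub>R heat \<tau> (helmholtz u) x) \<le> (LINT \<xi>|lborel. norm (fourier (helmholtz u) \<xi>))" for x \<tau>
      using bd[of \<tau> x] by (auto simp: indicator_def intro!: integral_nonneg_AE AE_I2)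
    show "(\<integral>\<^sup>+x. ennreal (norm (indicat_real {0..} \<tau> *\<^sub>R heat \<tau> (helmholtz u) x) powr r) \<partial>lborel) \<le> ennreal (R powr r)"
      if "indicat_real {0..t} \<tau> > 0" for \<tau>
      using that heat_contraction[OF v _ \<open>r > 1\<close> \<open>R \<ge> 0\<close> R, of \<tau>] by (auto simp: indicator_def split: if_splits)
  qed (use assms in auto)
  moreover have "indicat_real {0..t} \<tau> *\<^sub>R (indicat_real {0..} \<tau> *\<^sub>R heat \<tau> (helmholtz u) x) = indicat_real {0..t} \<tau> *\<^sub>R heat \<tau> (helmholtz u) x" for \<tau> x
    by (simp add: indicator_def)
  ultimately show ?thesis using t by (simp only: heat_diff_eq_integral[OF u less_imp_le[OF t]])
qed

text \<open>The triangle inequality together with contraction. The constant 4 instead of 2 comes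
  from working with r-th powers: 2 powr r from splitting the sum, and the two equal terms, bounded
  by a further 2 powr r.\<close>

lemma heat_diff_Lp_large:
  fixes u :: "real^'n \<Rightarrow> complex"
  assumes u: "schwartz u" and t: "t \<ge> 0" and "r > 1" "R \<ge> 0"
    and R: "(\<integral>\<^sup>+x. ennreal (norm (u x) powr r) \<partial>lborel) \<le> ennreal (R powr r)"
  shows "(\<integral>\<^sup>+x. ennreal (norm (u x - heat t u x) powr r) \<partial>lborel) \<le> ennreal ((4 * R) powr r)"
proof -
  have [measurable]: "u \<in> borel_measurable borel" by (rule schwartz_borel[OF u])
  have "(\<lambda>x. (\<lambda>(x, t). heat t u x) (x, t)) \<in> borel_measurable borel"
    by (rule measurable_compose[OF _ measurable_heat[OF u]]) measurable
  then have [measurable]: "heat t u \<in> borel_measurable borel" by simp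
  have "(\<integral>\<^sup>+x. ennreal (norm (u x - heat t u x) powr r) \<partial>lborel) \<le>
      (\<integral>\<^sup>+x. ennreal (2 powr r) * (ennreal (norm (u x) powr r) + ennreal (norm (heat t u x) powr r)) \<partial>lborel)"
  proof (rule nn_integral_mono)
    fix x
    have "norm (u x - heat t u x) powr r \<le> (norm (u x) + norm (heat t u x)) powr r"
      using \<open>r > 1\<close> by (intro powr_mono2 norm_triangle_ineq4) auto
    also have "\<dots> \<le> 2 powr r * (norm (u x) powr r + norm (heat t u x) powr r)"
      using \<open>r > 1\<close> by (intro powr_add_le) auto
    finally show "ennreal (norm (u x - heat t u x) powr r) \<le> ennreal (2 powr r) * (ennreal (norm (u x) powr r) + ennreal (norm (heat t u x) powr r))"
      by (simp add: ennreal_mult'[symmetric] ennreal_plus[symmetric] ennreal_leI del: ennreal_plus)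
  qed
  also have "\<dots> = ennreal (2 powr r) * ((\<integral>\<^sup>+x. ennreal (norm (u x) powr r) \<partial>lborel) + (\<integral>\<^sup>+x. ennreal (norm (heat t u x) powr r) \<partial>lborel))"
    by (simp add: nn_integral_cmult nn_integral_add)
  also have "\<dots> \<le> ennreal (2 powr r) * (ennreal (R powr r) + ennreal (R powr r))"
    by (intro mult_left_mono add_mono R heat_contraction[OF u t \<open>r > 1\<close> \<open>R \<ge> 0\<close> R]) auto
  also have "\<dots> = ennreal (2 powr r * (2 * R powr r))"
    by (simp add: ennreal_mult'[symmetric] ennreal_plus[symmetric] del: ennreal_plus)
  also have "\<dots> \<le> ennreal ((4 * R) powr r)"
  proof (intro ennreal_leI)
    have "2 powr 1 \<le> (2::real) powr r" using \<open>r > 1\<close> by (intro powr_mono) auto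
    then have "2 powr r * (2 * R powr r) \<le> 2 powr r * (2 powr r * R powr r)"
      by (intro mult_left_mono mult_right_mono) auto
    also have "\<dots> = (2 * (2 * R)) powr r" using \<open>R \<ge> 0\<close> by (simp only: powr_mult)
    finally show "2 powr r * (2 * R powr r) \<le> (4 * R) powr r" by simp
  qed
  finally show ?thesis .
qed

text \<open>The scalar formula at a = \<open>bessel_sym \<xi>\<close> is inserted into the inversion
  integral and the integrals are exchanged. Fubini applies because the time integral of the moduli
  is c \<open>bessel_sym \<xi> powr \<alpha>\<close> times the modulus of the transform, which is
  integrable for Schwartz u.\<close>

lemma bessel_sym_powr_fourier_eq_integral:
  fixes u :: "real^'n \<Rightarrow> complex"
  assumes u: "schwartz u"
    and c: "\<And>a. a > 0 \<Longrightarrow>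
      has_bochner_integral lborel (\<lambda>t. indicat_real {0<..} t * t powr (- \<alpha> - 1) * (1 - exp (- t * a))) (c * a powr \<alpha>)"
  shows "of_real c * inv_fourier (\<lambda>\<xi>. of_real (bessel_sym \<xi> powr \<alpha>) * fourier u \<xi>) x =
    (LINT t|lborel. (indicat_real {0<..} t * t powr (- \<alpha> - 1)) *\<^sub>R (u x - heat t u x))"
proof -
  let ?e = "\<lambda>\<xi>. fourier u \<xi> * cis (2 * pi * (x \<bullet> \<xi>))"
  let ?w = "\<lambda>\<xi>::real^'n. \<lambda>t. indicat_real {0<..} t * t powr (- \<alpha> - 1) * (1 - exp (- t * bessel_sym \<xi>))"
  let ?k = "\<lambda>\<xi> t. ?w \<xi> t *\<^sub>R ?e \<xi>"
  note U = fourier_schwartz[OF u]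
  have [measurable]: "fourier u \<in> borel_measurable borel" by (rule schwartz_borel[OF U])
  note w = c[OF bessel_sym_pos]
  have wi: "integrable lborel (?w \<xi>)" for \<xi>
    using w[of \<xi>] by (simp only: has_bochner_integral_iff)
  have w0: "?w \<xi> t \<ge> 0" for \<xi> :: "real^'n" and t
    using one_minus_exp_bounds(1)[of t "bessel_sym \<xi>"] by (simp add: indicator_def less_imp_le)
  have i: "integrable lborel (\<lambda>\<xi>. of_real (bessel_sym \<xi> powr \<alpha>) * fourier u \<xi>)"
    by (rule integrable_bessel_sym_powr_mult[OF U])
  have int: "integrable (lborel \<Otimes>\<^sub>M lborel) (\<lambda>(\<xi>, t). ?k \<xi> t)"
  proof (rule lborel_pair.Fubini_integrable)
    show "(\<lambda>(\<xi>, t). ?k \<xi> t) \<in> borel_measurable (lborel \<Otimes>\<^sub>M lborel)" by measurable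
    have "(LINT t|lborel. norm (case (\<xi>, t) of (\<xi>, t) \<Rightarrow> ?k \<xi> t)) = (c * bessel_sym \<xi> powr \<alpha>) * norm (fourier u \<xi>)" for \<xi>
      using has_bochner_integral_integral_eq[OF w[of \<xi>]] w0 by (simp add: norm_mult)
    moreover have "integrable lborel (\<lambda>\<xi>. c * norm (of_real (bessel_sym \<xi> powr \<alpha>) * fourier u \<xi>))"
      by (intro integrable_mult_right integrable_norm i)
    ultimately show "integrable lborel (\<lambda>\<xi>. LINT t|lborel. norm (case (\<xi>, t) of (\<xi>, t) \<Rightarrow> ?k \<xi> t))"
      by (simp only: norm_mult norm_of_real abs_of_nonneg powr_ge_zero mult.assoc)
    show "AE \<xi> in lborel. integrable lborel (\<lambda>t. case (\<xi>, t) of (\<xi>, t) \<Rightarrow> ?k \<xi> t)"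
      unfolding prod.case by (intro AE_I2 integrable_scaleR_left wi)
  qed
  have "of_real c * inv_fourier (\<lambda>\<xi>. of_real (bessel_sym \<xi> powr \<alpha>) * fourier u \<xi>) x =
      of_real c * (LINT \<xi>|lborel. of_real (bessel_sym \<xi> powr \<alpha>) * fourier u \<xi> * cis (2 * pi * (x \<bullet> \<xi>)))"
    by (subst inv_fourier_eq) auto
  also have "\<dots> = (LINT \<xi>|lborel. (c * bessel_sym \<xi> powr \<alpha>) *\<^sub>R ?e \<xi>)"
    by (simp add: scaleR_conv_of_real mult.assoc flip: integral_mult_right_zero)
  also have "\<dots> = (LINT \<xi>|lborel. LINT t|lborel. ?k \<xi> t)"
    by (simp only: integral_scaleR_left[OF wi] has_bochner_integral_integral_eq[OF w])
  also have "\<dots> = (LINT t|lborel. LINT \<xi>|lborel. ?k \<xi> t)"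
    using lborel_pair.Fubini_integral[OF int] by simp
  also have "\<dots> = (LINT t|lborel. (indicat_real {0<..} t * t powr (- \<alpha> - 1)) *\<^sub>R (u x - heat t u x))"
  proof (intro Bochner_Integration.integral_cong refl)
    fix t :: real
    show "(LINT \<xi>|lborel. ?k \<xi> t) = (indicat_real {0<..} t * t powr (- \<alpha> - 1)) *\<^sub>R (u x - heat t u x)"
    proof (cases "t > 0")
      case True
      then show ?thesis
        by (simp only: heat_diff_eq[OF u less_imp_le[OF True]] scaleR_scaleR[symmetric] integral_scaleR_right)
    qed simp
  qed
  finally show ?thesis .
qed

text \<open>Pointwise companions of the L^r estimates, from 1 - exp (- y) being at most 1 and at
  most y. They make the time integrals converge and provide the sup bound that the superposition
  inequality requires.\<close>

lemma heat_diff_bounds: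
  fixes u :: "real^'n \<Rightarrow> complex"
  assumes u: "schwartz u" and t: "t \<ge> 0"
  shows "norm (u x - heat t u x) \<le> (LINT \<xi>|lborel. norm (fourier u \<xi>))"
    and "norm (u x - heat t u x) \<le> t * (LINT \<xi>|lborel. norm (fourier (helmholtz u) \<xi>))"
proof -
  note U = fourier_schwartz[OF u]
  let ?d = "\<lambda>\<xi>::real^'n. 1 - exp (- t * bessel_sym \<xi>)"
  have d: "0 \<le> ?d \<xi>" "?d \<xi> \<le> 1" "?d \<xi> \<le> t * bessel_sym \<xi>" for \<xi> :: "real^'n"
    using one_minus_exp_bounds[OF t, of "bessel_sym \<xi>"] by (simp_all add: less_imp_le)
  have 0: "norm (u x - heat t u x) \<le> (LINT \<xi>|lborel. ?d \<xi> * norm (fourier u \<xi>))"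
    unfolding heat_diff_eq[OF u t] using d(1)
    by (intro order_trans[OF integral_norm_bound]) (simp add: norm_mult)
  also have "\<dots> \<le> (LINT \<xi>|lborel. norm (fourier u \<xi>))"
    using d by (intro integral_mono' integrable_norm schwartz_integrable U)
      (simp_all only: mult_left_le_one_le norm_ge_zero)
  finally show "norm (u x - heat t u x) \<le> (LINT \<xi>|lborel. norm (fourier u \<xi>))" .
  note 0
  also have "(LINT \<xi>|lborel. ?d \<xi> * norm (fourier u \<xi>)) \<le> (LINT \<xi>|lborel. t * norm (fourier (helmholtz u) \<xi>))"
  proof (intro integral_mono' integrable_mult_right integrable_norm schwartz_integrable fourier_schwartz schwartz_helmholtz u)
    fix \<xi> :: "real^'n"
    have "?d \<xi> * norm (fourier u \<xi>) \<le> (t * bessel_sym \<xi>) * norm (fourier u \<xi>)" by (intro mult_right_mono d) simp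
    then show "?d \<xi> * norm (fourier u \<xi>) \<le> t * norm (fourier (helmholtz u) \<xi>)"
      by (simp add: fourier_helmholtz[OF u] norm_mult mult.assoc abs_of_pos)
  qed (use t in simp)
  finally show "norm (u x - heat t u x) \<le> t * (LINT \<xi>|lborel. norm (fourier (helmholtz u) \<xi>))" by simp
qed

text \<open>Balakrishnan's integral for the fractional power is split at time \<open>1 / K\<^sup>2\<close>: before it
  \<open>u - heat t u\<close> is bounded through \<open>helmholtz u\<close>, after it through \<open>u\<close> itself.\<close>

lemma fractional_power_Lp_bound:
  fixes \<alpha> r :: real
  assumes \<alpha>: "0 < \<alpha>" "\<alpha> < 1" and r: "r > 1"
  shows "\<exists>C\<ge>0. \<forall>(u :: real^'n \<Rightarrow> complex) X K. schwartz u \<longrightarrow> X \<ge> 0 \<longrightarrow> K > 0 \<longrightarrow>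
     (\<integral>\<^sup>+x. ennreal (norm (u x) powr r) \<partial>lborel) \<le> ennreal (X powr r) \<longrightarrow>
     (\<integral>\<^sup>+x. ennreal (norm (helmholtz u x) powr r) \<partial>lborel) \<le> ennreal ((X * K\<^sup>2) powr r) \<longrightarrow>
     (\<integral>\<^sup>+x. ennreal (norm (inv_fourier (\<lambda>\<xi>. of_real (bessel_sym \<xi> powr \<alpha>) * fourier u \<xi>) x) powr r) \<partial>lborel)
       \<le> ennreal ((C * X * K powr (2 * \<alpha>)) powr r)"
proof -
  obtain c where c: "c > 0" "\<And>a. a > 0 \<Longrightarrow>
    has_bochner_integral lborel (\<lambda>t. indicat_real {0<..} t * t powr (- \<alpha> - 1) * (1 - exp (- t * a))) (c * a powr \<alpha>)"
    using fractional_power_integral[OF \<alpha>] by blast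
  define C0 where "C0 = 1 / (1 - \<alpha>) + 4 / \<alpha>"
  define C where "C = 4 * C0 / c"
  have C0: "C0 > 0" using \<alpha> by (simp add: C0_def add_pos_pos)
  show ?thesis
  proof (intro exI[of _ C] conjI allI impI)
    show "C \<ge> 0" using C0 c by (simp add: C_def)
    fix u :: "real^'n \<Rightarrow> complex" and X K :: real
    assume u: "schwartz u" and X: "X \<ge> 0" and K: "K > 0"
      and uX: "(\<integral>\<^sup>+x. ennreal (norm (u x) powr r) \<partial>lborel) \<le> ennreal (X powr r)"
      and vX: "(\<integral>\<^sup>+x. ennreal (norm (helmholtz u x) powr r) \<partial>lborel) \<le> ennreal ((X * K\<^sup>2) powr r)"
    \<comment> \<open>Times below \<delta> contribute about \<delta> powr (1 - \<alpha>) X K^2,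
      times above it about \<delta> powr (- \<alpha>) X. At \<delta> = K^(-2) the two balance, and
      both are of order X K powr (2 \<alpha>).\<close>
    define \<delta> where "\<delta> = K powr (- 2)"
    have \<delta>: "\<delta> > 0" using K by (simp add: \<delta>_def)
    define \<rho>1 where "\<rho>1 t = indicat_real {0..\<delta>} t * t powr (- \<alpha>)" for t
    define \<rho>2 where "\<rho>2 t = indicat_real {\<delta><..} t * t powr (- \<alpha> - 1)" for t
    have \<rho>1: "has_bochner_integral lborel \<rho>1 (\<delta> powr (1 - \<alpha>) / (1 - \<alpha>))" "\<And>t. \<rho>1 t \<ge> 0"
      unfolding \<rho>1_def[abs_def] using has_bochner_integral_powr_Icc[OF \<alpha>(2) \<delta>] by auto
    have \<rho>2: "has_bochner_integral lborel \<rho>2 (\<delta> powr (- \<alpha>) / \<alpha>)" "\<And>t. \<rho>2 t \<ge> 0"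
      unfolding \<rho>2_def[abs_def] using has_bochner_integral_powr_Ioi[OF \<alpha>(1) \<delta>] by auto
    \<comment> \<open>For small times one factor 1 / t is moved from the weight to the function: the
      difference quotient is bounded in L^r uniformly in t, and the remaining weight t powr (-
      \<alpha>) is integrable at 0.\<close>
    define Q1 where "Q1 x t = (indicat_real {0<..} t / t) *\<^sub>R (u x - heat t u x)" for x t
    define Q2 where "Q2 x t = indicat_real {0<..} t *\<^sub>R (u x - heat t u x)" for x t
    have [measurable]: "u \<in> borel_measurable borel" by (rule schwartz_borel[OF u])
    have mq: "(\<lambda>z. u (fst z) - (case z of (x, t) \<Rightarrow> heat t u x)) \<in> borel_measurable (borel \<Otimes>\<^sub>M borel)"
    proof (rule borel_measurable_diff[OF _ measurable_heat[OF u]])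
      show "(\<lambda>z. u (fst z)) \<in> borel_measurable (borel \<Otimes>\<^sub>M borel)" by measurable
    qed
    have mQ1: "(\<lambda>(x, t). Q1 x t) \<in> borel_measurable (borel \<Otimes>\<^sub>M borel)"
    proof -
      have "(\<lambda>z. (indicat_real {0<..} (snd z) / snd z) *\<^sub>R (u (fst z) - (case z of (x, t) \<Rightarrow> heat t u x))) \<in> borel_measurable (borel \<Otimes>\<^sub>M borel)"
        by (rule borel_measurable_scaleR[OF _ mq]) measurable
      then show ?thesis by (simp add: Q1_def case_prod_unfold)
    qed
    have mQ2: "(\<lambda>(x, t). Q2 x t) \<in> borel_measurable (borel \<Otimes>\<^sub>M borel)"
    proof -
      have "(\<lambda>z. indicat_real {0<..} (snd z) *\<^sub>R (u (fst z) - (case z of (x, t) \<Rightarrow> heat t u x))) \<in> borel_measurable (borel \<Otimes>\<^sub>M borel)"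
        by (rule borel_measurable_scaleR[OF _ mq]) measurable
      then show ?thesis by (simp add: Q2_def case_prod_unfold)
    qed
    define b1 where "b1 = (LINT \<xi>|lborel. norm (fourier (helmholtz u) \<xi>))"
    define b2 where "b2 = (LINT \<xi>|lborel. norm (fourier u \<xi>))"
    have b0: "b1 \<ge> 0" "b2 \<ge> 0" by (auto simp: b1_def b2_def intro!: integral_nonneg_AE)
    have b1: "norm (Q1 x t) \<le> b1" for x t
    proof (cases "t > 0")
      case True
      have "norm (Q1 x t) = norm (u x - heat t u x) / t"
        unfolding Q1_def norm_scaleR using True by simp
      also have "\<dots> \<le> b1"
        using heat_diff_bounds(2)[OF u, of t x] True by (simp add: b1_def[symmetric] pos_divide_le_eq mult.commute)
      finally show ?thesis .
    qed (use b0 in \<open>simp add: Q1_def\<close>)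
    have b2: "norm (Q2 x t) \<le> b2" for x t
      using heat_diff_bounds(1)[OF u, of t x] b0
      by (cases "t > 0") (auto simp: Q2_def b2_def[symmetric])
    define G1 where "G1 x = (LINT t|lborel. \<rho>1 t *\<^sub>R Q1 x t)" for x
    define G2 where "G2 x = (LINT t|lborel. \<rho>2 t *\<^sub>R Q2 x t)" for x
    let ?g = "inv_fourier (\<lambda>\<xi>. of_real (bessel_sym \<xi> powr \<alpha>) * fourier u \<xi>)"
    have g: "of_real c * ?g x = G1 x + G2 x" for x
    proof -
      have mx: "(\<lambda>t. Q1 x t) \<in> borel_measurable borel" "(\<lambda>t. Q2 x t) \<in> borel_measurable borel"
        using measurable_compose[OF measurable_Pair1' mQ1] measurable_compose[OF measurable_Pair1' mQ2] by auto
      have mr: "\<rho>1 \<in> borel_measurable borel" "\<rho>2 \<in> borel_measurable borel"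
        unfolding \<rho>1_def[abs_def] \<rho>2_def[abs_def] by measurable
      have i1: "integrable lborel (\<lambda>t. \<rho>1 t *\<^sub>R Q1 x t)"
      proof (rule Bochner_Integration.integrable_bound)
        show "integrable lborel (\<lambda>t. \<rho>1 t * b1)" using \<rho>1(1) by (intro integrable_mult_left) (simp add: has_bochner_integral_iff)
        show "AE t in lborel. norm (\<rho>1 t *\<^sub>R Q1 x t) \<le> norm (\<rho>1 t * b1)"
          using b1 \<rho>1(2) b0 by (intro AE_I2) (simp add: abs_mult mult_left_mono)
        show "(\<lambda>t. \<rho>1 t *\<^sub>R Q1 x t) \<in> borel_measurable lborel" using mx mr by measurable
      qed
      have i2: "integrable lborel (\<lambda>t. \<rho>2 t *\<^sub>R Q2 x t)"
      proof (rule Bochner_Integration.integrable_bound)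
        show "integrable lborel (\<lambda>t. \<rho>2 t * b2)" using \<rho>2(1) by (intro integrable_mult_left) (simp add: has_bochner_integral_iff)
        show "AE t in lborel. norm (\<rho>2 t *\<^sub>R Q2 x t) \<le> norm (\<rho>2 t * b2)"
          using b2 \<rho>2(2) b0 by (intro AE_I2) (simp add: abs_mult mult_left_mono)
        show "(\<lambda>t. \<rho>2 t *\<^sub>R Q2 x t) \<in> borel_measurable lborel" using mx mr by measurable
      qed
      have "of_real c * ?g x = (LINT t|lborel. (indicat_real {0<..} t * t powr (- \<alpha> - 1)) *\<^sub>R (u x - heat t u x))"
        by (rule bessel_sym_powr_fourier_eq_integral[OF u c(2)])
      also have "\<dots> = (LINT t|lborel. \<rho>1 t *\<^sub>R Q1 x t + \<rho>2 t *\<^sub>R Q2 x t)"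
      proof (intro Bochner_Integration.integral_cong refl)
        fix t :: real
        have "t powr (- \<alpha> - 1) = t powr (- \<alpha>) / t" if "t > 0" using that by (simp add: powr_diff)
        then show "(indicat_real {0<..} t * t powr (- \<alpha> - 1)) *\<^sub>R (u x - heat t u x) = \<rho>1 t *\<^sub>R Q1 x t + \<rho>2 t *\<^sub>R Q2 x t"
          using \<delta> by (auto simp: \<rho>1_def \<rho>2_def Q1_def Q2_def indicator_def)
      qed
      also have "\<dots> = G1 x + G2 x"
        unfolding G1_def G2_def by (rule Bochner_Integration.integral_add[OF i1 i2])
      finally show ?thesis .
    qed
    have T1: "\<delta> powr (1 - \<alpha>) / (1 - \<alpha>) * (X * K\<^sup>2) = X * K powr (2 * \<alpha>) * (1 / (1 - \<alpha>))"
    proof -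
      have "\<delta> powr (1 - \<alpha>) * K\<^sup>2 = K powr (2 * \<alpha>)"
        using K by (simp add: \<delta>_def powr_powr powr_add[symmetric] flip: powr_numeral)
      then show ?thesis by (simp add: mult_ac)
    qed
    have T2: "\<delta> powr (- \<alpha>) / \<alpha> * (4 * X) = X * K powr (2 * \<alpha>) * (4 / \<alpha>)"
      using K by (simp add: \<delta>_def powr_powr)
    define Y where "Y = X * K powr (2 * \<alpha>) * C0"
    have Y: "Y \<ge> 0" using X C0 by (simp add: Y_def)
    have G1: "(\<integral>\<^sup>+x. ennreal (norm (G1 x) powr r) \<partial>lborel) \<le> ennreal (Y powr r)"
    proof -
      have "(\<integral>\<^sup>+x. ennreal (norm (G1 x) powr r) \<partial>lborel) \<le> ennreal ((\<delta> powr (1 - \<alpha>) / (1 - \<alpha>) * (X * K\<^sup>2)) powr r)"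
        unfolding G1_def
      proof (rule minkowski_superposition[OF mQ1 \<rho>1 _ r b1])
        fix t assume "\<rho>1 t > 0"
        \<comment> \<open>At t = 0 the indicator is 1, and the claim rests on 0 powr x being
          0.\<close>
        moreover have "\<rho>1 t = 0" if "t \<le> 0" using that by (cases "t = 0") (simp_all add: \<rho>1_def)
        ultimately have t: "t > 0" by force
        have "(\<integral>\<^sup>+x. ennreal (norm (Q1 x t) powr r) \<partial>lborel) = (\<integral>\<^sup>+x. ennreal ((1 / t) powr r) * ennreal (norm (u x - heat t u x) powr r) \<partial>lborel)"
          using t by (intro nn_integral_cong) (simp add: Q1_def powr_mult powr_divide ennreal_mult'[symmetric])
        also have "\<dots> = ennreal ((1 / t) powr r) * (\<integral>\<^sup>+x. ennreal (norm (u x - heat t u x) powr r) \<partial>lborel)"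
        proof (rule nn_integral_cmult)
          have "(\<lambda>x. (\<lambda>z. u (fst z) - (case z of (x, t) \<Rightarrow> heat t u x)) (x, t)) \<in> borel_measurable borel"
            by (rule measurable_compose[OF _ mq]) measurable
          then have [measurable]: "(\<lambda>x. u x - heat t u x) \<in> borel_measurable borel" by simp
          show "(\<lambda>x. ennreal (norm (u x - heat t u x) powr r)) \<in> borel_measurable lborel" by measurable
        qed
        also have "\<dots> \<le> ennreal ((1 / t) powr r) * ennreal ((t * (X * K\<^sup>2)) powr r)"
          using X by (intro mult_left_mono heat_diff_Lp_small u t r vX) auto
        also have "\<dots> = ennreal ((X * K\<^sup>2) powr r)"
          using t by (simp add: ennreal_mult'[symmetric] powr_mult powr_divide)
        finally show "(\<integral>\<^sup>+x. ennreal (norm (Q1 x t) powr r) \<partial>lborel) \<le> ennreal ((X * K\<^sup>2) powr r)" .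
      qed (use \<delta> \<alpha> X in auto)
      also have "\<dots> \<le> ennreal (Y powr r)"
        unfolding T1 Y_def C0_def using X \<alpha> r by (intro ennreal_leI powr_mono2 mult_left_mono) auto
      finally show ?thesis .
    qed
    have G2: "(\<integral>\<^sup>+x. ennreal (norm (G2 x) powr r) \<partial>lborel) \<le> ennreal (Y powr r)"
    proof -
      have "(\<integral>\<^sup>+x. ennreal (norm (G2 x) powr r) \<partial>lborel) \<le> ennreal ((\<delta> powr (- \<alpha>) / \<alpha> * (4 * X)) powr r)"
        unfolding G2_def
      proof (rule minkowski_superposition[OF mQ2 \<rho>2 _ r b2])
        fix t assume "\<rho>2 t > 0"
        moreover have "\<rho>2 t = 0" if "t \<le> 0" using that \<delta> by (simp add: \<rho>2_def)
        ultimately have t: "t > 0" by force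
        show "(\<integral>\<^sup>+x. ennreal (norm (Q2 x t) powr r) \<partial>lborel) \<le> ennreal ((4 * X) powr r)"
          using heat_diff_Lp_large[OF u _ r X uX, of t] t by (simp add: Q2_def)
      qed (use \<delta> \<alpha> X in auto)
      also have "\<dots> \<le> ennreal (Y powr r)"
        unfolding T2 Y_def C0_def using X \<alpha> r by (intro ennreal_leI powr_mono2 mult_left_mono) auto
      finally show ?thesis .
    qed
    have [measurable]: "G1 \<in> borel_measurable borel" "G2 \<in> borel_measurable borel"
    proof -
      have [measurable]: "\<rho>1 \<in> borel_measurable borel" "\<rho>2 \<in> borel_measurable borel"
        unfolding \<rho>1_def[abs_def] \<rho>2_def[abs_def] by measurable
      note [measurable] = mQ1 mQ2
      show "G1 \<in> borel_measurable borel" "G2 \<in> borel_measurable borel"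
        unfolding G1_def[abs_def] G2_def[abs_def] by measurable
    qed
    have "(\<integral>\<^sup>+x. ennreal (norm (?g x) powr r) \<partial>lborel) \<le>
       (\<integral>\<^sup>+x. ennreal ((2 / c) powr r) * (ennreal (norm (G1 x) powr r) + ennreal (norm (G2 x) powr r)) \<partial>lborel)"
    proof (rule nn_integral_mono)
      fix x
      have "norm (of_real c * ?g x) = norm (G1 x + G2 x)" by (simp only: g)
      then have "norm (?g x) = norm (G1 x + G2 x) / c" using c by (simp add: norm_mult field_simps)
      also have "\<dots> \<le> (norm (G1 x) + norm (G2 x)) / c" using c by (intro divide_right_mono norm_triangle_ineq) auto
      finally have "norm (?g x) powr r \<le> ((norm (G1 x) + norm (G2 x)) / c) powr r"
        using r by (intro powr_mono2) auto
      also have "\<dots> = (norm (G1 x) + norm (G2 x)) powr r / c powr r" by (rule powr_divide)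
      also have "\<dots> \<le> (2 powr r * (norm (G1 x) powr r + norm (G2 x) powr r)) / c powr r"
        using r by (intro divide_right_mono powr_add_le) auto
      also have "\<dots> = (2 / c) powr r * (norm (G1 x) powr r + norm (G2 x) powr r)"
        by (simp add: powr_divide)
      finally show "ennreal (norm (?g x) powr r) \<le> ennreal ((2 / c) powr r) * (ennreal (norm (G1 x) powr r) + ennreal (norm (G2 x) powr r))"
        by (simp add: ennreal_mult'[symmetric] ennreal_plus[symmetric] ennreal_leI del: ennreal_plus)
    qed
    also have "\<dots> = ennreal ((2 / c) powr r) * ((\<integral>\<^sup>+x. ennreal (norm (G1 x) powr r) \<partial>lborel) + (\<integral>\<^sup>+x. ennreal (norm (G2 x) powr r) \<partial>lborel))"
      by (simp add: nn_integral_cmult nn_integral_add)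
    also have "\<dots> \<le> ennreal ((2 / c) powr r) * (ennreal (Y powr r) + ennreal (Y powr r))"
      by (intro mult_left_mono add_mono G1 G2) auto
    also have "\<dots> = ennreal ((2 / c) powr r * (2 * Y powr r))"
      by (simp add: ennreal_mult'[symmetric] ennreal_plus[symmetric] del: ennreal_plus)
    also have "\<dots> \<le> ennreal ((C * X * K powr (2 * \<alpha>)) powr r)"
    proof (intro ennreal_leI)
      have "2 powr 1 \<le> (2::real) powr r" using r by (intro powr_mono) auto
      then have "(2 / c) powr r * (2 * Y powr r) \<le> (2 / c) powr r * (2 powr r * Y powr r)"
        by (intro mult_left_mono mult_right_mono) auto
      also have "\<dots> = ((2 / c) * (2 * Y)) powr r" by (simp only: powr_mult)
      also have "(2 / c) * (2 * Y) = C * X * K powr (2 * \<alpha>)" by (simp add: C_def Y_def)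
      finally show "(2 / c) powr r * (2 * Y powr r) \<le> (C * X * K powr (2 * \<alpha>)) powr r" .
    qed
    finally show "(\<integral>\<^sup>+x. ennreal (norm (?g x) powr r) \<partial>lborel) \<le> ennreal ((C * X * K powr (2 * \<alpha>)) powr r)" .
  qed
qed

text \<open>With s / 2 = l + \<alpha>, the fractional estimate is applied to the l-th power of A on
  h, with X K^(2l) in the role of X; then K^(2l) K powr (2 \<alpha>) = K powr s. The integer l
  depends on s only.\<close>

lemma sobolev_norm_bound:
  fixes r s :: real
  assumes r: "r > 1" and s: "s > 0"
  obtains l :: nat and C :: real where "C \<ge> 0"
    "\<And>(h :: real^'n \<Rightarrow> complex) X K. schwartz h \<Longrightarrow> X \<ge> 0 \<Longrightarrow> K > 0 \<Longrightarrow>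
     (\<And>j. j \<in> {l, Suc l} \<Longrightarrow> (\<integral>\<^sup>+x. ennreal (norm ((helmholtz ^^ j) h x) powr r) \<partial>lborel) \<le> ennreal ((X * K ^ (2 * j)) powr r)) \<Longrightarrow>
     sobolev_norm r s h \<le> ennreal (C * X * K powr s)"
proof -
  define l where "l = nat \<lfloor>s / 2\<rfloor>"
  define \<alpha> where "\<alpha> = s / 2 - real l"
  have l: "real l = of_int \<lfloor>s / 2\<rfloor>" using s by (simp add: l_def)
  have \<alpha>: "0 \<le> \<alpha>" "\<alpha> < 1" unfolding \<alpha>_def l by linarith+
  have s\<alpha>: "s / 2 = \<alpha> + real l" by (simp add: \<alpha>_def)
  obtain C where C: "C \<ge> 0"
    "\<And>(u :: real^'n \<Rightarrow> complex) X K. schwartz u \<Longrightarrow> X \<ge> 0 \<Longrightarrow> K > 0 \<Longrightarrow>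
     (\<integral>\<^sup>+x. ennreal (norm (u x) powr r) \<partial>lborel) \<le> ennreal (X powr r) \<Longrightarrow>
     (\<integral>\<^sup>+x. ennreal (norm (helmholtz u x) powr r) \<partial>lborel) \<le> ennreal ((X * K\<^sup>2) powr r) \<Longrightarrow>
     (\<integral>\<^sup>+x. ennreal (norm (inv_fourier (\<lambda>\<xi>. of_real (bessel_sym \<xi> powr \<alpha>) * fourier u \<xi>) x) powr r) \<partial>lborel)
       \<le> ennreal ((C * X * K powr (2 * \<alpha>)) powr r)"
  proof (cases "\<alpha> = 0")
    \<comment> \<open>When s / 2 is an integer, no fractional power is left and Balakrishnan's
      integral, which diverges at \<alpha> = 0, has to be avoided.\<close>
    case True
    have "inv_fourier (\<lambda>\<xi>. of_real (bessel_sym \<xi> powr \<alpha>) * fourier u \<xi>) = u" if "schwartz u" for u :: "real^'n \<Rightarrow> complex"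
      using fourier_inversion[OF that] True by (simp add: less_imp_neq[OF bessel_sym_pos, symmetric] fun_eq_iff)
    then show ?thesis using True by (intro that[of 1]) auto
  next
    case False
    then have "\<alpha> > 0" using \<alpha> by simp
    from fractional_power_Lp_bound[OF this \<alpha>(2) r] show ?thesis
      by (elim exE conjE) (rule that, assumption, blast)
  qed
  show ?thesis
  proof (rule that[OF C(1), of l])
    fix h :: "real^'n \<Rightarrow> complex" and X K :: real
    assume h: "schwartz h" and X: "X \<ge> 0" and K: "K > 0"
      and bd: "\<And>j. j \<in> {l, Suc l} \<Longrightarrow> (\<integral>\<^sup>+x. ennreal (norm ((helmholtz ^^ j) h x) powr r) \<partial>lborel) \<le> ennreal ((X * K ^ (2 * j)) powr r)"
    let ?u = "(helmholtz ^^ l) h"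
    have u: "schwartz ?u" by (rule schwartz_helmholtz_power[OF h])
    have eq: "(\<lambda>\<xi>. of_real (bessel_sym \<xi> powr (s / 2)) * fourier h \<xi>) = (\<lambda>\<xi>. of_real (bessel_sym \<xi> powr \<alpha>) * fourier ?u \<xi>)"
      by (simp add: fourier_helmholtz_power[OF h] s\<alpha> powr_add powr_realpow mult.assoc)
    have "(\<integral>\<^sup>+x. ennreal (norm (inv_fourier (\<lambda>\<xi>. of_real (bessel_sym \<xi> powr (s / 2)) * fourier h \<xi>) x) powr r) \<partial>lborel)
        \<le> ennreal ((C * (X * K ^ (2 * l)) * K powr (2 * \<alpha>)) powr r)"
      unfolding eq using X K bd[of l] bd[of "Suc l"]
      by (intro C(2) u) (auto simp: power_add power2_eq_square mult_ac)
    then have "Lp_norm r (inv_fourier (\<lambda>\<xi>. of_real (bessel_sym \<xi> powr (s / 2)) * fourier h \<xi>)) \<le> ennreal (C * (X * K ^ (2 * l)) * K powr (2 * \<alpha>))"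
      using C X K r by (intro Lp_norm_le) auto
    also have "C * (X * K ^ (2 * l)) * K powr (2 * \<alpha>) = C * X * K powr s"
    proof -
      have "K ^ (2 * l) * K powr (2 * \<alpha>) = K powr (real (2 * l) + 2 * \<alpha>)"
        using K by (simp only: powr_add powr_realpow)
      also have "real (2 * l) + 2 * \<alpha> = s" by (simp add: \<alpha>_def)
      finally show ?thesis by (simp add: mult.assoc)
    qed
    finally show "sobolev_norm r s h \<le> ennreal (C * X * K powr s)"
      using sobolev_norm_le_Lp_norm[OF h] order_trans by blast
  qed
qed

section \<open>Sobolev norms of localised Gaussians\<close>

lemma schwartz_iter_partial: "schwartz f \<Longrightarrow> schwartz (iter_partial is f)"
  by (induction "is") (auto simp: schwartz_partial_deriv)

lemma iter_partial_add:
  assumes "schwartz f" "schwartz g"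
  shows "iter_partial is (\<lambda>x. f x + g x) = (\<lambda>x. iter_partial is f x + iter_partial is g x)"
  by (induction "is")
    (simp_all add: partial_deriv_add schwartz_differentiable schwartz_iter_partial assms fun_eq_iff[of "partial_deriv _ _"])

lemma iter_partial_cmult:
  assumes "schwartz f"
  shows "iter_partial is (\<lambda>x. c * f x) = (\<lambda>x. c * iter_partial is f x)"
  by (induction "is")
    (simp_all add: partial_deriv_mult partial_deriv_const schwartz_differentiable schwartz_iter_partial assms fun_eq_iff[of "partial_deriv _ _"])

lemma iter_partial_zero: "iter_partial is (\<lambda>x. 0) = (\<lambda>x. 0)"
  using iter_partial_cmult[OF schwartz_zero, of "is" 0] by simp

lemma iter_partial_sum:
  assumes "\<And>i. i \<in> I \<Longrightarrow> schwartz (f i)"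
  shows "iter_partial is (\<lambda>x. \<Sum>i\<in>I. f i x) = (\<lambda>x. \<Sum>i\<in>I. iter_partial is (f i) x)"
  using assms
  by (induction I rule: infinite_finite_induct) (simp_all add: iter_partial_zero iter_partial_add schwartz_sum)

lemma iter_partial_helmholtz:
  assumes f: "schwartz f"
  shows "iter_partial is (helmholtz f) x = iter_partial is f x - (\<Sum>i\<in>UNIV. iter_partial (is @ [i, i]) f x)"
proof -
  have "helmholtz f = (\<lambda>x. f x + (- 1) * (\<Sum>i\<in>UNIV. partial_deriv i (partial_deriv i f) x))"
    by (simp add: helmholtz_def fun_eq_iff)
  moreover have "iter_partial is (partial_deriv i (partial_deriv i f)) = iter_partial (is @ [i, i]) f" for i
    by (simp add: iter_partial_snoc)
  ultimately show ?thesis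
    using f by (simp only: iter_partial_add iter_partial_cmult iter_partial_sum schwartz_cmult schwartz_sum
        schwartz_partial_deriv) simp
qed

text \<open>The induction runs over all index lists at once, because each application of the
  operator asks for two more derivatives. The identity part of I - \<Delta> is of lower order and is
  absorbed using M \<ge> 1. The point x is fixed throughout, so M and G may depend on it.\<close>

lemma helmholtz_power_bound:
  fixes c :: "'n::finite list \<Rightarrow> real"
  assumes c: "\<And>is. c is \<ge> 0"
  shows "\<exists>C\<ge>0. \<forall>(h :: real^'n \<Rightarrow> complex) x M G. schwartz h \<longrightarrow> M \<ge> 1 \<longrightarrow> G \<ge> 0 \<longrightarrow>
     (\<forall>is. norm (iter_partial is h x) \<le> c is * M ^ length is * G) \<longrightarrow>
     norm (iter_partial is ((helmholtz ^^ j) h) x) \<le> C * M ^ (length is + 2 * j) * G"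
proof (induction j arbitrary: "is")
  case 0
  show ?case using c by (intro exI[of _ "c is"]) simp
next
  case (Suc j)
  then obtain C where C: "\<And>is. C is \<ge> 0" "\<And>is (h :: real^'n \<Rightarrow> complex) x M G. schwartz h \<Longrightarrow> M \<ge> 1 \<Longrightarrow> G \<ge> 0 \<Longrightarrow>
     (\<And>is. norm (iter_partial is h x) \<le> c is * M ^ length is * G) \<Longrightarrow>
     norm (iter_partial is ((helmholtz ^^ j) h) x) \<le> C is * M ^ (length is + 2 * j) * G"
    by metis
  show ?case
  proof (intro exI[of _ "C is + (\<Sum>i\<in>UNIV. C (is @ [i, i]))"] conjI allI impI)
    show "0 \<le> C is + (\<Sum>i\<in>UNIV. C (is @ [i, i]))" using C(1) by (intro add_nonneg_nonneg sum_nonneg) auto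
    fix h :: "real^'n \<Rightarrow> complex" and x M G
    assume *: "schwartz h" "(M::real) \<ge> 1" "(G::real) \<ge> 0" "\<forall>is. norm (iter_partial is h x) \<le> c is * M ^ length is * G"
    let ?u = "(helmholtz ^^ j) h"
    have u: "schwartz ?u" by (rule schwartz_helmholtz_power[OF *(1)])
    have "norm (iter_partial is ((helmholtz ^^ Suc j) h) x) \<le> norm (iter_partial is ?u x) + (\<Sum>i\<in>UNIV. norm (iter_partial (is @ [i, i]) ?u x))"
      by (simp only: funpow.simps o_def iter_partial_helmholtz[OF u])
        (rule order_trans[OF norm_triangle_ineq4 add_left_mono[OF norm_sum]])
    also have "\<dots> \<le> C is * M ^ (length is + 2 * Suc j) * G + (\<Sum>i\<in>UNIV. C (is @ [i, i]) * M ^ (length is + 2 * Suc j) * G)"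
    proof (intro add_mono sum_mono)
      have "norm (iter_partial is ?u x) \<le> C is * M ^ (length is + 2 * j) * G" using * by (intro C(2)) auto
      also have "\<dots> \<le> C is * M ^ (length is + 2 * Suc j) * G"
        using * C(1) by (intro mult_right_mono mult_left_mono power_increasing) auto
      finally show "norm (iter_partial is ?u x) \<le> C is * M ^ (length is + 2 * Suc j) * G" .
      fix i
      have "norm (iter_partial (is @ [i, i]) ?u x) \<le> C (is @ [i, i]) * M ^ (length (is @ [i, i]) + 2 * j) * G" using * by (intro C(2)) auto
      then show "norm (iter_partial (is @ [i, i]) ?u x) \<le> C (is @ [i, i]) * M ^ (length is + 2 * Suc j) * G" by simp
    qed
    finally show "norm (iter_partial is ((helmholtz ^^ Suc j) h) x) \<le> (C is + (\<Sum>i\<in>UNIV. C (is @ [i, i]))) * M ^ (length is + 2 * Suc j) * G"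
      by (simp only: distrib_right sum_distrib_right)
  qed
qed

lemma schwartz_gexp_mult_fourier:
  assumes \<Psi>: "schwartz \<Psi>" and w: "Re w > 0"
  shows "schwartz (\<lambda>x. gexp w \<beta> a c x * fourier \<Psi> x)"
proof (rule schwartz_gexp_mult[OF _ _ w])
  show "iter_partial is (fourier \<Psi>) differentiable (at x)" for "is" x
    using fourier_schwartz[OF \<Psi>] unfolding schwartz_def by blast
  show "\<exists>C. \<forall>x. norm (iter_partial is (fourier \<Psi>) x) \<le> C" for "is"
    using schwartz_decay0[OF schwartz_iter_partial[OF fourier_schwartz[OF \<Psi>]], of 0] by simp
qed

abbreviation annulus :: "(real^'n) set" where
  "annulus \<equiv> {x. 1/2 \<le> norm x \<and> norm x \<le> 2}"

text \<open>The bound on \<open>glin\<close> is asked for on the annulus only, which is where |x| is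
  controlled; elsewhere the cutoff and all its derivatives vanish.\<close>

lemma helmholtz_power_gexp_bound:
  fixes \<Psi> :: "real^'n \<Rightarrow> complex"
  assumes \<Psi>: "schwartz \<Psi>" and supp: "\<And>\<xi>. fourier \<Psi> \<xi> \<noteq> 0 \<Longrightarrow> 1/2 < norm \<xi> \<and> norm \<xi> < 2"
  shows "\<exists>C\<ge>0. \<forall>w \<beta> a c x K V. Re w > 0 \<longrightarrow> 1 \<le> K \<longrightarrow> 1 \<le> V \<longrightarrow> norm w \<le> K\<^sup>2 \<longrightarrow>
     (x \<in> annulus \<longrightarrow> (\<forall>i. norm (glin w \<beta> a i x) \<le> K * V)) \<longrightarrow>
     norm ((helmholtz ^^ j) (\<lambda>x. gexp w \<beta> a c x * fourier \<Psi> x) x)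
       \<le> C * (K * V) ^ (2 * j) * norm (gexp w \<beta> a c x) * indicator annulus x"
proof -
  let ?\<rho> = "indicat_real (annulus :: (real^'n) set)"
  \<comment> \<open>Named so that one application of choice supplies the constants for all index
    lists simultaneously.\<close>
  define P where "P is C \<longleftrightarrow> 0 \<le> C \<and> (\<forall>w \<beta> a c x K V. 1 \<le> K \<longrightarrow> 1 \<le> V \<longrightarrow> norm w \<le> K\<^sup>2 \<longrightarrow> (\<forall>i. norm (glin w \<beta> a i x) \<le> K * V) \<longrightarrow>
     norm (iter_partial is (\<lambda>x. gexp w \<beta> a c x * fourier \<Psi> x) x) \<le> C * (K * V) ^ length is * norm (gexp w \<beta> a c x) * ?\<rho> x)" for "is" C
  have "\<exists>C. P is C" for "is"
    unfolding P_def
  proof (rule iter_partial_gexp_mult_bound)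
    show "iter_partial is (fourier \<Psi>) differentiable (at x)" for "is" x
      using fourier_schwartz[OF \<Psi>] unfolding schwartz_def by blast
  qed (use fourier_annulus_bound[OF \<Psi> supp] in auto)
  then obtain c0 where P: "\<And>is. P is (c0 is)" using choice[of P] by blast
  have c0: "c0 is \<ge> 0" for "is" using P[of "is"] by (simp add: P_def)
  have c0': "norm (iter_partial is (\<lambda>x. gexp w \<beta> a c x * fourier \<Psi> x) x) \<le> c0 is * (K * V) ^ length is * norm (gexp w \<beta> a c x) * ?\<rho> x"
    if "1 \<le> K" "1 \<le> V" "norm w \<le> K\<^sup>2" "\<And>i. norm (glin w \<beta> a i x) \<le> K * V" for "is" w \<beta> a c x K V
    using P[of "is"] that unfolding P_def by blast
  obtain C where C: "C \<ge> 0" "\<And>(h :: real^'n \<Rightarrow> complex) x M G. schwartz h \<Longrightarrow> M \<ge> 1 \<Longrightarrow> G \<ge> 0 \<Longrightarrow>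
     (\<And>is. norm (iter_partial is h x) \<le> c0 is * M ^ length is * G) \<Longrightarrow>
     norm (iter_partial [] ((helmholtz ^^ j) h) x) \<le> C * M ^ (length ([]::'n list) + 2 * j) * G"
    using helmholtz_power_bound[of c0 "[]" j, OF c0] by blast
  have main: "norm ((helmholtz ^^ j) (\<lambda>x. gexp w \<beta> a c x * fourier \<Psi> x) x) \<le> C * (K * V) ^ (2 * j) * (norm (gexp w \<beta> a c x) * ?\<rho> x)"
    if "Re w > 0" "1 \<le> K" "1 \<le> V" "norm w \<le> K\<^sup>2" "\<And>i. norm (glin w \<beta> a i x) \<le> K * V" for w \<beta> a c x and K V :: real
  proof -
    have "1 * 1 \<le> K * V" using that by (intro mult_mono) auto
    then show ?thesis
      using C(2)[of "\<lambda>x. gexp w \<beta> a c x * fourier \<Psi> x" "K * V" "norm (gexp w \<beta> a c x) * ?\<rho> x" x] that c0'[of K V w \<beta> a x]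
      by (simp add: schwartz_gexp_mult_fourier[OF \<Psi>] mult.assoc)
  qed
  show ?thesis
  proof (intro exI[of _ C] conjI allI impI C(1))
    fix w \<beta> c and a x :: "real^'n" and K V :: real
    assume *: "Re w > 0" "1 \<le> K" "1 \<le> V" "norm w \<le> K\<^sup>2" "x \<in> annulus \<longrightarrow> (\<forall>i. norm (glin w \<beta> a i x) \<le> K * V)"
    show "norm ((helmholtz ^^ j) (\<lambda>x. gexp w \<beta> a c x * fourier \<Psi> x) x)
       \<le> C * (K * V) ^ (2 * j) * norm (gexp w \<beta> a c x) * ?\<rho> x"
    proof (cases "x \<in> annulus")
      case True
      then show ?thesis using main[of w K V \<beta> a x c] * by (simp add: mult.assoc)
    next
      case False
      \<comment> \<open>Off the annulus the indicator makes the estimate zero, so any weight large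
        enough for \<open>main\<close> to apply will do.\<close>
      define V' where "V' = 1 + (\<Sum>i\<in>UNIV. norm (glin w \<beta> a i x))"
      have le: "norm (glin w \<beta> a i x) \<le> V'" for i
        using member_le_sum[of i UNIV "\<lambda>i. norm (glin w \<beta> a i x)"] by (simp add: V'_def)
      have V': "1 \<le> V'" by (simp add: V'_def sum_nonneg)
      have "V' \<le> K * V'" using *(2) V' by simp
      then have le': "norm (glin w \<beta> a i x) \<le> K * V'" for i using le[of i] by linarith
      have "norm ((helmholtz ^^ j) (\<lambda>x. gexp w \<beta> a c x * fourier \<Psi> x) x)
         \<le> C * (K * V') ^ (2 * j) * (norm (gexp w \<beta> a c x) * ?\<rho> x)"
        by (rule main[OF *(1,2) V' *(4) le'])
      then show ?thesis using False by simp
    qed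
  qed
qed

section \<open>Estimates on the annulus and the two families of test multipliers\<close>

lemma gauss_scaled_eq_gexp:
  "gauss z (q *\<^sub>R \<xi> - a) = gexp (of_real (pi * q\<^sup>2) * z) (of_real (2 * pi * q) * z) a (- (of_real (pi * (norm a)\<^sup>2) * z)) \<xi>"
proof -
  have T: "(norm (q *\<^sub>R \<xi> - a))\<^sup>2 = q\<^sup>2 * (norm \<xi>)\<^sup>2 - 2 * q * (a \<bullet> \<xi>) + (norm a)\<^sup>2"
    unfolding power2_norm_eq_inner
    by (simp add: inner_diff_left inner_diff_right inner_commute power2_eq_square[of q] algebra_simps)
  show ?thesis
    unfolding gauss_eq gexp_def T by (intro arg_cong[of _ _ exp]) (simp add: algebra_simps)
qed

text \<open>From (t / 2 - 1)^2 \<ge> 0. The first form absorbs polynomial weights into exp (- pi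
  t^2) with decay to spare; the second, with a quarter, is matched to the tail exp (- L^2 / 4) of
  the bump.\<close>

lemma power_le_exp_square:
  fixes t :: real
  assumes "t \<ge> 0"
  shows "(1 + t) ^ N \<le> fact N * exp (2 + t\<^sup>2)" "(1 + t) ^ N \<le> fact N * exp (2 + t\<^sup>2 / 4)"
proof -
  have "0 \<le> (t / 2 - 1)\<^sup>2" by simp
  also have "\<dots> = t\<^sup>2 / 4 - t + 1" by (simp add: power2_eq_square field_simps)
  finally have *: "1 + t \<le> 2 + t\<^sup>2 / 4" by simp
  then have "exp (1 + t) \<le> exp (2 + t\<^sup>2 / 4)" by simp
  then show 1: "(1 + t) ^ N \<le> fact N * exp (2 + t\<^sup>2 / 4)"
    using power_le_fact_exp[OF assms, of N] by (meson fact_ge_zero mult_left_mono order_trans)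
  have "exp (2 + t\<^sup>2 / 4) \<le> exp (2 + t\<^sup>2)" by simp
  then show "(1 + t) ^ N \<le> fact N * exp (2 + t\<^sup>2)"
    using 1 by (meson fact_ge_zero mult_left_mono order_trans)
qed

lemma emeasure_annulus_finite: "emeasure lborel (annulus :: (real^'n) set) < \<infinity>"
proof -
  have "emeasure lborel (annulus :: (real^'n) set) \<le> emeasure lborel (cball 0 2 :: (real^'n) set)"
    by (intro emeasure_mono) auto
  then show ?thesis using emeasure_lborel_cball_finite order_le_less_trans by blast
qed

lemma annulus_sets [measurable]: "annulus \<in> sets borel"
  by measurable

text \<open>With m the volume of the annulus, 1 + m replaces m powr (1 / r): it is at least 1, so
  its r-th power dominates m whatever the size of m.\<close>

lemma Lp_bound_annulus:
  fixes f :: "real^'n \<Rightarrow> complex"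
  assumes f: "\<And>x. norm (f x) \<le> A * indicator annulus x" and "A \<ge> 0" and r: "r > 1"
  shows "(\<integral>\<^sup>+x. ennreal (norm (f x) powr r) \<partial>lborel) \<le> ennreal ((A * (1 + measure lborel (annulus :: (real^'n) set))) powr r)"
proof -
  let ?m = "measure lborel (annulus :: (real^'n) set)"
  have "(\<integral>\<^sup>+x. ennreal (norm (f x) powr r) \<partial>lborel) \<le> (\<integral>\<^sup>+x. ennreal (A powr r) * indicator annulus x \<partial>(lborel :: (real^'n) measure))"
  proof (rule nn_integral_mono)
    fix x :: "real^'n"
    have "norm (f x) powr r \<le> (A * indicator annulus x) powr r" using r by (intro powr_mono2 f) auto
    then show "ennreal (norm (f x) powr r) \<le> ennreal (A powr r) * indicator annulus x"
      by (auto simp: indicator_def ennreal_leI)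
  qed
  also have "\<dots> = ennreal (A powr r) * emeasure lborel (annulus :: (real^'n) set)"
    by (rule nn_integral_cmult_indicator) measurable
  also have "emeasure lborel (annulus :: (real^'n) set) = ennreal ?m"
    by (rule emeasure_eq_ennreal_measure) (rule less_imp_neq[OF emeasure_annulus_finite, unfolded infinity_ennreal_def])
  also have "\<dots> \<le> ennreal ((1 + ?m) powr r)"
  proof (intro ennreal_leI)
    have "?m \<le> (1 + ?m) powr 1" by simp
    also have "\<dots> \<le> (1 + ?m) powr r" using r by (intro powr_mono) auto
    finally show "?m \<le> (1 + ?m) powr r" .
  qed
  finally show ?thesis using \<open>A \<ge> 0\<close> by (simp add: ennreal_mult'[symmetric] powr_mult mult_left_mono)
qed

text \<open>The frequency K and the growth V are kept apart: V is integrated against the Gaussian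
  and enters through A, so only K is raised to the power s. The exponent N is the one belonging to
  the higher power l + 1; as V is at least 1, it serves the power l too.\<close>

lemma sobolev_norm_gexp_bound:
  fixes \<Psi> :: "real^'n \<Rightarrow> complex" and r s :: real
  assumes \<Psi>: "schwartz \<Psi>" and supp: "\<And>\<xi>. fourier \<Psi> \<xi> \<noteq> 0 \<Longrightarrow> 1/2 < norm \<xi> \<and> norm \<xi> < 2"
    and r: "r > 1" and s: "s > 0"
  obtains N :: nat and C :: real where "C \<ge> 0"
    "\<And>w \<beta> a c K V A. Re w > 0 \<Longrightarrow> 1 \<le> K \<Longrightarrow> norm w \<le> K\<^sup>2 \<Longrightarrow> V \<in> borel_measurable borel \<Longrightarrow> (\<And>x. 1 \<le> V x) \<Longrightarrow>
      (\<And>x i. x \<in> annulus \<Longrightarrow> norm (glin w \<beta> a i x) \<le> K * V x) \<Longrightarrow> A \<ge> 0 \<Longrightarrow>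
      (\<integral>\<^sup>+x. ennreal ((V x ^ N * norm (gexp w \<beta> a c x) * indicator annulus x) powr r) \<partial>(lborel :: (real^'n) measure)) \<le> ennreal (A powr r) \<Longrightarrow>
      sobolev_norm r s (\<lambda>x. gexp w \<beta> a c x * fourier \<Psi> x) \<le> ennreal (C * A * K powr s)"
proof (rule sobolev_norm_bound[OF r s, where ?'n = 'n])
  fix l :: nat and C0 :: real
  assume C0: "C0 \<ge> 0"
    "\<And>(h :: real^'n \<Rightarrow> complex) X K. schwartz h \<Longrightarrow> X \<ge> 0 \<Longrightarrow> K > 0 \<Longrightarrow>
     (\<And>j. j \<in> {l, Suc l} \<Longrightarrow> (\<integral>\<^sup>+x. ennreal (norm ((helmholtz ^^ j) h x) powr r) \<partial>lborel) \<le> ennreal ((X * K ^ (2 * j)) powr r)) \<Longrightarrow>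
     sobolev_norm r s h \<le> ennreal (C0 * X * K powr s)"
  define P where "P j C \<longleftrightarrow> 0 \<le> C \<and> (\<forall>w \<beta> a c x K V. Re w > 0 \<longrightarrow> 1 \<le> K \<longrightarrow> 1 \<le> V \<longrightarrow> norm w \<le> K\<^sup>2 \<longrightarrow>
     (x \<in> annulus \<longrightarrow> (\<forall>i. norm (glin w \<beta> a i x) \<le> K * V)) \<longrightarrow>
     norm ((helmholtz ^^ j) (\<lambda>x. gexp w \<beta> a c x * fourier \<Psi> x) x)
       \<le> C * (K * V) ^ (2 * j) * norm (gexp w \<beta> a c x) * indicator annulus x)" for j C
  have "\<exists>C. P j C" for j
    unfolding P_def by (rule helmholtz_power_gexp_bound[OF \<Psi> supp])
  then obtain D where D: "\<And>j. P j (D j)" using choice[of P] by blast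
  have D0: "D j \<ge> 0" for j using D[of j] by (simp add: P_def)
  define E where "E = D l + D (Suc l)"
  have E: "E \<ge> 0" "\<And>j. j \<in> {l, Suc l} \<Longrightarrow> D j \<le> E" using D0 by (auto simp: E_def)
  show ?thesis
  proof (rule that[of "C0 * E" "2 * Suc l"])
    show "0 \<le> C0 * E" using C0(1) E(1) by simp
    fix w \<beta> c and a :: "real^'n" and K A :: real and V :: "real^'n \<Rightarrow> real"
    assume w: "Re w > 0" and K: "1 \<le> K" "norm w \<le> K\<^sup>2" and mV: "V \<in> borel_measurable borel" and V: "\<And>x. 1 \<le> V x"
      and lin: "\<And>x i. x \<in> annulus \<Longrightarrow> norm (glin w \<beta> a i x) \<le> K * V x" and A: "A \<ge> 0"
      and int: "(\<integral>\<^sup>+x. ennreal ((V x ^ (2 * Suc l) * norm (gexp w \<beta> a c x) * indicator annulus x) powr r) \<partial>(lborel :: (real^'n) measure)) \<le> ennreal (A powr r)"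
    let ?h = "\<lambda>x. gexp w \<beta> a c x * fourier \<Psi> x"
    let ?F = "\<lambda>x. V x ^ (2 * Suc l) * norm (gexp w \<beta> a c x) * indicat_real annulus x"
    note [measurable] = mV
    have [measurable]: "gexp w \<beta> a c \<in> borel_measurable borel"
      by (rule schwartz_borel[OF schwartz_gexp[OF w]])
    have h: "schwartz ?h" by (rule schwartz_gexp_mult_fourier[OF \<Psi> w])
    have "(\<integral>\<^sup>+x. ennreal (norm ((helmholtz ^^ j) ?h x) powr r) \<partial>lborel) \<le> ennreal ((E * A * K ^ (2 * j)) powr r)" if j: "j \<in> {l, Suc l}" for j
    proof -
      have pw: "norm ((helmholtz ^^ j) ?h x) \<le> E * K ^ (2 * j) * ?F x" for x
      proof -
        have "norm ((helmholtz ^^ j) ?h x) \<le> D j * (K * V x) ^ (2 * j) * norm (gexp w \<beta> a c x) * indicator annulus x"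
          using D[of j] w K V[of x] lin[of x] unfolding P_def by blast
        also have "\<dots> = D j * K ^ (2 * j) * (V x ^ (2 * j) * (norm (gexp w \<beta> a c x) * indicator annulus x))"
          by (simp add: power_mult_distrib mult_ac)
        also have "\<dots> \<le> E * K ^ (2 * j) * (V x ^ (2 * Suc l) * (norm (gexp w \<beta> a c x) * indicator annulus x))"
        proof (rule mult_mono[OF mult_right_mono[OF E(2)[OF j]] mult_right_mono])
          show "V x ^ (2 * j) \<le> V x ^ (2 * Suc l)" using j by (intro power_increasing V) auto
        qed (use K E(1) order_trans[OF zero_le_one V[of x]] in auto)
        finally show ?thesis by (simp add: mult.assoc)
      qed
      have F0: "?F x \<ge> 0" for x using order_trans[OF zero_le_one V[of x]] by simp
      have "(\<integral>\<^sup>+x. ennreal (norm ((helmholtz ^^ j) ?h x) powr r) \<partial>lborel) \<le> (\<integral>\<^sup>+x. ennreal ((E * K ^ (2 * j)) powr r) * ennreal (?F x powr r) \<partial>lborel)"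
      proof (rule nn_integral_mono)
        fix x
        have "norm ((helmholtz ^^ j) ?h x) powr r \<le> (E * K ^ (2 * j) * ?F x) powr r" using r by (intro powr_mono2 pw) auto
        also have "\<dots> = (E * K ^ (2 * j)) powr r * ?F x powr r" by (rule powr_mult)
        finally show "ennreal (norm ((helmholtz ^^ j) ?h x) powr r) \<le> ennreal ((E * K ^ (2 * j)) powr r) * ennreal (?F x powr r)"
          by (simp only: ennreal_mult'[symmetric] powr_ge_zero ennreal_leI)
      qed
      also have "\<dots> = ennreal ((E * K ^ (2 * j)) powr r) * (\<integral>\<^sup>+x. ennreal (?F x powr r) \<partial>lborel)"
        by (rule nn_integral_cmult) measurable
      also have "\<dots> \<le> ennreal ((E * K ^ (2 * j)) powr r) * ennreal (A powr r)"
        by (intro mult_left_mono int) simp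
      also have "\<dots> = ennreal ((E * A * K ^ (2 * j)) powr r)"
        by (simp add: ennreal_mult'[symmetric] powr_mult mult_ac)
      finally show ?thesis .
    qed
    then have "sobolev_norm r s ?h \<le> ennreal (C0 * (E * A) * K powr s)"
      using K E A by (intro C0(2) h) auto
    then show "sobolev_norm r s ?h \<le> ennreal (C0 * E * A * K powr s)" by (simp add: mult.assoc)
  qed
qed

text \<open>At scale q = 2^k the chirp has frequency of order q^2 |z| on the annulus, which grows
  with q, but there its modulus is at most exp (- pi q^2 / 4). The exponential outweighs the power
  of q, so the supremum over k costs only a constant times |z| powr s.\<close>

lemma hormander_const_chirp:
  fixes \<Psi> :: "real^'n \<Rightarrow> complex" and r s :: real
  assumes \<Psi>: "schwartz \<Psi>" and supp: "\<And>\<xi>. fourier \<Psi> \<xi> \<noteq> 0 \<Longrightarrow> 1/2 < norm \<xi> \<and> norm \<xi> < 2"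
    and r: "r > 1" and s: "s > 0"
  obtains B :: real where "B \<ge> 0"
    "\<And>z. Re z = 1 \<Longrightarrow> hormander_const \<Psi> r s (\<lambda>\<xi>. gauss z (\<xi> - 0)) \<le> ennreal (B * norm z powr s)"
proof (rule sobolev_norm_gexp_bound[OF \<Psi> supp r s])
  fix N :: nat and C :: real
  assume C: "C \<ge> 0" and bound: "\<And>w \<beta> a c K V A. Re w > 0 \<Longrightarrow> 1 \<le> K \<Longrightarrow> norm w \<le> K\<^sup>2 \<Longrightarrow> V \<in> borel_measurable borel \<Longrightarrow> (\<And>x. 1 \<le> V x) \<Longrightarrow>
      (\<And>x i. x \<in> annulus \<Longrightarrow> norm (glin w \<beta> a i x) \<le> K * V x) \<Longrightarrow> A \<ge> 0 \<Longrightarrow>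
      (\<integral>\<^sup>+x. ennreal ((V x ^ N * norm (gexp w \<beta> a c x) * indicator annulus x) powr r) \<partial>(lborel :: (real^'n) measure)) \<le> ennreal (A powr r) \<Longrightarrow>
      sobolev_norm r s (\<lambda>x. gexp w \<beta> a c x * fourier \<Psi> x) \<le> ennreal (C * A * K powr s)"
  let ?m = "1 + measure lborel (annulus :: (real^'n) set)"
  obtain M :: nat where M: "s \<le> real M" using real_arch_simple by blast
  define D :: real where "D = 16 powr s * (fact M * exp 1)"
  show ?thesis
  proof (rule that[of "C * ?m * D"])
    show "0 \<le> C * ?m * D" using C by (simp add: D_def)
    fix z :: complex assume z: "Re z = 1"
    have nz: "norm z \<ge> 1" using complex_Re_le_cmod[of z] z by simp
    have one: "sobolev_norm r s (\<lambda>\<xi>. gauss z (q *\<^sub>R \<xi> - 0) * fourier \<Psi> \<xi>) \<le> ennreal (C * ?m * D * norm z powr s)" if q: "q > 0" for q :: real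
    proof -
      let ?w = "of_real (pi * q\<^sup>2) * z" and ?\<beta> = "of_real (2 * pi * q) * z" and ?c = "- (of_real (pi * (norm (0::real^'n))\<^sup>2) * z)"
      \<comment> \<open>The least decay exponent pi q^2 |x|^2 on the annulus, attained at |x| =
        1/2.\<close>
      define y where "y = pi * q\<^sup>2 / 4"
      have y: "y > 0" using q by (simp add: y_def)
      \<comment> \<open>On the annulus \<open>glin\<close> is at most 2 |w| |x| \<le> 4 |w|, and |w|
        = 4 y |z|.\<close>
      define K where "K = 1 + 16 * y * norm z"
      have K: "K \<ge> 1" using y by (simp add: K_def)
      have nw: "norm ?w = 4 * y * norm z" using q by (simp add: norm_mult norm_power y_def)
      have yz: "0 \<le> y * norm z" using y by simp
      have "norm ?w \<le> K" unfolding nw K_def using yz by linarith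
      also have "K \<le> K\<^sup>2" using K by (simp add: self_le_power)
      finally have wK: "norm ?w \<le> K\<^sup>2" .
      have "sobolev_norm r s (\<lambda>\<xi>. gexp ?w ?\<beta> 0 ?c \<xi> * fourier \<Psi> \<xi>) \<le> ennreal (C * (exp (- y) * ?m) * K powr s)"
      proof (rule bound[where V = "\<lambda>x. 1"])
        show "norm (glin ?w ?\<beta> 0 i x) \<le> K * 1" if "x \<in> annulus" for x :: "real^'n" and i
        proof -
          have "norm (glin ?w ?\<beta> 0 i x) = 2 * norm ?w * \<bar>x $ i\<bar>" by (simp add: glin_def norm_mult)
          also have "\<dots> \<le> 2 * norm ?w * 2"
            using that component_le_norm_cart[of x i] by (intro mult_left_mono) auto
          also have "\<dots> \<le> K" unfolding nw K_def by simp
          finally show ?thesis by simp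
        qed
        have "(\<integral>\<^sup>+x. ennreal (norm (complex_of_real (1 ^ N * norm (gexp ?w ?\<beta> 0 ?c x) * indicator annulus x)) powr r) \<partial>(lborel :: (real^'n) measure)) \<le> ennreal ((exp (- y) * ?m) powr r)"
        proof (rule Lp_bound_annulus)
          fix x :: "real^'n"
          show "norm (complex_of_real (1 ^ N * norm (gexp ?w ?\<beta> 0 ?c x) * indicator annulus x)) \<le> exp (- y) * indicator annulus x"
          proof (cases "x \<in> annulus")
            case True
            have "(1/2)\<^sup>2 \<le> (norm x)\<^sup>2" using True by (intro power_mono) auto
            then have "pi * q\<^sup>2 * (1/4) \<le> pi * q\<^sup>2 * (norm x)\<^sup>2"
              by (intro mult_left_mono) (auto simp: power2_eq_square)
            then show ?thesis using True z by (simp add: norm_gexp y_def)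
          qed simp
        qed (use r in auto)
        then show "(\<integral>\<^sup>+x. ennreal ((1 ^ N * norm (gexp ?w ?\<beta> 0 ?c x) * indicator annulus x) powr r) \<partial>(lborel :: (real^'n) measure)) \<le> ennreal ((exp (- y) * ?m) powr r)"
          by (simp only: norm_of_real abs_of_nonneg mult_nonneg_nonneg zero_le_power norm_ge_zero zero_le_one indicator_pos_le)
      qed (use q z K wK in auto)
      also have "\<dots> \<le> ennreal (C * ?m * D * norm z powr s)"
      proof (intro ennreal_leI)
        \<comment> \<open>Since |z| \<ge> 1, it can be factored out of K. The remaining (1 + y) powr
          s is bounded by a multiple of exp y, which the factor exp (- y) cancels.\<close>
        have "K \<le> 16 * (1 + y) * norm z" using nz y by (simp add: K_def algebra_simps)
        then have "K powr s \<le> (16 * (1 + y) * norm z) powr s" using K s by (intro powr_mono2) auto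
        also have "\<dots> = 16 powr s * (1 + y) powr s * norm z powr s" by (simp only: powr_mult)
        also have "(1 + y) powr s \<le> fact M * exp (1 + y)"
        proof -
          have "(1 + y) powr s \<le> (1 + y) powr real M" using M y by (intro powr_mono) auto
          also have "\<dots> = (1 + y) ^ M" using y by (simp add: powr_realpow)
          also have "\<dots> \<le> fact M * exp (1 + y)" using y by (intro power_le_fact_exp) simp
          finally show ?thesis .
        qed
        finally have "K powr s \<le> 16 powr s * (fact M * exp (1 + y)) * norm z powr s" by (simp add: mult_left_mono mult_right_mono)
        then have "C * (exp (- y) * ?m) * K powr s \<le> C * (exp (- y) * ?m) * (16 powr s * (fact M * exp (1 + y)) * norm z powr s)"
          using C by (intro mult_left_mono) auto
        also have "\<dots> = C * ?m * (16 powr s * (fact M * (exp (- y) * exp (1 + y)))) * norm z powr s" by (simp only: mult_ac)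
        also have "exp (- y) * exp (1 + y) = exp 1" by (simp add: exp_add[symmetric])
        finally show "C * (exp (- y) * ?m) * K powr s \<le> C * ?m * D * norm z powr s" by (simp add: D_def)
      qed
      finally show ?thesis unfolding gauss_scaled_eq_gexp .
    qed
    show "hormander_const \<Psi> r s (\<lambda>\<xi>. gauss z (\<xi> - 0)) \<le> ennreal (C * ?m * D * norm z powr s)"
      unfolding hormander_const_def by (intro SUP_least one) simp
  qed
qed

text \<open>At scale q = 2^k the piece is a Gaussian of width 1 / (L q) around a / q. Its frequency
  is about L q and its L^r norm about (L q) powr (- n / r), which gives (L q) powr (s - n / r). The
  exponent is negative, so scales q \<ge> 1/2 are worst at q = 1/2. For smaller q the centre lies
  far outside the annulus and only a Gaussian tail remains.\<close>

lemma hormander_const_bump: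
  fixes \<Psi> :: "real^'n \<Rightarrow> complex" and r s :: real and a :: "real^'n"
  assumes \<Psi>: "schwartz \<Psi>" and supp: "\<And>\<xi>. fourier \<Psi> \<xi> \<noteq> 0 \<Longrightarrow> 1/2 < norm \<xi> \<and> norm \<xi> < 2"
    and r: "r > 1" and s: "s > 0" and a: "norm a = 1" and rs: "r * s < real CARD('n)"
  obtains B :: real where "B \<ge> 0"
    "\<And>L. L \<ge> 1 \<Longrightarrow> hormander_const \<Psi> r s (\<lambda>\<xi>. gauss (of_real (L\<^sup>2)) (\<xi> - a)) \<le> ennreal (B * L powr (s - real CARD('n) / r))"
proof (rule sobolev_norm_gexp_bound[OF \<Psi> supp r s])
  fix N :: nat and C :: real
  assume C: "C \<ge> 0" and bound: "\<And>w \<beta> a c K V A. Re w > 0 \<Longrightarrow> 1 \<le> K \<Longrightarrow> norm w \<le> K\<^sup>2 \<Longrightarrow> V \<in> borel_measurable borel \<Longrightarrow> (\<And>x. 1 \<le> V x) \<Longrightarrow>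
      (\<And>x i. x \<in> annulus \<Longrightarrow> norm (glin w \<beta> a i x) \<le> K * V x) \<Longrightarrow> A \<ge> 0 \<Longrightarrow>
      (\<integral>\<^sup>+x. ennreal ((V x ^ N * norm (gexp w \<beta> a c x) * indicator annulus x) powr r) \<partial>(lborel :: (real^'n) measure)) \<le> ennreal (A powr r) \<Longrightarrow>
      sobolev_norm r s (\<lambda>x. gexp w \<beta> a c x * fourier \<Psi> x) \<le> ennreal (C * A * K powr s)"
  let ?m = "1 + measure lborel (annulus :: (real^'n) set)" and ?n = "real CARD('n)"
  define D :: real where "D = fact N * exp 2"
  define e where "e = s - ?n / r"
  have e: "e < 0" using rs r by (simp add: e_def field_simps)
  have D: "D \<ge> 0" by (simp add: D_def)
  obtain M :: nat where M: "?n / r \<le> real M" using real_arch_simple by blast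
  define E where "E = (r / pi) powr (- ?n / (2 * r))"
  define B1 where "B1 = C * (D * E) * (2 + 2 * pi) powr s * (1/2) powr e"
  define B2 where "B2 = C * (D * ?m) * (1 + 2 * pi) powr s * (fact M * exp 2)"
  have B: "B1 \<ge> 0" "B2 \<ge> 0" using C D by (simp_all add: B1_def B2_def E_def)
  show ?thesis
  proof (rule that[of "B1 + B2"])
    show "0 \<le> B1 + B2" using B by simp
    fix L :: real assume L: "L \<ge> 1"
    let ?z = "complex_of_real (L\<^sup>2)"
    \<comment> \<open>No power of 2 lies strictly between 1/4 and 1/2. This gap keeps a / q at
      distance at least 2 from the annulus in the second case.\<close>
    have one: "sobolev_norm r s (\<lambda>\<xi>. gauss ?z (q *\<^sub>R \<xi> - a) * fourier \<Psi> \<xi>) \<le> ennreal ((B1 + B2) * L powr e)"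
      if q: "q > 0" and q': "q \<ge> 1/2 \<or> q \<le> 1/4" for q :: real
    proof -
      let ?w = "of_real (pi * q\<^sup>2) * ?z" and ?\<beta> = "of_real (2 * pi * q) * ?z" and ?c = "- (of_real (pi * (norm a)\<^sup>2) * ?z)"
      \<comment> \<open>The displacement from the centre measured in units of the width 1 / (L q).
        The modulus of the Gaussian depends on it alone, and \<open>glin\<close> is linear in it
        with coefficient 2 pi L q, whence K and V = 1 + |v|.\<close>
      let ?v = "\<lambda>x. L *\<^sub>R (q *\<^sub>R x - a)"
      define K where "K = 1 + 2 * pi * (L * q)"
      have Lq: "L * q > 0" using L q by simp
      have K: "K \<ge> 1" using Lq by (simp add: K_def)
      have wK: "norm ?w \<le> K\<^sup>2"
      proof -
        have "norm ?w = pi * (L * q)\<^sup>2" using q by (simp add: norm_mult power_mult_distrib norm_power)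
        also have "\<dots> \<le> (4 * pi * pi) * (L * q)\<^sup>2" using pi_gt3 by (intro mult_right_mono) auto
        also have "\<dots> = (2 * pi * (L * q))\<^sup>2" by (simp add: power2_eq_square)
        also have "\<dots> \<le> K\<^sup>2" using Lq by (intro power_mono) (auto simp: K_def)
        finally show ?thesis .
      qed
      have lin: "norm (glin ?w ?\<beta> a i x) \<le> K * (1 + norm (?v x))" for x i
      proof -
        have "glin ?w ?\<beta> a i x = of_real (- (2 * pi * (L * q)) * (?v x $ i))"
          by (simp add: glin_def power2_eq_square algebra_simps)
        then have "norm (glin ?w ?\<beta> a i x) = (2 * pi * (L * q)) * \<bar>?v x $ i\<bar>"
          using abs_of_pos[of "2 * pi * (L * q)"] Lq by (simp only: norm_of_real abs_mult[of "- (2 * pi * (L * q))"] abs_minus_cancel) simp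
        also have "\<dots> \<le> K * (1 + norm (?v x))"
          using Lq component_le_norm_cart[of "?v x" i] by (intro mult_mono) (auto simp: K_def)
        finally show ?thesis .
      qed
      have gx: "norm (gexp ?w ?\<beta> a ?c x) = exp (- pi * (norm (?v x))\<^sup>2)" for x
        unfolding gauss_scaled_eq_gexp[symmetric] norm_gauss by (simp add: power_mult_distrib)
      have F: "(1 + norm (?v x)) ^ N * norm (gexp ?w ?\<beta> a ?c x) \<le> D * exp (- (norm (?v x))\<^sup>2)" for x
      proof -
        have "(1 + norm (?v x)) ^ N * norm (gexp ?w ?\<beta> a ?c x) \<le> (fact N * exp (2 + (norm (?v x))\<^sup>2)) * exp (- pi * (norm (?v x))\<^sup>2)"
          unfolding gx by (intro mult_right_mono power_le_exp_square) auto
        also have "\<dots> = fact N * exp (2 + (norm (?v x))\<^sup>2 + - pi * (norm (?v x))\<^sup>2)"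
          by (simp only: exp_add mult.assoc)
        also have "\<dots> \<le> fact N * exp (2 + - (norm (?v x))\<^sup>2)"
        proof (intro mult_left_mono)
          have "2 * (norm (?v x))\<^sup>2 \<le> pi * (norm (?v x))\<^sup>2" using pi_gt3 by (intro mult_right_mono) auto
          then show "exp (2 + (norm (?v x))\<^sup>2 + - pi * (norm (?v x))\<^sup>2) \<le> exp (2 + - (norm (?v x))\<^sup>2)" by simp
        qed simp
        also have "\<dots> = D * exp (- (norm (?v x))\<^sup>2)" by (simp only: D_def exp_add mult.assoc)
        finally show ?thesis .
      qed
      let ?F = "\<lambda>x. (1 + norm (?v x)) ^ N * norm (gexp ?w ?\<beta> a ?c x) * indicat_real annulus x"
      have sob: "sobolev_norm r s (\<lambda>\<xi>. gauss ?z (q *\<^sub>R \<xi> - a) * fourier \<Psi> \<xi>) \<le> ennreal (C * A * K powr s)"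
        if A: "A \<ge> 0" "(\<integral>\<^sup>+x. ennreal (?F x powr r) \<partial>lborel) \<le> ennreal (A powr r)" for A
        unfolding gauss_scaled_eq_gexp
      proof (rule bound[OF _ K wK _ _ lin A])
        show "Re ?w > 0" using q L by simp
        show "(\<lambda>x. 1 + norm (?v x)) \<in> borel_measurable borel" by measurable
      qed simp
      show ?thesis
      proof (cases "q \<ge> 1/2")
        case True
        have "(\<integral>\<^sup>+x. ennreal (?F x powr r) \<partial>lborel) \<le> ennreal ((D * E * (L * q) powr (- ?n / r)) powr r)"
        proof -
          let ?t = "r * (L * q)\<^sup>2 / pi"
          have t: "?t > 0" using r by (intro divide_pos_pos mult_pos_pos zero_less_power Lq) auto
          have "(\<integral>\<^sup>+x. ennreal (?F x powr r) \<partial>lborel) \<le> (\<integral>\<^sup>+x. ennreal (D powr r) * ennreal (exp (- (pi * ?t) * (norm (x + - (1 / q) *\<^sub>R a))\<^sup>2)) \<partial>lborel)"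
          proof (rule nn_integral_mono)
            fix x :: "real^'n"
            have "?F x \<le> D * exp (- (norm (?v x))\<^sup>2)"
              using F[of x] D by (auto simp: indicator_def)
            then have "?F x powr r \<le> (D * exp (- (norm (?v x))\<^sup>2)) powr r" using r by (intro powr_mono2) auto
            also have "\<dots> = D powr r * exp (- (norm (?v x))\<^sup>2) powr r" by (rule powr_mult)
            also have "exp (- (norm (?v x))\<^sup>2) powr r = exp (- (r * (norm (?v x))\<^sup>2))" by (simp add: exp_powr_real)
            also have "- (r * (norm (?v x))\<^sup>2) = - (pi * ?t) * (norm (x + - (1 / q) *\<^sub>R a))\<^sup>2"
            proof -
              have "?v x = (L * q) *\<^sub>R (x + - (1 / q) *\<^sub>R a)" using q by (simp add: algebra_simps)
              then show ?thesis by (simp only: norm_scaleR power_mult_distrib power2_abs) simp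
            qed
            finally show "ennreal (?F x powr r) \<le> ennreal (D powr r) * ennreal (exp (- (pi * ?t) * (norm (x + - (1 / q) *\<^sub>R a))\<^sup>2))"
              by (simp only: ennreal_mult'[symmetric] powr_ge_zero ennreal_leI)
          qed
          also have "\<dots> = ennreal (D powr r) * (\<integral>\<^sup>+x. ennreal (exp (- (pi * ?t) * (norm (x + - (1 / q) *\<^sub>R a))\<^sup>2)) \<partial>lborel)"
            by (rule nn_integral_cmult) measurable
          also have "(\<integral>\<^sup>+x. ennreal (exp (- (pi * ?t) * (norm (x + - (1 / q) *\<^sub>R a))\<^sup>2)) \<partial>lborel) = (\<integral>\<^sup>+x. ennreal (exp (- (pi * ?t) * (norm x)\<^sup>2)) \<partial>(lborel :: (real^'n) measure))"
            by (rule nn_integral_lborel_translate) measurable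
          also have "\<dots> = ennreal (?t powr (- ?n / 2))" using nn_integral_exp_square[OF t, where 'a = "real^'n"] by simp
          also have "ennreal (D powr r) * ennreal (?t powr (- ?n / 2)) = ennreal ((D * E * (L * q) powr (- ?n / r)) powr r)"
          proof -
            have "?t powr (- ?n / 2) = (r / pi) powr (- ?n / 2) * ((L * q)\<^sup>2) powr (- ?n / 2)"
              by (simp flip: powr_mult)
            also have "((L * q)\<^sup>2) powr (- ?n / 2) = (L * q) powr (- ?n)"
              using Lq by (simp add: powr_powr flip: powr_numeral)
            also have "(L * q) powr (- ?n) = ((L * q) powr (- ?n / r)) powr r" using r by (simp add: powr_powr)
            also have "(r / pi) powr (- ?n / 2) = E powr r" using r by (simp add: E_def powr_powr)
            finally show ?thesis by (simp only: powr_mult ennreal_mult'[symmetric] powr_ge_zero mult.assoc)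
          qed
          finally show ?thesis .
        qed
        from sob[OF _ this] have "sobolev_norm r s (\<lambda>\<xi>. gauss ?z (q *\<^sub>R \<xi> - a) * fourier \<Psi> \<xi>) \<le> ennreal (C * (D * E * (L * q) powr (- ?n / r)) * K powr s)"
          using D by (simp add: E_def)
        also have "\<dots> \<le> ennreal ((B1 + B2) * L powr e)"
        proof (intro ennreal_leI)
          have "1 / 2 \<le> L * q" using mult_mono[of 1 L "1/2" q] L True by simp
          then have "K \<le> (2 + 2 * pi) * (L * q)" by (simp add: K_def algebra_simps)
          then have "K powr s \<le> ((2 + 2 * pi) * (L * q)) powr s" using K s by (intro powr_mono2) auto
          also have "\<dots> = (2 + 2 * pi) powr s * (L * q) powr s" by (rule powr_mult)
          finally have "C * (D * E * (L * q) powr (- ?n / r)) * K powr s \<le> C * (D * E * (L * q) powr (- ?n / r)) * ((2 + 2 * pi) powr s * (L * q) powr s)"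
            using C D by (intro mult_left_mono) (auto simp: E_def)
          also have "\<dots> = C * (D * E) * (2 + 2 * pi) powr s * ((L * q) powr (- ?n / r) * (L * q) powr s)"
            by (simp only: mult_ac)
          also have "(L * q) powr (- ?n / r) * (L * q) powr s = (L * q) powr e"
            by (simp add: e_def powr_add[symmetric])
          \<comment> \<open>Here r s < n is used: e is negative, so the power decreases in q and is
            largest at q = 1/2.\<close>
          also have "C * (D * E) * (2 + 2 * pi) powr s * (L * q) powr e \<le> C * (D * E) * (2 + 2 * pi) powr s * (L * (1/2)) powr e"
          proof (intro mult_left_mono)
            show "(L * q) powr e \<le> (L * (1/2)) powr e"
              using L True e by (intro powr_mono2') auto
          qed (use C D in \<open>auto simp: E_def\<close>)
          also have "\<dots> = B1 * L powr e" by (simp only: B1_def powr_mult mult_ac)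
          also have "\<dots> \<le> (B1 + B2) * L powr e" using B by (intro mult_right_mono) auto
          finally show "C * (D * E * (L * q) powr (- ?n / r)) * K powr s \<le> (B1 + B2) * L powr e" .
        qed
        finally show ?thesis .
      next
        case False
        then have q4: "q \<le> 1/4" using q' by simp
        have "(\<integral>\<^sup>+x. ennreal (norm (complex_of_real (?F x)) powr r) \<partial>lborel) \<le> ennreal (((D * exp (- L\<^sup>2 / 4)) * ?m) powr r)"
        proof (rule Lp_bound_annulus)
          fix x :: "real^'n"
          show "norm (complex_of_real (?F x)) \<le> D * exp (- L\<^sup>2 / 4) * indicator annulus x"
          proof (cases "x \<in> annulus")
            case True
            have "q * norm x \<le> 1/4 * 2" using True q q4 by (intro mult_mono) auto
            moreover have "norm a - norm (q *\<^sub>R x) \<le> norm (q *\<^sub>R x - a)"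
              using norm_triangle_ineq2[of a "q *\<^sub>R x"] by (simp add: norm_minus_commute)
            ultimately have "1/2 \<le> norm (q *\<^sub>R x - a)" using a q by simp
            then have "L * (1/2) \<le> norm (?v x)" using L by simp
            then have "(L * (1/2))\<^sup>2 \<le> (norm (?v x))\<^sup>2" using L by (intro power_mono) auto
            then have le: "L\<^sup>2 / 4 \<le> (norm (?v x))\<^sup>2" by (simp add: power2_eq_square)
            have "norm (complex_of_real (?F x)) = (1 + norm (?v x)) ^ N * norm (gexp ?w ?\<beta> a ?c x)"
              using True by (simp only: norm_of_real abs_of_nonneg) (simp add: abs_mult)
            also have "\<dots> \<le> D * exp (- (norm (?v x))\<^sup>2)" by (rule F)
            also have "\<dots> \<le> D * exp (- L\<^sup>2 / 4)" using le D by (intro mult_left_mono) auto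
            finally show ?thesis using True by simp
          qed simp
        qed (use r D in auto)
        moreover have "norm (complex_of_real (?F x)) = ?F x" for x
          by (simp only: norm_of_real abs_of_nonneg mult_nonneg_nonneg zero_le_power add_nonneg_nonneg norm_ge_zero zero_le_one indicator_pos_le)
        ultimately have "(\<integral>\<^sup>+x. ennreal (?F x powr r) \<partial>lborel) \<le> ennreal (((D * exp (- L\<^sup>2 / 4)) * ?m) powr r)" by (simp only:)
        from sob[OF _ this] have "sobolev_norm r s (\<lambda>\<xi>. gauss ?z (q *\<^sub>R \<xi> - a) * fourier \<Psi> \<xi>) \<le> ennreal (C * (D * exp (- L\<^sup>2 / 4) * ?m) * K powr s)"
          using D by simp
        also have "\<dots> \<le> ennreal ((B1 + B2) * L powr e)"
        proof (intro ennreal_leI)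
          have "L * q \<le> L * 1" using L q4 by (intro mult_left_mono) auto
          then have "2 * pi * (L * q) \<le> 2 * pi * L" by (intro mult_left_mono) auto
          then have "K \<le> (1 + 2 * pi) * L" using L unfolding K_def distrib_right mult_1_left by linarith
          then have "K powr s \<le> ((1 + 2 * pi) * L) powr s" using K s by (intro powr_mono2) auto
          also have "\<dots> = (1 + 2 * pi) powr s * L powr s" by (rule powr_mult)
          \<comment> \<open>Only L powr e may survive. The surplus L powr (n / r) is bounded by a
            multiple of exp (L^2 / 4) and cancelled by the Gaussian tail.\<close>
          also have "L powr s = L powr (?n / r) * L powr e" by (simp add: e_def powr_add[symmetric])
          also have "L powr (?n / r) \<le> fact M * exp (2 + L\<^sup>2 / 4)"
          proof -
            have "L powr (?n / r) \<le> L powr real M" using L M by (intro powr_mono) auto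
            also have "\<dots> = L ^ M" using L by (simp add: powr_realpow)
            also have "\<dots> \<le> (1 + L) ^ M" using L by (intro power_mono) auto
            also have "\<dots> \<le> fact M * exp (2 + L\<^sup>2 / 4)" using L by (intro power_le_exp_square) simp
            finally show ?thesis .
          qed
          finally have "K powr s \<le> (1 + 2 * pi) powr s * (fact M * exp (2 + L\<^sup>2 / 4) * L powr e)"
            by (simp add: mult_left_mono mult_right_mono)
          then have "C * (D * exp (- L\<^sup>2 / 4) * ?m) * K powr s \<le> C * (D * exp (- L\<^sup>2 / 4) * ?m) * ((1 + 2 * pi) powr s * (fact M * exp (2 + L\<^sup>2 / 4) * L powr e))"
            using C D by (intro mult_left_mono) auto
          also have "\<dots> = C * (D * ?m) * (1 + 2 * pi) powr s * (fact M * (exp (- L\<^sup>2 / 4) * exp (2 + L\<^sup>2 / 4))) * L powr e"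
            by (simp only: mult_ac)
          also have "exp (- L\<^sup>2 / 4) * exp (2 + L\<^sup>2 / 4) = exp 2" by (simp add: exp_add[symmetric])
          also have "C * (D * ?m) * (1 + 2 * pi) powr s * (fact M * exp 2) * L powr e \<le> (B1 + B2) * L powr e"
            unfolding B2_def[symmetric] using B by (intro mult_right_mono) auto
          finally show "C * (D * exp (- L\<^sup>2 / 4) * ?m) * K powr s \<le> (B1 + B2) * L powr e" .
        qed
        finally show ?thesis .
      qed
    qed
    have "(2::real) powi k \<ge> 1/2 \<or> (2::real) powi k \<le> 1/4" for k :: int
    proof (cases "k \<ge> - 1")
      case True
      then have "(2::real) powi (- 1) \<le> 2 powi k" by (intro power_int_increasing) auto
      then show ?thesis by (simp add: power_int_minus)
    next
      case False
      then have "(2::real) powi k \<le> 2 powi (- 2)" by (intro power_int_increasing) auto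
      then show ?thesis by (simp add: power_int_minus)
    qed
    then show "hormander_const \<Psi> r s (\<lambda>\<xi>. gauss ?z (\<xi> - a)) \<le> ennreal ((B1 + B2) * L powr (s - ?n / r))"
      unfolding hormander_const_def e_def[symmetric] by (intro SUP_least one) simp_all
  qed
qed

section \<open>Letting the parameters tend to infinity, and the theorem\<close>

lemma exponent_nonpos_if_bounded:
  fixes c e D :: real
  assumes "c > 0" and bd: "\<And>m. m \<ge> 2 \<Longrightarrow> c * m powr e \<le> D"
  shows "e \<le> 0"
proof (rule ccontr)
  assume "\<not> e \<le> 0"
  then have e: "e > 0" by simp
  \<comment> \<open>Large enough that c m powr e is at least |D| + c, which exceeds D.\<close>
  define m where "m = max 2 ((\<bar>D\<bar> / c + 1) powr (1 / e))"
  have "\<bar>D\<bar> / c + 1 = ((\<bar>D\<bar> / c + 1) powr (1 / e)) powr e"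
    using e \<open>c > 0\<close> by (simp add: powr_powr add_nonneg_pos)
  also have "\<dots> \<le> m powr e" using e by (intro powr_mono2) (auto simp: m_def)
  finally have "c * (\<bar>D\<bar> / c + 1) \<le> c * m powr e" using \<open>c > 0\<close> by (intro mult_left_mono) auto
  also have "\<dots> \<le> D" by (rule bd) (simp add: m_def)
  finally show False using \<open>c > 0\<close> by (simp add: distrib_left)
qed

lemma Linfty_gauss:
  fixes a :: "real^'n"
  assumes "Re z > 0"
  shows "Linfty (\<lambda>\<xi>. gauss z (\<xi> - a))"
  unfolding Linfty_def
proof
  show "(\<lambda>\<xi>. gauss z (\<xi> - a)) \<in> borel_measurable lebesgue"
    by (rule borel_measurable_lebesgue) measurable
  show "\<exists>B. AE \<xi> in lebesgue. norm (gauss z (\<xi> - a)) \<le> B"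
    using assms by (intro exI[of _ 1] AE_I2) (simp add: norm_gauss)
qed

text \<open>The assumed multiplier inequality is applied here. A bound for the Hormander constant
  both makes the multiplier admissible and limits the explicit Gaussian ratio on the left.\<close>

lemma multiplier_test:
  fixes \<Psi> :: "real^'n \<Rightarrow> complex" and p r s C B :: real and a :: "real^'n"
  assumes hyp: "\<And>\<sigma>. Linfty \<sigma> \<Longrightarrow> hormander_const \<Psi> r s \<sigma> < \<infinity> \<Longrightarrow>
      Lp_op_norm p (multiplier_op \<sigma>) \<le> ennreal C * hormander_const \<Psi> r s \<sigma>"
    and "C \<ge> 0" "B \<ge> 0" "p > 0" and z0: "Re z0 > 0" and z1: "Re z1 > 0"
    and B: "hormander_const \<Psi> r s (\<lambda>\<xi>. gauss z1 (\<xi> - a)) \<le> ennreal B"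
  shows "(norm z0 / norm (z0 + z1)) powr (real CARD('n) / 2) *
            (Re (1 / z0) / Re (1 / (z0 + z1))) powr (real CARD('n) / (2 * p)) \<le> C * B"
proof -
  have fin: "hormander_const \<Psi> r s (\<lambda>\<xi>. gauss z1 (\<xi> - a)) < \<infinity>"
    using B by (simp add: le_less_trans[OF _ ennreal_less_top])
  have "ennreal ((norm z0 / norm (z0 + z1)) powr (real CARD('n) / 2) *
            (Re (1 / z0) / Re (1 / (z0 + z1))) powr (real CARD('n) / (2 * p)))
      \<le> Lp_op_norm p (multiplier_op (\<lambda>\<xi>. gauss z1 (\<xi> - a)))"
    by (rule Lp_op_norm_gauss_ge[OF z0 z1 \<open>p > 0\<close>])
  also have "\<dots> \<le> ennreal C * hormander_const \<Psi> r s (\<lambda>\<xi>. gauss z1 (\<xi> - a))"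
    by (rule hyp[OF Linfty_gauss[OF z1] fin])
  also have "\<dots> \<le> ennreal C * ennreal B" by (intro mult_left_mono B) simp
  also have "\<dots> = ennreal (C * B)" using \<open>C \<ge> 0\<close> by (simp add: ennreal_mult')
  finally show ?thesis using \<open>C \<ge> 0\<close> \<open>B \<ge> 0\<close> by (simp only: ennreal_le_iff mult_nonneg_nonneg)
qed

theorem proposition4p1:
  fixes \<Psi> :: "real^'n \<Rightarrow> complex" and p r s :: real
  assumes "littlewood_paley \<Psi>"
    and "1 < p" and "1 < r" and "0 < s"
    and "\<exists>C::ennreal. C < \<infinity> \<and>
           (\<forall>\<sigma>. Linfty \<sigma> \<and> hormander_const \<Psi> r s \<sigma> < \<infinity> \<longrightarrow>
              Lp_op_norm p (multiplier_op \<sigma>) \<le> C * hormander_const \<Psi> r s \<sigma>)"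
  shows "r * s \<ge> real CARD('n) \<and> \<bar>1 / p - 1 / 2\<bar> \<le> s / real CARD('n)"
proof -
  let ?n = "real CARD('n)"
  have n: "?n > 0" by simp
  have \<Psi>: "schwartz \<Psi>" and supp: "\<And>\<xi>. fourier \<Psi> \<xi> \<noteq> 0 \<Longrightarrow> 1/2 < norm \<xi> \<and> norm \<xi> < 2"
    using assms(1) unfolding littlewood_paley_def by blast+
  obtain C' :: ennreal where C': "C' < \<infinity>" "\<And>\<sigma>. Linfty \<sigma> \<Longrightarrow> hormander_const \<Psi> r s \<sigma> < \<infinity> \<Longrightarrow>
      Lp_op_norm p (multiplier_op \<sigma>) \<le> C' * hormander_const \<Psi> r s \<sigma>"
    using assms(5) by blast
  define C where "C = enn2real C'"
  have C: "C \<ge> 0" "C' = ennreal C" using C'(1) by (simp_all add: C_def)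
  note hyp = C'(2)[unfolded C(2)]
  have p: "p > 0" using assms(2) by simp
  have "r * s \<ge> ?n"
  proof (rule ccontr)
    assume "\<not> r * s \<ge> ?n"
    then have rs: "r * s < ?n" by simp
    define a :: "real^'n" where "a = axis undefined 1"
    have a: "norm a = 1" by (simp add: a_def)
    show False
    proof (rule hormander_const_bump[OF \<Psi> supp assms(3,4) a rs])
      fix B :: real
      assume B: "B \<ge> 0" "\<And>L. L \<ge> 1 \<Longrightarrow> hormander_const \<Psi> r s (\<lambda>\<xi>. gauss (of_real (L\<^sup>2)) (\<xi> - a)) \<le> ennreal (B * L powr (s - ?n / r))"
      \<comment> \<open>With z0 = z1 = L^2 the ratio of moduli is 1/2 and the ratio of the Re (1 /
        z) is 2, so the lower bound for the operator norm does not depend on L.\<close>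
      define c where "c = (1 / 2 :: real) powr (?n / 2) * 2 powr (?n / (2 * p))"
      have c: "c > 0" unfolding c_def by simp
      have "c * L powr (?n / r - s) \<le> C * B" if L: "L \<ge> 2" for L
      proof -
        let ?z = "complex_of_real (L\<^sup>2)"
        have z: "Re ?z > 0" using L by simp
        have "norm ?z / norm (?z + ?z) = 1 / 2" using L by (simp add: norm_mult flip: mult_2)
        moreover have "Re (1 / ?z) / Re (1 / (?z + ?z)) = 2"
          using L by (simp add: Re_inverse_eq norm_mult norm_power power2_eq_square flip: mult_2)
        ultimately have "c \<le> C * (B * L powr (s - ?n / r))"
          using multiplier_test[OF hyp C(1) _ p z z B(2)[of L]] L B(1) by (simp add: c_def)
        then have "c * L powr (?n / r - s) \<le> C * (B * L powr (s - ?n / r)) * L powr (?n / r - s)"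
          by (intro mult_right_mono) auto
        also have "\<dots> = C * B * (L powr (s - ?n / r) * L powr (?n / r - s))" by (simp only: mult_ac)
        also have "\<dots> = C * B" using L by (simp add: powr_add[symmetric])
        finally show ?thesis .
      qed
      then have "?n / r - s \<le> 0" by (rule exponent_nonpos_if_bounded[OF c])
      then show False using rs assms(3) by (simp add: field_simps)
    qed
  qed
  moreover have "\<bar>1 / p - 1 / 2\<bar> \<le> s / ?n"
  proof (rule hormander_const_chirp[OF \<Psi> supp assms(3,4)])
    fix B :: real
    assume B: "B \<ge> 0" "\<And>z. Re z = 1 \<Longrightarrow> hormander_const \<Psi> r s (\<lambda>\<xi>. gauss z (\<xi> - 0)) \<le> ennreal (B * norm z powr s)"
    have test: "(norm z0 / norm (z0 + z1)) powr (?n / 2) * (Re (1 / z0) / Re (1 / (z0 + z1))) powr (?n / (2 * p)) \<le> C * (B * norm z1 powr s)"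
      if "Re z0 = 1" "Re z1 = 1" for z0 z1
      using that B C(1) p by (intro multiplier_test[OF hyp, where a = 0]) auto
    \<comment> \<open>The two one-sided inequalities are proved for every p without a case
      distinction; this one is informative for p < 2, the next one for p > 2, and together they
      bound the absolute value.\<close>
    have "?n / p - ?n / 2 - s \<le> 0"
    proof (rule exponent_nonpos_if_bounded)
      show "(1 / 2 :: real) powr (?n / (2 * p)) > 0" by simp
      fix m :: real assume m: "m \<ge> 2"
      \<comment> \<open>Spreading, with z0 = 1. The imaginary part is chosen so that 1 + z has
        modulus exactly m, which requires m \<ge> 2. The amplitude drops by m powr (- n / 2), while
        Re (1 / (1 + z)) = 2 / m^2 means a width of order m and contributes m powr (n / p) up to a
        constant.\<close>
      let ?z = "Complex 1 (sqrt (m\<^sup>2 - 4))"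
      have sq: "(m\<^sup>2) powr (?n / (2 * p)) = m powr (?n / p)"
        using m by (simp add: powr_powr flip: powr_numeral)
      have m4: "m\<^sup>2 \<ge> 4" using power_mono[OF m, of 2] by simp
      have nm: "norm (1 + ?z) = m" using m m4 by (simp add: cmod_def)
      have nz: "norm ?z \<le> m"
        using m m4 by (simp add: cmod_def real_le_lsqrt)
      have R: "Re (1 / (1 + ?z)) = 2 / m\<^sup>2" unfolding Re_inverse_eq nm by simp
      have "(1 / m) powr (?n / 2) * (m\<^sup>2 * (1 / 2)) powr (?n / (2 * p)) \<le> C * (B * norm ?z powr s)"
        using test[of 1 ?z] by (simp add: nm R)
      also have "\<dots> \<le> C * (B * m powr s)"
        using nz C(1) B(1) assms(4) by (intro mult_left_mono powr_mono2) auto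
      also have "(m\<^sup>2 * (1 / 2)) powr (?n / (2 * p)) = m powr (?n / p) * (1 / 2) powr (?n / (2 * p))"
        by (simp only: powr_mult sq)
      also have "(1 / m) powr (?n / 2) = m powr (- (?n / 2))"
        using m by (simp only: powr_divide powr_minus_divide powr_one_eq_one)
      finally have "m powr (- (?n / 2)) * (m powr (?n / p) * (1 / 2) powr (?n / (2 * p))) * m powr (- s) \<le> C * (B * m powr s) * m powr (- s)"
        by (intro mult_right_mono) auto
      also have "C * (B * m powr s) * m powr (- s) = C * B * (m powr s * m powr (- s))" by (simp only: mult_ac)
      also have "m powr s * m powr (- s) = 1" using m by (simp add: powr_add[symmetric])
      also have "m powr (- (?n / 2)) * (m powr (?n / p) * (1 / 2) powr (?n / (2 * p))) * m powr (- s) =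
          (1 / 2) powr (?n / (2 * p)) * (m powr (?n / p) * m powr (- (?n / 2)) * m powr (- s))" by (simp only: mult_ac)
      also have "m powr (?n / p) * m powr (- (?n / 2)) * m powr (- s) = m powr (?n / p - ?n / 2 - s)"
        by (simp add: powr_add[symmetric])
      finally show "(1 / 2) powr (?n / (2 * p)) * m powr (?n / p - ?n / 2 - s) \<le> C * B * 1" .
    qed
    moreover have "?n / 2 - ?n / p - s \<le> 0"
    proof (rule exponent_nonpos_if_bounded)
      show "(1 / 2 :: real) powr (?n / 2) * 2 powr (?n / (2 * p)) > 0" by simp
      fix m :: real assume m: "m \<ge> 2"
      let ?y = "sqrt (m\<^sup>2 - 1)"
      \<comment> \<open>Focusing: z0 and z1 are conjugate of modulus m, so the multiplier cancels
        the oscillation of the input and the sum is the fixed number 2. The amplitude rises by (m /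
        2) powr (n / 2), and the shrinking width costs m powr (- n / p) up to a constant.\<close>
      let ?z0 = "Complex 1 (- ?y)" and ?z1 = "Complex 1 ?y"
      have sq: "(m\<^sup>2) powr (?n / (2 * p)) = m powr (?n / p)"
        using m by (simp add: powr_powr flip: powr_numeral)
      have m1: "m\<^sup>2 \<ge> 1" using power_mono[OF m, of 2] by simp
      have nz: "norm ?z0 = m" "norm ?z1 = m" using m m1 by (simp_all add: cmod_def)
      have sum: "?z0 + ?z1 = 2" by (simp add: complex_eq_iff)
      have R: "Re (1 / ?z0) = 1 / m\<^sup>2" unfolding Re_inverse_eq nz by simp
      have "(m * (1 / 2)) powr (?n / 2) * ((1 / m\<^sup>2) * 2) powr (?n / (2 * p)) \<le> C * (B * m powr s)"
        using test[of ?z0 ?z1] by (simp add: nz sum R)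
      also have "((1 / m\<^sup>2) * 2) powr (?n / (2 * p)) = m powr (- (?n / p)) * 2 powr (?n / (2 * p))"
        by (simp only: powr_mult powr_divide sq powr_one_eq_one powr_minus_divide)
      also have "(m * (1 / 2)) powr (?n / 2) = m powr (?n / 2) * (1 / 2) powr (?n / 2)" by (rule powr_mult)
      finally have "m powr (?n / 2) * (1 / 2) powr (?n / 2) * (m powr (- (?n / p)) * 2 powr (?n / (2 * p))) * m powr (- s) \<le> C * (B * m powr s) * m powr (- s)"
        by (intro mult_right_mono) auto
      also have "C * (B * m powr s) * m powr (- s) = C * B * (m powr s * m powr (- s))" by (simp only: mult_ac)
      also have "m powr s * m powr (- s) = 1" using m by (simp add: powr_add[symmetric])
      also have "m powr (?n / 2) * (1 / 2) powr (?n / 2) * (m powr (- (?n / p)) * 2 powr (?n / (2 * p))) * m powr (- s) =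
          (1 / 2) powr (?n / 2) * 2 powr (?n / (2 * p)) * (m powr (?n / 2) * m powr (- (?n / p)) * m powr (- s))" by (simp only: mult_ac)
      also have "m powr (?n / 2) * m powr (- (?n / p)) * m powr (- s) = m powr (?n / 2 - ?n / p - s)"
        by (simp add: powr_add[symmetric])
      finally show "(1 / 2) powr (?n / 2) * 2 powr (?n / (2 * p)) * m powr (?n / 2 - ?n / p - s) \<le> C * B * 1" .
    qed
    ultimately have "\<bar>?n / p - ?n / 2\<bar> \<le> s" by linarith
    moreover have "\<bar>?n / p - ?n / 2\<bar> = ?n * \<bar>1 / p - 1 / 2\<bar>"
    proof -
      have "?n / p - ?n / 2 = ?n * (1 / p - 1 / 2)" by (simp add: right_diff_distrib)
      then show ?thesis by (simp only: abs_mult abs_of_nat)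
    qed
    ultimately have "?n * \<bar>1 / p - 1 / 2\<bar> \<le> s" by (simp only:)
    then show ?thesis unfolding pos_le_divide_eq[OF n] by (simp only: mult.commute)
  qed
  ultimately show ?thesis by blast
qed

end
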